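(* Let $$l_2=\lambda_2,\qquad l_1=\lambda_2\cos(\xi+\xi_0),\qquad l_3=\lambda_2\sin(\xi+\xi_0)$$ be solutions of Lamé's system, where $\xi=\alpha_1x_1+\alpha_3x_3$ and $\alpha_1,\alpha_3,\lambda_2,\xi_0$ are real constants with $\alpha_1\cdot\alpha_3\neq0$. Then the associated conformally flat hypersurfaces are conformal to the product $$M^2\times I=\{tp:\ 0<t<\infty,\ p\in M^2\}\subset\mathbb{R}^4,$$ where $M^2\subset\mathbb{S}^3$ is locally congruent to a helicoidal flat surface.
   Context: Lamé's system for functions $(l_1,l_2,l_3):U\subset\mathbb{R}^3\to\mathbb{R}$ of $(x_1,x_2,x_3)$ is $$l_{i,x_jx_k}-\frac{l_{i,x_j}l_{j,x_k}}{l_j}-\frac{l_{i,x_k}l_{k,x_j}}{l_k}=0,\qquad \left(\frac{l_{i,x_j}}{l_j}\right)_{,x_j}+\left(\frac{l_{j,x_i}}{l_i}\right)_{,x_i}+\frac{l_{i,x_k}l_{j,x_k}}{l_k^2}=0,$$ for distinct indices $i,j,k\in\{1,2,3\}$, together with the Guichard condition $l_1^2-l_2^2+l_3^2=0$; subscripts after a comma denote partial derivatives, and the system is considered where the $l_i$ do not vanish. By a result of Hertrich-Jeromin, solutions of Lamé's system satisfying the Guichard condition correspond to conformally flat hypersurfaces with three distinct principal curvatures in a $4$-dimensional space form $M^4_K$ (constant sectional curvature $K$). The hypersurface associated with $(l_1,l_2,l_3)$ is parametrized by curvature lines, with induced metric $g=e^{2u}\{l_1^2(dx_1)^2+l_2^2(dx_2)^2+l_3^2(dx_3)^2\}$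 for some function $u$. $\mathbb{S}^3\subset\mathbb{R}^4$ is the unit sphere. A surface in $\mathbb{S}^3$ is flat if its induced metric has zero Gauss curvature. It is helicoidal if it is invariant under the action of a $1$-parameter group of isometries $$\phi_{\alpha,\beta}(t)=\begin{pmatrix}\cos\alpha t&-\sin\alpha t&0&0\\ \sin\alpha t&\cos\alpha t&0&0\\ 0&0&\cos\beta t&-\sin\beta t\\ 0&0&\sin\beta t&\cos\beta t\end{pmatrix},\qquad \alpha,\beta\in\mathbb{R},$$ with the standing assumption $\alpha\neq\pm\beta$.
   Formalization: For α1 = ±α3 the helicoidal group is only asserted nontrivial, (α,β) ≠ (0,0), since the standing assumption α ≠ ±β fails there (the surface is a Hopf cylinder); α ≠ ±β is proved in all other cases. The domain U is taken open and connected. *)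

theory Defs
  imports "HOL-Analysis.Analysis"
begin

section \<open>Smooth maps\<close>

text \<open>Meaningful on open sets only.\<close>

primrec Ck_on :: "nat \<Rightarrow> 'a::euclidean_space set \<Rightarrow> ('a \<Rightarrow> 'b::real_normed_vector) \<Rightarrow> bool" where
  "Ck_on 0 S f \<longleftrightarrow> continuous_on S f"
| "Ck_on (Suc k) S f \<longleftrightarrow>
     f differentiable_on S \<and> (\<forall>b\<in>Basis. Ck_on k S (\<lambda>x. frechet_derivative f (at x) b))"

definition smooth_on :: "'a::euclidean_space set \<Rightarrow> ('a \<Rightarrow> 'b::real_normed_vector) \<Rightarrow> bool" where
  "smooth_on S f \<longleftrightarrow> (\<forall>k. Ck_on k S f)"

definition diffeomorphism_between ::
    "('a::euclidean_space \<Rightarrow> 'b::euclidean_space) \<Rightarrow> 'a set \<Rightarrow> 'b set \<Rightarrow> bool" where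
  "diffeomorphism_between h S T \<longleftrightarrow>
     open S \<and> open T \<and> bij_betw h S T \<and> smooth_on S h \<and> smooth_on T (inv_into S h)"

definition pd :: "'n::finite \<Rightarrow> (real^'n \<Rightarrow> 'b::real_normed_vector) \<Rightarrow> real^'n \<Rightarrow> 'b" where
  "pd i f x = frechet_derivative f (at x) (axis i 1)"


section \<open>Lame's system with the Guichard condition\<close>

text \<open>In the type \<open>3\<close> the numeral 3 denotes the same element as 0, so 1, 2, 3 are its three
  distinct elements.\<close>

definition lame_system :: "(real^3) set \<Rightarrow> (3 \<Rightarrow> real^3 \<Rightarrow> real) \<Rightarrow> bool" where
  "lame_system U l \<longleftrightarrow>
     (\<forall>i. smooth_on U (l i)) \<and> (\<forall>x\<in>U. \<forall>i. l i x \<noteq> 0) \<and>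
     (\<forall>x\<in>U. \<forall>i j k. i \<noteq> j \<and> j \<noteq> k \<and> i \<noteq> k \<longrightarrow>
        pd k (pd j (l i)) x - pd j (l i) x * pd k (l j) x / l j x
          - pd k (l i) x * pd j (l k) x / l k x = 0 \<and>
        pd j (\<lambda>y. pd j (l i) y / l j y) x + pd i (\<lambda>y. pd i (l j) y / l i y) x
          + pd k (l i) x * pd k (l j) x / (l k x)\<^sup>2 = 0)"

definition guichard_condition :: "(real^3) set \<Rightarrow> (3 \<Rightarrow> real^3 \<Rightarrow> real) \<Rightarrow> bool" where
  "guichard_condition U l \<longleftrightarrow> (\<forall>x\<in>U. (l 1 x)\<^sup>2 - (l 2 x)\<^sup>2 + (l 3 x)\<^sup>2 = 0)"


section \<open>Space forms and their hypersurfaces\<close>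

text \<open>
  The four-dimensional space form of curvature \<open>K\<close> is realised, for all \<open>K\<close> at once, as the quadric
  \<open>s\<^sup>2 + K |y|\<^sup>2 = 1\<close> in the space of pairs \<open>(s, y)\<close>, with the metric induced by
  \<open>|dy|\<^sup>2 + ds\<^sup>2 / K\<close>. For \<open>K > 0\<close> the substitution \<open>s = \<surd>K s'\<close> turns it into the round sphere of radius
  \<open>1 / \<surd>K\<close>, for \<open>K < 0\<close> the sheet \<open>s > 0\<close> is the hyperboloid model of hyperbolic space, and
  for \<open>K = 0\<close> one gets the affine hyperplane \<open>s = 1\<close>, where the term \<open>s s' / 0 = 0\<close> drops out and the
  metric is the Euclidean one.\<close>

definition space_form :: "real \<Rightarrow> (real \<times> (real^4)) set" where
  "space_form K = {(s, y). s\<^sup>2 + K * (y \<bullet> y) = 1 \<and> (K \<le> 0 \<longrightarrow> s > 0)}"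

definition tangent_space :: "real \<Rightarrow> real \<times> (real^4) \<Rightarrow> (real \<times> (real^4)) set" where
  "tangent_space K P = {v. fst P * fst v + K * (snd P \<bullet> snd v) = 0}"

definition sf_metric :: "real \<Rightarrow> real \<times> (real^4) \<Rightarrow> real \<times> (real^4) \<Rightarrow> real" where
  "sf_metric K v w = snd v \<bullet> snd w + fst v * fst w / K"

text \<open>
  The hypersurfaces associated with \<open>l\<close>: curvature line parametrizations \<open>f\<close> with three distinct
  principal curvatures \<open>\<kappa> 1, \<kappa> 2, \<kappa> 3\<close> and induced metric \<open>e\<^sup>2\<^sup>u \<Sum> l\<^sub>i\<^sup>2 dx\<^sub>i\<^sup>2\<close>. Since \<open>N\<close> is tangent to the
  quadric and orthogonal to \<open>f\<close>, its flat derivative is its Levi-Civita derivative, so the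
  last condition is the Weingarten equation with diagonal shape operator. If \<open>l\<close> solves Lame's
  system, then \<open>\<Sum> l\<^sub>i\<^sup>2 dx\<^sub>i\<^sup>2\<close> is a flat metric, whence \<open>f\<close> is conformally flat.\<close>

definition associated_hypersurface ::
    "real \<Rightarrow> (3 \<Rightarrow> real^3 \<Rightarrow> real) \<Rightarrow> (real^3) set \<Rightarrow> (real^3 \<Rightarrow> real \<times> (real^4)) \<Rightarrow> bool" where
  "associated_hypersurface K l U f \<longleftrightarrow>
     smooth_on U f \<and> f ` U \<subseteq> space_form K \<and>
     (\<exists>u. smooth_on U u \<and>
        (\<forall>x\<in>U. \<forall>i j. sf_metric K (pd i f x) (pd j f x) =
            (if i = j then exp (2 * u x) * (l i x)\<^sup>2 else 0))) \<and>
     (\<exists>N \<kappa>. smooth_on U N \<and>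
        (\<forall>x\<in>U. N x \<in> tangent_space K (f x) \<and> sf_metric K (N x) (N x) = 1 \<and>
           (\<forall>i. sf_metric K (N x) (pd i f x) = 0) \<and>
           inj (\<lambda>i::3. \<kappa> i x) \<and>
           (\<forall>i. pd i N x = - \<kappa> i x *\<^sub>R pd i f x)))"


section \<open>Conformal equivalence of hypersurfaces\<close>

text \<open>Maps on (relatively) open subsets of the space form are given as restrictions of smooth
  maps on open sets \<open>\<Omega>\<close> of the ambient vector space; only their derivatives on tangent vectors
  matter.\<close>

definition conformal_embedding ::
    "real \<Rightarrow> (real \<times> (real^4) \<Rightarrow> real^4) \<Rightarrow> (real \<times> (real^4)) set \<Rightarrow> bool" where
  "conformal_embedding K \<Phi> \<Omega> \<longleftrightarrow>
     open \<Omega> \<and> smooth_on \<Omega> \<Phi> \<and> inj_on \<Phi> (\<Omega> \<inter> space_form K) \<and>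
     (\<forall>P \<in> \<Omega> \<inter> space_form K. \<exists>\<rho>>0. \<forall>v\<in>tangent_space K P. \<forall>w\<in>tangent_space K P.
        frechet_derivative \<Phi> (at P) v \<bullet> frechet_derivative \<Phi> (at P) w = \<rho> * sf_metric K v w)"

text \<open>Conformality is extrinsic: a conformal map between open parts of the ambient spaces carries
  the hypersurface \<open>f\<close> of the space form onto the hypersurface \<open>F\<close> of \<open>\<real>\<^sup>4\<close>, up to a change of
  parameters \<open>h\<close>. (Any two conformally flat 3-manifolds are locally conformal intrinsically.)\<close>

definition conformally_equivalent ::
    "real \<Rightarrow> (real^3 \<Rightarrow> real \<times> (real^4)) \<Rightarrow> (real^3) set \<Rightarrow>
     (real \<times> (real^2) \<Rightarrow> real^4) \<Rightarrow> (real \<times> (real^2)) set \<Rightarrow> bool" where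
  "conformally_equivalent K f U F D \<longleftrightarrow>
     (\<exists>h \<Phi> \<Omega>. diffeomorphism_between h U D \<and> conformal_embedding K \<Phi> \<Omega> \<and> f ` U \<subseteq> \<Omega> \<and>
        (\<forall>x\<in>U. \<Phi> (f x) = F (h x)))"


section \<open>Surfaces in the unit 3-sphere\<close>

text \<open>Surfaces are immersed. An orbit of a one-parameter group may be dense in a torus, hence
  helicoidal surfaces need not be embedded submanifolds.\<close>

definition spherical_surface :: "(real^2 \<Rightarrow> real^4) \<Rightarrow> (real^2) set \<Rightarrow> bool" where
  "spherical_surface p V \<longleftrightarrow>
     open V \<and> connected V \<and> smooth_on V p \<and>
     (\<forall>v\<in>V. norm (p v) = 1 \<and> inj (frechet_derivative p (at v)))"

definition induced_metric :: "(real^2 \<Rightarrow> real^4) \<Rightarrow> real^2 \<Rightarrow> real^2^2" where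
  "induced_metric p v = (\<chi> i j. pd i p v \<bullet> pd j p v)"

definition christoffel :: "(real^2 \<Rightarrow> real^2^2) \<Rightarrow> 2 \<Rightarrow> 2 \<Rightarrow> 2 \<Rightarrow> real^2 \<Rightarrow> real" where
  "christoffel g k i j v =
     (\<Sum>m\<in>UNIV. matrix_inv (g v) $ k $ m *
        (pd i (\<lambda>w. g w $ m $ j) v + pd j (\<lambda>w. g w $ m $ i) v - pd m (\<lambda>w. g w $ i $ j) v)) / 2"

text \<open>\<open>riemann_122 g m v\<close> is the \<open>m\<close>-th component of \<open>R(\<partial>\<^sub>1, \<partial>\<^sub>2) \<partial>\<^sub>2\<close>.\<close>

definition riemann_122 :: "(real^2 \<Rightarrow> real^2^2) \<Rightarrow> 2 \<Rightarrow> real^2 \<Rightarrow> real" where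
  "riemann_122 g m v =
     pd 1 (christoffel g m 2 2) v - pd 2 (christoffel g m 1 2) v +
     (\<Sum>n\<in>UNIV. christoffel g n 2 2 v * christoffel g m 1 n v -
                christoffel g n 1 2 v * christoffel g m 2 n v)"

definition gauss_curvature :: "(real^2 \<Rightarrow> real^2^2) \<Rightarrow> real^2 \<Rightarrow> real" where
  "gauss_curvature g v = (\<Sum>m\<in>UNIV. riemann_122 g m v * g v $ m $ 1) / det (g v)"

definition flat_surface :: "(real^2 \<Rightarrow> real^4) \<Rightarrow> (real^2) set \<Rightarrow> bool" where
  "flat_surface p V \<longleftrightarrow>
     spherical_surface p V \<and> (\<forall>v\<in>V. gauss_curvature (induced_metric p) v = 0)"

definition helicoidal_motion :: "real \<Rightarrow> real \<Rightarrow> real \<Rightarrow> real^4^4" where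
  "helicoidal_motion a b t = vector
     [vector [cos (a * t), - sin (a * t), 0, 0],
      vector [sin (a * t),   cos (a * t), 0, 0],
      vector [0, 0, cos (b * t), - sin (b * t)],
      vector [0, 0, sin (b * t),   cos (b * t)]]"

definition invariant_under_motions :: "real \<Rightarrow> real \<Rightarrow> (real^4) set \<Rightarrow> bool" where
  "invariant_under_motions a b M \<longleftrightarrow> (\<forall>t. (\<lambda>y. helicoidal_motion a b t *v y) ` M = M)"

text \<open>Every point of the surface \<open>p\<close> has a neighbourhood that an isometry \<open>A\<close> of the sphere carries
  onto an open piece of the surface \<open>q\<close>, up to a change of parameters \<open>\<theta>\<close>.\<close>

definition locally_congruent ::
    "(real^2 \<Rightarrow> real^4) \<Rightarrow> (real^2) set \<Rightarrow> (real^2 \<Rightarrow> real^4) \<Rightarrow> (real^2) set \<Rightarrow> bool" where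
  "locally_congruent p V q G \<longleftrightarrow>
     (\<forall>v\<in>V. \<exists>V' G' \<theta> A. v \<in> V' \<and> V' \<subseteq> V \<and> G' \<subseteq> G \<and> diffeomorphism_between \<theta> V' G' \<and>
        orthogonal_transformation A \<and> (\<forall>w\<in>V'. A (p w) = q (\<theta> w)))"

end

theory Submission
  imports Defs
begin

text \<open>
  The assertion belongs to conformal geometry, so the hypersurface is studied in the light cone of
  \<open>\<real>\<^sup>4 \<times> \<real> \<times> \<real>\<close> with a form of Lorentz signature. Every space form embeds isometrically into this cone
  (\<open>lift\<close>), rescaling the embedding by a positive function changes the metric conformally, and a basis
  consisting of four orthonormal vectors and two null vectors orthogonal to them gives a conformal
  chart into \<open>\<real>\<^sup>4\<close> (\<open>cone_projection_conformal\<close>). It therefore suffices to find six constant vectors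
  with respect to which the lift of \<open>f\<close> has, up to a common factor, the coordinates of a cone.

  Let \<open>F\<close> be the lift of \<open>f\<close> rescaled by \<open>e\<^sup>-\<^sup>u\<close>. Its metric is \<open>\<Sum> l\<^sub>i\<^sup>2 dx\<^sub>i\<^sup>2\<close>. The lifted normal is only
  determined modulo \<open>F\<close>, and adding \<open>\<kappa>\<^sub>2\<close> times the lift gives a field \<open>N\<close> whose derivative in the
  second direction is a multiple of \<open>F\<close>. Together with \<open>E\<^sub>i = F\<^sub>,\<^sub>i / l\<^sub>i\<close> and \<open>W = E\<^sub>2\<^sub>,\<^sub>2 / l\<^sub>2\<close>, the fields
  \<open>F\<close> and \<open>N\<close> form a moving basis. Since \<open>l\<^sub>2\<close> is constant and \<open>l\<^sub>1\<close>, \<open>l\<^sub>3\<close> are the cosine and sine of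
  a linear function of \<open>x\<^sub>1\<close>, \<open>x\<^sub>3\<close>, comparing mixed partial derivatives removes almost all
  coefficients of the derivatives of this basis. What remains are two functions with
  \<open>b\<^sub>,\<^sub>1 = \<alpha>\<^sub>1 a\<close>, \<open>a\<^sub>,\<^sub>3 = - \<alpha>\<^sub>3 b\<close> and \<open>a b\<close> a constant multiple of \<open>l\<^sub>1 l\<^sub>3\<close>. The two values of \<open>b\<^sub>,\<^sub>1\<^sub>3\<close>
  agree only if \<open>a = - M sin\<close> and \<open>b = M cos\<close> for a constant \<open>M\<close>, because the principal curvatures
  are distinct (\<open>invariants\<close>).

  Now the basis splits. The plane of \<open>W\<close> and \<open>E\<^sub>2\<close> depends on \<open>x\<^sub>2\<close> only and undergoes a hyperbolic
  rotation of speed \<open>M\<close>, which provides the factor \<open>t = exp (M x\<^sub>2)\<close>. The other four vectors depend on \<open>x\<^sub>1\<close>, \<open>x\<^sub>3\<close> only, and after a rotation by the angle \<open>\<xi> + \<xi>\<^sub>0\<close> they satisfy a linear system with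
  constant coefficients, given by two commuting skew matrices. A singular value
  decomposition solves it by sines and cosines of two linear functions (\<open>singular_value_rotation\<close>,
  \<open>model_surface\<close>). The resulting surface in the sphere has the flat metric
  \<open>M\<^sup>2 (cos\<^sup>2 dx\<^sub>1\<^sup>2 + sin\<^sup>2 dx\<^sub>3\<^sup>2)\<close>, and translations along the lines \<open>\<xi> = const\<close> act on it as helicoidal
  motions. Pairing the moving basis of the hypersurface with that of the model yields the six
  constant vectors (\<open>reconstruction\<close>).\<close>

section \<open>Calculus of smooth maps\<close>

lemma Ck_on_cong:
  assumes "open S" "\<And>x. x \<in> S \<Longrightarrow> f x = g x" "Ck_on k S f"
  shows "Ck_on k S g"
  using assms(2,3)
proof (induction k arbitrary: f g)
  case 0
  then show ?case by (simp cong: continuous_on_cong)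
next
  case (Suc k)
  have d: "(g has_derivative frechet_derivative f (at x)) (at x)" if "x \<in> S" for x
    using Suc.prems that \<open>open S\<close>
    by (metis Ck_on.simps(2) at_within_open differentiable_on_def frechet_derivative_works
        has_derivative_transform_within_open)
  have fg: "frechet_derivative f (at x) = frechet_derivative g (at x)" if "x \<in> S" for x
    using d[OF that] by (rule frechet_derivative_at)
  have "g differentiable_on S"
    using d \<open>open S\<close> by (auto simp: differentiable_on_eq_differentiable_at differentiable_def)
  moreover have "Ck_on k S (\<lambda>x. frechet_derivative g (at x) b)" if "b \<in> Basis" for b
    by (rule Suc.IH[of "\<lambda>x. frechet_derivative f (at x) b"]) (use fg Suc.prems that in auto)
  ultimately show ?case by simp
qed

lemma Ck_on_SucI:
  assumes "open S" "\<And>x. x \<in> S \<Longrightarrow> (f has_derivative f' x) (at x)"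
    "\<And>b. b \<in> Basis \<Longrightarrow> Ck_on k S (\<lambda>x. f' x b)"
  shows "Ck_on (Suc k) S f"
proof -
  have "frechet_derivative f (at x) = f' x" if "x \<in> S" for x
    using assms(2)[OF that] frechet_derivative_at by metis
  then have "Ck_on k S (\<lambda>x. frechet_derivative f (at x) b)" if "b \<in> Basis" for b
    by (intro Ck_on_cong[OF \<open>open S\<close> _ assms(3)[OF that]]) auto
  moreover have "f differentiable_on S"
    using assms(1,2) by (auto simp: differentiable_on_eq_differentiable_at differentiable_def)
  ultimately show ?thesis by simp
qed

lemma Ck_on_SucD: "Ck_on (Suc k) S f \<Longrightarrow> Ck_on k S f"
proof (induction k arbitrary: f)
  case 0
  then show ?case by (auto intro: differentiable_imp_continuous_on)
next
  case (Suc k)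
  then have "Ck_on k S (\<lambda>x. frechet_derivative f (at x) b)" if "b \<in> Basis" for b
    using that by (intro Suc.IH) (auto simp del: Ck_on.simps(2) dest: Ck_on.simps(2)[THEN iffD1])
  then show ?case using Suc.prems by (simp del: Ck_on.simps(2) add: Ck_on.simps(2)[of k] Ck_on.simps(2)[of "Suc k"])
qed

lemma Ck_on_Suc_has_derivative:
  assumes "open S" "Ck_on (Suc k) S f" "x \<in> S"
  shows "(f has_derivative frechet_derivative f (at x)) (at x)"
  using assms by (simp add: differentiable_on_eq_differentiable_at flip: frechet_derivative_works)

lemma Ck_on_const: "open S \<Longrightarrow> Ck_on k S (\<lambda>x. c)"
proof (induction k arbitrary: c)
  case (Suc k)
  show ?case by (rule Ck_on_SucI[where f' = "\<lambda>_ _. 0"]) (use Suc in auto)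
qed auto

lemma Ck_on_bounded_linear:
  assumes "open S" "bounded_linear L"
  shows "Ck_on k S L"
proof (cases k)
  case 0
  then show ?thesis using assms linear_continuous_on by auto
next
  case (Suc n)
  then show ?thesis
    using assms by (auto intro!: Ck_on_SucI Ck_on_const bounded_linear_imp_has_derivative simp del: Ck_on.simps)
qed

lemma Ck_on_add:
  assumes "open S" "Ck_on k S f" "Ck_on k S g"
  shows "Ck_on k S (\<lambda>x. f x + g x)"
  using assms(2,3)
proof (induction k arbitrary: f g)
  case 0
  then show ?case by (auto intro: continuous_intros)
next
  case (Suc k)
  show ?case
    by (rule Ck_on_SucI[OF \<open>open S\<close> has_derivative_add[OF Ck_on_Suc_has_derivative Ck_on_Suc_has_derivative]])
      (use Suc assms(1) in auto)
qed

lemma Ck_on_bilinear: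
  fixes S :: "'c::euclidean_space set"
  assumes "bounded_bilinear op" "open S" "Ck_on k S f" "Ck_on k S g"
  shows "Ck_on k S (\<lambda>x. op (f x) (g x))"
  using assms(3,4)
proof (induction k arbitrary: f g)
  case 0
  then show ?case by (auto intro: bounded_bilinear.continuous_on[OF assms(1)])
next
  case (Suc k)
  note D = Ck_on_Suc_has_derivative[OF \<open>open S\<close>]
  show ?case
  proof (rule Ck_on_SucI[OF \<open>open S\<close>])
    fix x assume "x \<in> S"
    then show "((\<lambda>x. op (f x) (g x)) has_derivative
      (\<lambda>h. op (f x) (frechet_derivative g (at x) h) + op (frechet_derivative f (at x) h) (g x))) (at x)"
      using Suc.prems by (intro bounded_bilinear.FDERIV[OF assms(1)] D) auto
  next
    fix b :: 'c assume "b \<in> Basis"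
    then show "Ck_on k S (\<lambda>x. op (f x) (frechet_derivative g (at x) b) + op (frechet_derivative f (at x) b) (g x))"
      using Suc.prems Ck_on_SucD[OF Suc.prems(1)] Ck_on_SucD[OF Suc.prems(2)]
      by (intro Ck_on_add Suc.IH \<open>open S\<close>) simp_all
  qed
qed

text \<open>The order \<open>k\<close> condition is imposed on \<open>g' \<circ> f\<close> rather than on \<open>g'\<close>: for the exponential, sine, cosine
  and reciprocal the composite \<open>g' \<circ> f\<close> is again built from the functions under consideration, so that
  an induction on \<open>k\<close> closes.\<close>

lemma Ck_on_real_chain:
  fixes f :: "'a::euclidean_space \<Rightarrow> real" and g g' :: "real \<Rightarrow> real"
  assumes "open S" "Ck_on (Suc k) S f"
    and "\<And>x. x \<in> S \<Longrightarrow> (g has_real_derivative g' (f x)) (at (f x))"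
    and "Ck_on k S (\<lambda>x. g' (f x))"
  shows "Ck_on (Suc k) S (\<lambda>x. g (f x))"
proof (rule Ck_on_SucI[OF \<open>open S\<close>])
  fix x assume "x \<in> S"
  then show "((\<lambda>x. g (f x)) has_derivative (\<lambda>h. g' (f x) * frechet_derivative f (at x) h)) (at x)"
    using has_derivative_compose[OF Ck_on_Suc_has_derivative[OF assms(1,2)]
        assms(3)[THEN has_field_derivative_imp_has_derivative]]
    by (simp add: mult.commute)
next
  fix b :: 'a assume "b \<in> Basis"
  then show "Ck_on k S (\<lambda>x. g' (f x) * frechet_derivative f (at x) b)"
    using assms by (intro Ck_on_bilinear[OF bounded_bilinear_mult]) auto
qed

lemma Ck_on_exp:
  fixes f :: "'a::euclidean_space \<Rightarrow> real"
  assumes "open S" "Ck_on k S f"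
  shows "Ck_on k S (\<lambda>x. exp (f x))"
  using assms(2)
proof (induction k)
  case (Suc k)
  show ?case
    by (rule Ck_on_real_chain[OF assms(1) Suc.prems DERIV_exp Suc.IH[OF Ck_on_SucD[OF Suc.prems]]])
qed (auto intro: continuous_intros)

lemma Ck_on_sin_cos:
  fixes f :: "'a::euclidean_space \<Rightarrow> real"
  assumes "open S" "Ck_on k S f"
  shows "Ck_on k S (\<lambda>x. sin (f x)) \<and> Ck_on k S (\<lambda>x. cos (f x))"
  using assms(2)
proof (induction k)
  case (Suc k)
  have IH: "Ck_on k S (\<lambda>x. sin (f x))" "Ck_on k S (\<lambda>x. cos (f x))"
    using Suc.IH Ck_on_SucD[OF Suc.prems] by auto
  have "Ck_on k S (\<lambda>x. - 1 * sin (f x))"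
    by (intro Ck_on_bilinear[OF bounded_bilinear_mult] Ck_on_const IH assms(1))
  then have "Ck_on k S (\<lambda>x. - sin (f x))" by simp
  from Ck_on_real_chain[OF assms(1) Suc.prems DERIV_sin IH(2)]
    Ck_on_real_chain[OF assms(1) Suc.prems DERIV_cos this]
  show ?case by blast
qed (auto intro: continuous_intros)

lemma Ck_on_inverse:
  fixes f :: "'a::euclidean_space \<Rightarrow> real"
  assumes "open S" "Ck_on k S f" "\<And>x. x \<in> S \<Longrightarrow> f x \<noteq> 0"
  shows "Ck_on k S (\<lambda>x. inverse (f x))"
  using assms(2)
proof (induction k)
  case 0
  then show ?case using assms by (auto intro: continuous_intros)
next
  case (Suc k)
  have IH: "Ck_on k S (\<lambda>x. inverse (f x))"
    using Suc.IH Ck_on_SucD[OF Suc.prems] by auto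
  have "Ck_on k S (\<lambda>x. - 1 * (inverse (f x) * inverse (f x)))"
    by (intro Ck_on_bilinear[OF bounded_bilinear_mult] Ck_on_const IH assms(1))
  then have "Ck_on k S (\<lambda>x. - (inverse (f x) ^ Suc (Suc 0)))" by simp
  from Ck_on_real_chain[OF assms(1) Suc.prems DERIV_inverse[OF assms(3)] this]
  show ?case by blast
qed

lemma Ck_on_ln:
  fixes f :: "'a::euclidean_space \<Rightarrow> real"
  assumes "open S" "Ck_on k S f" "\<And>x. x \<in> S \<Longrightarrow> f x > 0"
  shows "Ck_on k S (\<lambda>x. ln (f x))"
proof (cases k)
  case 0
  then show ?thesis using assms by (auto intro!: continuous_intros simp: less_imp_neq[THEN not_sym])
next
  case (Suc n)
  have f: "Ck_on (Suc n) S f" using assms(2) Suc by simp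
  have "Ck_on n S (\<lambda>x. inverse (f x))"
    using assms(3) by (intro Ck_on_inverse assms(1) Ck_on_SucD[OF f]) force
  from Ck_on_real_chain[OF assms(1) f DERIV_ln[OF assms(3)] this]
  show ?thesis unfolding Suc by blast
qed

lemma smooth_on_cong:
  "open S \<Longrightarrow> smooth_on S f \<Longrightarrow> (\<And>x. x \<in> S \<Longrightarrow> f x = g x) \<Longrightarrow> smooth_on S g"
  unfolding smooth_on_def using Ck_on_cong by blast

lemma smooth_on_const: "open S \<Longrightarrow> smooth_on S (\<lambda>x. c)"
  by (simp add: smooth_on_def Ck_on_const)

lemma smooth_on_linear: "open S \<Longrightarrow> bounded_linear L \<Longrightarrow> smooth_on S L"
  by (simp add: smooth_on_def Ck_on_bounded_linear)

lemma smooth_on_add: "open S \<Longrightarrow> smooth_on S f \<Longrightarrow> smooth_on S g \<Longrightarrow> smooth_on S (\<lambda>x. f x + g x)"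
  by (simp add: smooth_on_def Ck_on_add)

lemma smooth_on_bilinear:
  "bounded_bilinear op \<Longrightarrow> open S \<Longrightarrow> smooth_on S f \<Longrightarrow> smooth_on S g
    \<Longrightarrow> smooth_on S (\<lambda>x. op (f x) (g x))"
  by (simp add: smooth_on_def Ck_on_bilinear)

lemmas smooth_on_scaleR = smooth_on_bilinear[OF bounded_bilinear_scaleR]
  and smooth_on_mult = smooth_on_bilinear[OF bounded_bilinear_mult]
  and smooth_on_inner = smooth_on_bilinear[OF bounded_bilinear_inner]

lemma smooth_on_minus: "open S \<Longrightarrow> smooth_on S f \<Longrightarrow> smooth_on S (\<lambda>x. - f x)"
  using smooth_on_scaleR[OF _ smooth_on_const, of S f "- 1"] by simp

lemma smooth_on_diff: "open S \<Longrightarrow> smooth_on S f \<Longrightarrow> smooth_on S g \<Longrightarrow> smooth_on S (\<lambda>x. f x - g x)"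
  using smooth_on_add[OF _ _ smooth_on_minus, of S f g] by simp

lemma smooth_on_linear_comp:
  assumes "bounded_linear L" "open S" "smooth_on S f"
  shows "smooth_on S (\<lambda>x. L (f x))"
proof -
  have "bounded_bilinear (\<lambda>(r::real) v. r *\<^sub>R L v)"
    using bounded_bilinear.comp[OF bounded_bilinear_scaleR bounded_linear_ident assms(1)] by simp
  from smooth_on_bilinear[OF this assms(2) smooth_on_const assms(3), of 1]
  show ?thesis using assms(2) by simp
qed

lemma smooth_on_sum:
  "open S \<Longrightarrow> (\<And>i. i \<in> I \<Longrightarrow> smooth_on S (f i)) \<Longrightarrow> smooth_on S (\<lambda>x. \<Sum>i\<in>I. f i x)"
  by (induction I rule: infinite_finite_induct) (auto intro: smooth_on_add smooth_on_const)

lemma smooth_on_exp: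
  "open S \<Longrightarrow> smooth_on S f \<Longrightarrow> smooth_on S (\<lambda>x. exp (f x :: real))"
  and smooth_on_sin: "open S \<Longrightarrow> smooth_on S f \<Longrightarrow> smooth_on S (\<lambda>x. sin (f x :: real))"
  and smooth_on_cos: "open S \<Longrightarrow> smooth_on S f \<Longrightarrow> smooth_on S (\<lambda>x. cos (f x :: real))"
  and smooth_on_ln: "open S \<Longrightarrow> smooth_on S f \<Longrightarrow> (\<And>x. x \<in> S \<Longrightarrow> f x > 0)
    \<Longrightarrow> smooth_on S (\<lambda>x. ln (f x :: real))"
  by (simp_all add: smooth_on_def Ck_on_exp Ck_on_sin_cos Ck_on_ln)

lemma smooth_on_divide:
  fixes f g :: "'a::euclidean_space \<Rightarrow> real"
  assumes "open S" "smooth_on S f" "smooth_on S g" "\<And>x. x \<in> S \<Longrightarrow> g x \<noteq> 0"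
  shows "smooth_on S (\<lambda>x. f x / g x)"
proof -
  have "smooth_on S (\<lambda>x. f x * inverse (g x))"
    using assms by (intro smooth_on_mult) (auto simp: smooth_on_def Ck_on_inverse)
  then show ?thesis by (simp add: divide_inverse)
qed

lemma smooth_on_component: "open S \<Longrightarrow> smooth_on S (\<lambda>x. x $ i)"
  by (intro smooth_on_linear bounded_linear_vec_nth)

lemma smooth_on_Pair:
  assumes "open S" "smooth_on S f" "smooth_on S g"
  shows "smooth_on S (\<lambda>x. (f x, g x))"
proof -
  have "smooth_on S (\<lambda>x. (f x, 0) + (0, g x))"
    using assms bounded_linear_Pair[OF bounded_linear_ident bounded_linear_zero]
      bounded_linear_Pair[OF bounded_linear_zero bounded_linear_ident]
    by (intro smooth_on_add smooth_on_linear_comp[of "\<lambda>y. (y, 0)"] smooth_on_linear_comp[of "\<lambda>y. (0, y)"]) auto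
  then show ?thesis by simp
qed

lemma smooth_on_vec_lambda:
  assumes "open S" "\<And>i. smooth_on S (\<lambda>x. f x i)"
  shows "smooth_on S (\<lambda>x. (\<chi> i. f x i) :: real^'n)"
proof -
  have "smooth_on S (\<lambda>x. \<Sum>i\<in>UNIV. f x i *\<^sub>R (axis i 1 :: real^'n))"
    using assms by (intro smooth_on_sum smooth_on_scaleR smooth_on_const)
  moreover have "(\<Sum>i\<in>UNIV. f x i *\<^sub>R axis i 1) = (\<chi> i. f x i)" for x
    by (simp add: vec_eq_iff axis_def if_distrib[of "\<lambda>t. _ * t"] cong: if_cong)
  ultimately show ?thesis by simp
qed

lemma smooth_on_subset: 
  assumes "open S" "open T" "T \<subseteq> S" "smooth_on S f" shows "smooth_on T f"
proof -
  have "Ck_on k T f" if "Ck_on k S f" for k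
    using that
  proof (induction k arbitrary: f)
    case 0 then show ?case using assms continuous_on_subset by auto
  next
    case (Suc k) then show ?case using assms by (auto intro: differentiable_on_subset)
  qed
  then show ?thesis using assms(4) by (auto simp: smooth_on_def)
qed

lemma smooth_on_continuous: "smooth_on S f \<Longrightarrow> continuous_on S f"
  unfolding smooth_on_def by (metis Ck_on.simps(1))

lemma smooth_on_differentiable:
  assumes "open S" "smooth_on S f" "x \<in> S"
  shows "f differentiable (at x)"
  using assms Ck_on.simps(2)[of 0 S f] unfolding smooth_on_def
  by (metis differentiable_on_eq_differentiable_at)

lemma smooth_on_pd:
  assumes "open S" "smooth_on S f"
  shows "smooth_on S (pd i f)"
proof -
  have "axis i (1::real) \<in> Basis" by (auto simp: Basis_vec_def)
  then have "Ck_on k S (\<lambda>x. frechet_derivative f (at x) (axis i 1))" for k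
    using assms(2) Ck_on.simps(2)[of k S f] unfolding smooth_on_def by metis
  then show ?thesis by (simp add: smooth_on_def pd_def[abs_def])
qed

lemma has_derivative_vecI:
  fixes f :: "'a::real_normed_vector \<Rightarrow> 'n::finite \<Rightarrow> real"
  assumes "\<And>i. ((\<lambda>x. f x i) has_derivative (\<lambda>h. f' h i)) (at x)"
  shows "((\<lambda>x. \<chi> i. f x i) has_derivative (\<lambda>h. \<chi> i. f' h i)) (at x)"
  using assms by (subst has_derivative_componentwise_within) (auto simp: Basis_vec_def inner_axis)

section \<open>Partial derivatives\<close>

lemma pd_eqI: "(f has_derivative f') (at x) \<Longrightarrow> pd i f x = f' (axis i 1)"
  unfolding pd_def using frechet_derivative_at by metis

lemma pd_cong:
  assumes "open S" "x \<in> S" "\<And>y. y \<in> S \<Longrightarrow> f y = g y"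
  shows "pd i f x = pd i g x"
proof -
  have "f differentiable at x \<longleftrightarrow> g differentiable at x"
    using assms unfolding differentiable_def
    by (metis has_derivative_transform_within_open)
  then show ?thesis
  proof (cases "f differentiable at x")
    case True
    then show ?thesis unfolding pd_def
      using frechet_derivative_transform_within_open[OF True assms(1,2), of g] assms(3) by simp
  next
    case False
    then have "\<not> (f has_derivative D) (at x)" "\<not> (g has_derivative D) (at x)" for D
      using \<open>_ \<longleftrightarrow> _\<close> by (auto simp: differentiable_def)
    then show ?thesis by (simp add: pd_def frechet_derivative_def)
  qed
qed

lemma pd_has_derivative:
  "f differentiable at x \<Longrightarrow> (f has_derivative frechet_derivative f (at x)) (at x)"
  by (simp add: frechet_derivative_works)

lemma pd_const: "pd i (\<lambda>x. c) x = 0"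
  by (simp add: pd_def)

lemma pd_add: "f differentiable at x \<Longrightarrow> g differentiable at x
    \<Longrightarrow> pd i (\<lambda>y. f y + g y) x = pd i f x + pd i g x"
  by (subst pd_eqI[OF has_derivative_add[OF pd_has_derivative pd_has_derivative]]) (auto simp: pd_def)

lemma pd_minus: "f differentiable at x \<Longrightarrow> pd i (\<lambda>y. - f y) x = - pd i f x"
  by (subst pd_eqI[OF has_derivative_minus[OF pd_has_derivative]]) (auto simp: pd_def)

lemma pd_diff: "f differentiable at x \<Longrightarrow> g differentiable at x
    \<Longrightarrow> pd i (\<lambda>y. f y - g y) x = pd i f x - pd i g x"
  by (subst pd_eqI[OF has_derivative_diff[OF pd_has_derivative pd_has_derivative]]) (auto simp: pd_def)

lemma pd_bilinear:
  assumes "bounded_bilinear op" "f differentiable at x" "g differentiable at x"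
  shows "pd i (\<lambda>y. op (f y) (g y)) x = op (f x) (pd i g x) + op (pd i f x) (g x)"
  by (subst pd_eqI[OF bounded_bilinear.FDERIV[OF assms(1) pd_has_derivative pd_has_derivative]])
    (use assms in \<open>auto simp: pd_def\<close>)

lemma pd_linear:
  assumes "bounded_linear L" "f differentiable at x"
  shows "pd i (\<lambda>y. L (f y)) x = L (pd i f x)"
  by (subst pd_eqI[OF bounded_linear.has_derivative[OF assms(1) pd_has_derivative]])
    (use assms in \<open>auto simp: pd_def\<close>)

lemma pd_vec: 
  fixes f :: "real^'n \<Rightarrow> real^'m"
  assumes "f differentiable at x" shows "pd k f x $ i = pd k (\<lambda>y. f y $ i) x"
  using pd_linear[OF bounded_linear_vec_nth assms, of k i] by simp

lemma pd_real_chain: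
  assumes "f differentiable at x" "(g has_real_derivative g') (at (f x))"
  shows "pd i (\<lambda>y. g (f y)) x = g' * pd i f x"
  using pd_eqI[OF has_derivative_compose[OF pd_has_derivative[OF assms(1)]
        assms(2)[THEN has_field_derivative_imp_has_derivative]]]
  by (simp add: pd_def)

lemma differentiable_coordinate: "(\<lambda>x::real^'n. x $ i) differentiable at x"
  by (rule smooth_on_differentiable[OF open_UNIV smooth_on_component[OF open_UNIV]]) simp

lemma pd_coordinate: "pd k (\<lambda>x::real^'n. x $ i) x = (if k = i then 1 else 0)"
  by (subst pd_eqI[OF bounded_linear_imp_has_derivative[OF bounded_linear_vec_nth]]) (simp add: axis_def)

lemmas pd_scaleR = pd_bilinear[OF bounded_bilinear_scaleR]
  and pd_mult = pd_bilinear[OF bounded_bilinear_mult]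
  and pd_inner = pd_bilinear[OF bounded_bilinear_inner]

text \<open>The mean value theorem, applied first in direction \<open>i\<close> to a difference in direction \<open>j\<close> and then in
  direction \<open>j\<close>. The left-hand side is symmetric in \<open>i\<close> and \<open>j\<close>, which is the reason why
  partial derivatives commute.\<close>

lemma mixed_difference_mean_value:
  fixes f :: "real^'n \<Rightarrow> real"
  assumes "open S" "smooth_on S f" "h > 0"
    and in_S: "\<And>s t. 0 \<le> s \<Longrightarrow> s \<le> h \<Longrightarrow> 0 \<le> t \<Longrightarrow> t \<le> h \<Longrightarrow> x + s *\<^sub>R axis i 1 + t *\<^sub>R axis j 1 \<in> S"
  shows "\<exists>s t. 0 \<le> s \<and> s \<le> h \<and> 0 \<le> t \<and> t \<le> h \<and>
    f (x + h *\<^sub>R axis i 1 + h *\<^sub>R axis j 1) - f (x + h *\<^sub>R axis i 1) - f (x + h *\<^sub>R axis j 1) + f x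
      = h * h * pd j (pd i f) (x + s *\<^sub>R axis i 1 + t *\<^sub>R axis j 1)"
proof -
  have line: "((\<lambda>s. g (y + s *\<^sub>R axis k 1)) has_real_derivative pd k g (y + s *\<^sub>R axis k 1)) (at s)"
    if "smooth_on S g" "y + s *\<^sub>R axis k 1 \<in> S" for g :: "real^'n \<Rightarrow> real" and y s k
  proof -
    let ?D = "frechet_derivative g (at (y + s *\<^sub>R axis k 1))"
    have D: "(g has_derivative ?D) (at (y + s *\<^sub>R axis k 1))"
      using that smooth_on_differentiable[OF \<open>open S\<close>] pd_has_derivative by metis
    have "((\<lambda>s. y + s *\<^sub>R axis k (1::real)) has_derivative (\<lambda>r. r *\<^sub>R axis k 1)) (at s)"
      by (auto intro!: derivative_eq_intros)
    from has_derivative_compose[OF this D]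
    have "((\<lambda>s. g (y + s *\<^sub>R axis k 1)) has_derivative (\<lambda>r. ?D (r *\<^sub>R axis k 1))) (at s)" .
    moreover have "?D (r *\<^sub>R axis k 1) = pd k g (y + s *\<^sub>R axis k 1) * r" for r
      using linear_scale[OF has_derivative_linear[OF D]] by (simp add: pd_def)
    ultimately show ?thesis by (simp add: has_field_derivative_def)
  qed
  let ?g = "\<lambda>s. f ((x + h *\<^sub>R axis j 1) + s *\<^sub>R axis i 1) - f (x + s *\<^sub>R axis i 1)"
  have S1: "(x + h *\<^sub>R axis j 1) + s *\<^sub>R axis i 1 \<in> S" "x + s *\<^sub>R axis i 1 \<in> S" if "0 \<le> s" "s \<le> h" for s
    using in_S[OF that, of h] in_S[OF that, of 0] \<open>h > 0\<close> by (auto simp: algebra_simps)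
  have "\<exists>s. 0 < s \<and> s < h \<and> ?g h - ?g 0 =
      (h - 0) * (pd i f ((x + h *\<^sub>R axis j 1) + s *\<^sub>R axis i 1) - pd i f (x + s *\<^sub>R axis i 1))"
    by (rule MVT2[OF \<open>h > 0\<close>]) (intro DERIV_diff line assms S1)
  then obtain s where s: "0 < s" "s < h" "?g h - ?g 0 =
      h * (pd i f ((x + h *\<^sub>R axis j 1) + s *\<^sub>R axis i 1) - pd i f (x + s *\<^sub>R axis i 1))" by auto
  let ?k = "\<lambda>t. pd i f ((x + s *\<^sub>R axis i 1) + t *\<^sub>R axis j 1)"
  have "\<exists>t. 0 < t \<and> t < h \<and> ?k h - ?k 0 = (h - 0) * pd j (pd i f) ((x + s *\<^sub>R axis i 1) + t *\<^sub>R axis j 1)"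
    using s in_S by (intro MVT2[OF \<open>h > 0\<close>] line smooth_on_pd assms) auto
  then obtain t where "0 < t" "t < h" "?k h - ?k 0 = h * pd j (pd i f) ((x + s *\<^sub>R axis i 1) + t *\<^sub>R axis j 1)" by auto
  then show ?thesis using s by (intro exI[of _ s] exI[of _ t]) (auto simp: algebra_simps)
qed

lemma pd_commute:
  fixes f :: "real^'n \<Rightarrow> 'b::euclidean_space"
  assumes "open S" "smooth_on S f" "x \<in> S"
  shows "pd i (pd j f) x = pd j (pd i f) x"
proof -
  have real_case: "pd i (pd j g) x = pd j (pd i g) x" if g: "smooth_on S g" for g :: "real^'n \<Rightarrow> real"
  proof (rule ccontr)
    define A where "A = pd i (pd j g)"
    define C where "C = pd j (pd i g)"
    assume "pd i (pd j g) x \<noteq> pd j (pd i g) x"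
    then have e: "\<bar>A x - C x\<bar> / 2 > 0" by (auto simp: A_def C_def)
    have "continuous_on S A" "continuous_on S C"
      unfolding A_def C_def
      by (intro smooth_on_continuous smooth_on_pd \<open>open S\<close> g)+
    then have "isCont A x" "isCont C x"
      using assms by (auto simp: continuous_on_eq_continuous_at)
    then have "\<exists>d>0. \<forall>y. dist y x < d \<longrightarrow> dist (A y) (A x) < \<bar>A x - C x\<bar> / 2"
      "\<exists>d>0. \<forall>y. dist y x < d \<longrightarrow> dist (C y) (C x) < \<bar>A x - C x\<bar> / 2"
      using e by (simp_all only: continuous_at_eps_delta)
    then obtain d1 d2 where d: "d1 > 0" "\<And>y. dist y x < d1 \<Longrightarrow> dist (A y) (A x) < \<bar>A x - C x\<bar> / 2"
        "d2 > 0" "\<And>y. dist y x < d2 \<Longrightarrow> dist (C y) (C x) < \<bar>A x - C x\<bar> / 2"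
      by blast
    obtain d3 where d3: "d3 > 0" "\<And>y. dist y x < d3 \<Longrightarrow> y \<in> S"
      using assms(1,3) unfolding open_dist by blast
    \<comment> \<open>Both mean value points stay within distance \<open>2 h < d\<close> of \<open>x\<close>.\<close>
    define d where "d = min d1 (min d2 d3)"
    define h where "h = d / 3"
    have h: "h > 0" using d d3 by (auto simp: h_def d_def)
    have near: "dist (x + s *\<^sub>R axis k 1 + t *\<^sub>R axis m 1) x < d"
      if "0 \<le> s" "s \<le> h" "0 \<le> t" "t \<le> h" for s t and k m :: 'n
    proof -
      have "norm (s *\<^sub>R axis k 1 + t *\<^sub>R axis m (1::real)) \<le> s + t"
        using norm_triangle_ineq[of "s *\<^sub>R axis k 1" "t *\<^sub>R axis m (1::real)"] that by simp
      then show ?thesis using that h by (simp add: dist_norm h_def add.assoc)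
    qed
    obtain s t where 1: "0 \<le> s" "s \<le> h" "0 \<le> t" "t \<le> h"
      "g (x + h *\<^sub>R axis i 1 + h *\<^sub>R axis j 1) - g (x + h *\<^sub>R axis i 1) - g (x + h *\<^sub>R axis j 1) + g x
      = h * h * C (x + s *\<^sub>R axis i 1 + t *\<^sub>R axis j 1)"
      using mixed_difference_mean_value[OF \<open>open S\<close> g h, of x i j] near d3 unfolding C_def d_def by force
    obtain s' t' where 2: "0 \<le> s'" "s' \<le> h" "0 \<le> t'" "t' \<le> h"
      "g (x + h *\<^sub>R axis j 1 + h *\<^sub>R axis i 1) - g (x + h *\<^sub>R axis j 1) - g (x + h *\<^sub>R axis i 1) + g x
      = h * h * A (x + s' *\<^sub>R axis j 1 + t' *\<^sub>R axis i 1)"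
      using mixed_difference_mean_value[OF \<open>open S\<close> g h, of x j i] near d3 unfolding A_def d_def by force
    have swap: "x + h *\<^sub>R axis i 1 + h *\<^sub>R axis j 1 = x + h *\<^sub>R axis j 1 + h *\<^sub>R axis i 1"
      by (simp add: add.commute add.left_commute)
    have "h * h * A (x + s' *\<^sub>R axis j 1 + t' *\<^sub>R axis i 1) = h * h * C (x + s *\<^sub>R axis i 1 + t *\<^sub>R axis j 1)"
      using 1(5)[unfolded swap] 2(5) by linarith
    then have "A (x + s' *\<^sub>R axis j 1 + t' *\<^sub>R axis i 1) = C (x + s *\<^sub>R axis i 1 + t *\<^sub>R axis j 1)"
      using h by simp
    moreover have "dist (A (x + s' *\<^sub>R axis j 1 + t' *\<^sub>R axis i 1)) (A x) < \<bar>A x - C x\<bar> / 2"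
      using near[OF 2(1-4)] d unfolding d_def by auto
    moreover have "dist (C (x + s *\<^sub>R axis i 1 + t *\<^sub>R axis j 1)) (C x) < \<bar>A x - C x\<bar> / 2"
      using near[OF 1(1-4)] d unfolding d_def by auto
    ultimately show False
      using dist_triangle_half_r[of "C (x + s *\<^sub>R axis i 1 + t *\<^sub>R axis j 1)" "A x" "\<bar>A x - C x\<bar>" "C x"]
      by (simp add: dist_real_def)
  qed
  have inner: "pd k (\<lambda>y. g y \<bullet> b) y = pd k g y \<bullet> b" if "smooth_on S g" "y \<in> S" for k y b and g :: "real^'n \<Rightarrow> 'b"
    using pd_linear[OF bounded_linear_inner_left, of g y] smooth_on_differentiable[OF \<open>open S\<close> that] by simp
  have comp: "pd k (pd m f) x \<bullet> b = pd k (pd m (\<lambda>y. f y \<bullet> b)) x" for k m b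
    by (subst inner[symmetric, OF smooth_on_pd[OF assms(1,2)] assms(3)])
      (intro pd_cong[OF assms(1,3)] inner[symmetric] assms(2))
  have "smooth_on S (\<lambda>y. f y \<bullet> b)" for b
    using assms by (intro smooth_on_inner smooth_on_const)
  then have "pd i (pd j f) x \<bullet> b = pd j (pd i f) x \<bullet> b" for b
    unfolding comp[of i j b] comp[of j i b] by (rule real_case)
  then show ?thesis by (rule euclidean_eqI)
qed

lemma pd_zero_imp_constant:
  fixes f :: "real^'n \<Rightarrow> 'b::euclidean_space"
  assumes "open S" "connected S" "smooth_on S f" "\<And>x i. x \<in> S \<Longrightarrow> pd i f x = 0"
  shows "\<exists>c. \<forall>x\<in>S. f x = c"
proof -
  have "(f has_derivative (\<lambda>h. 0)) (at x within S)" if "x \<in> S" for x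
  proof -
    have D: "(f has_derivative frechet_derivative f (at x)) (at x)"
      using smooth_on_differentiable[OF assms(1,3) that] by (rule pd_has_derivative)
    have "frechet_derivative f (at x) b = 0" if "b \<in> Basis" for b
      using assms(4)[OF \<open>x \<in> S\<close>] that by (auto simp: Basis_vec_def pd_def)
    then have "frechet_derivative f (at x) = (\<lambda>h. 0)"
      by (intro linear_eq_stdbasis[OF has_derivative_linear[OF D] linear_zero])
    then show ?thesis using D has_derivative_at_withinI[of f "\<lambda>h. 0" x S] by simp
  qed
  then have "f constant_on S"
    by (intro has_derivative_zero_connected_constant_on[OF assms(2,1) finite.emptyI
          smooth_on_continuous[OF assms(3)]]) simp
  then show ?thesis by (auto simp: constant_on_def)
qed

section \<open>The light cone model of conformal geometry\<close>

text \<open>The form below is \<open>y \<bullet> y' - s t' - t s'\<close>, so the last two coordinates are null coordinates. This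
  choice makes Euclidean space, the sphere and hyperbolic space appear in the same shape.\<close>

type_synonym lorentz = "(real^4) \<times> real \<times> real"

definition lor :: "lorentz \<Rightarrow> lorentz \<Rightarrow> real" where
  "lor v w = fst v \<bullet> fst w - fst (snd v) * snd (snd w) - snd (snd v) * fst (snd w)"

lemma bounded_bilinear_lor: "bounded_bilinear lor"
  unfolding bilinear_conv_bounded_bilinear[symmetric]
  by (auto simp: bilinear_def lor_def inner_add_left inner_add_right algebra_simps intro!: linearI)

lemma lor_commute: "lor v w = lor w v"
  by (simp add: lor_def inner_commute)

lemmas lor_simps =
  bounded_bilinear.add_left[OF bounded_bilinear_lor] bounded_bilinear.add_right[OF bounded_bilinear_lor]
  bounded_bilinear.diff_left[OF bounded_bilinear_lor] bounded_bilinear.diff_right[OF bounded_bilinear_lor]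
  bounded_bilinear.minus_left[OF bounded_bilinear_lor] bounded_bilinear.minus_right[OF bounded_bilinear_lor]
  bounded_bilinear.scaleR_left[OF bounded_bilinear_lor] bounded_bilinear.scaleR_right[OF bounded_bilinear_lor]
  bounded_bilinear.zero_left[OF bounded_bilinear_lor] bounded_bilinear.zero_right[OF bounded_bilinear_lor]

text \<open>The six vectors need not be orthogonal: \<open>lor b b\<close> is arbitrary. This covers both the moving basis of
  a hypersurface, where that number is an unknown of the problem, and a basis with two null vectors.\<close>

lemma lor_expansion:
  assumes "lor e1 e1 = 1" "lor e2 e2 = 1" "lor e3 e3 = 1" "lor n n = 1"
    "lor e1 e2 = 0" "lor e1 e3 = 0" "lor e1 n = 0" "lor e2 e3 = 0" "lor e2 n = 0" "lor e3 n = 0"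
    "lor a a = 0" "lor b a = - 1"
    "lor e1 a = 0" "lor e2 a = 0" "lor e3 a = 0" "lor n a = 0"
    "lor e1 b = 0" "lor e2 b = 0" "lor e3 b = 0" "lor n b = 0"
  shows "v = lor v e1 *\<^sub>R e1 + lor v e2 *\<^sub>R e2 + lor v e3 *\<^sub>R e3 + lor v n *\<^sub>R n
    - (lor v b + lor b b * lor v a) *\<^sub>R a - lor v a *\<^sub>R b"
proof -
  note G = assms assms[THEN trans[OF lor_commute]]
  define L where "L v = (((\<chi> i::4. if i = 1 then lor v e1 else if i = 2 then lor v e2 else
      if i = 3 then lor v e3 else lor v n), lor v b, lor v a) :: lorentz)" for v
  have "linear L"
    by (rule linearI) (auto simp: L_def lor_simps vec_eq_iff)
  \<comment> \<open>The map to the six products has an explicit right inverse, hence is bijective by dimension.\<close>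
  have "surj L"
  proof (rule surjI)
    fix y :: lorentz
    let ?z = "fst y" and ?s = "fst (snd y)" and ?t = "snd (snd y)"
    show "L (?z$1 *\<^sub>R e1 + ?z$2 *\<^sub>R e2 + ?z$3 *\<^sub>R e3 + ?z$4 *\<^sub>R n - (?s + lor b b * ?t) *\<^sub>R a - ?t *\<^sub>R b) = y"
      by (simp add: L_def lor_simps G vec_eq_iff forall_4 prod_eq_iff)
  qed
  then have "inj L"
    using linear_surjective_imp_injective[OF \<open>linear L\<close>] by simp
  moreover have "L (lor v e1 *\<^sub>R e1 + lor v e2 *\<^sub>R e2 + lor v e3 *\<^sub>R e3 + lor v n *\<^sub>R n
    - (lor v b + lor b b * lor v a) *\<^sub>R a - lor v a *\<^sub>R b) = L v"
    by (auto simp: L_def lor_simps G vec_eq_iff forall_4)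
  ultimately show ?thesis by (simp add: inj_eq)
qed

text \<open>For \<open>K \<noteq> 0\<close> the lift is affine. In the limit \<open>K \<rightarrow> 0\<close> the quotient \<open>(1 - s) / K\<close>, which equals
  \<open>|y|\<^sup>2 / (1 + s)\<close> on the space form, becomes \<open>|y|\<^sup>2 / 2\<close>, and the lift becomes the usual paraboloid.
  The image lies in the intersection of the light cone with a fixed affine hyperplane.\<close>

definition lift :: "real \<Rightarrow> real \<times> (real^4) \<Rightarrow> lorentz" where
  "lift K P = (snd P, (1 + fst P) / 2, if K = 0 then (snd P \<bullet> snd P) / 2 else (1 - fst P) / K)"

definition dlift :: "real \<Rightarrow> real \<times> (real^4) \<Rightarrow> real \<times> (real^4) \<Rightarrow> lorentz" where
  "dlift K P v = (snd v, fst v / 2, if K = 0 then snd P \<bullet> snd v else - fst v / K)"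

lemma lift_has_derivative: "(lift K has_derivative dlift K P) (at P)"
proof (cases "K = 0")
  case True
  have "((\<lambda>P. (snd P, (1 + fst P) / 2, (snd P \<bullet> snd P) / 2)) has_derivative
     (\<lambda>v. (snd v, fst v / 2, snd P \<bullet> snd v))) (at P)" for P :: "real \<times> (real^4)"
    by (auto intro!: derivative_eq_intros simp: inner_commute)
  then show ?thesis using True by (simp add: lift_def[abs_def] dlift_def[abs_def])
next
  case False
  have "((\<lambda>P. (snd P, (1 + fst P) / 2, (1 - fst P) / K)) has_derivative
     (\<lambda>v. (snd v, fst v / 2, - fst v / K))) (at P)" for P :: "real \<times> (real^4)"
    by (auto intro!: derivative_eq_intros simp: False)
  then show ?thesis using False by (simp add: lift_def[abs_def] dlift_def[abs_def])
qed

lemma smooth_on_lift: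
  assumes "open S" "smooth_on S f"
  shows "smooth_on S (\<lambda>x. lift K (f x))"
proof -
  have s: "smooth_on S (\<lambda>x. fst (f x))" "smooth_on S (\<lambda>x. snd (f x))"
    using assms by (auto intro: smooth_on_linear_comp bounded_linear_fst bounded_linear_snd)
  have "smooth_on S (\<lambda>x. (snd (f x), (1 + fst (f x)) / 2, (snd (f x) \<bullet> snd (f x)) / 2))"
    by (intro smooth_on_Pair smooth_on_divide smooth_on_add smooth_on_const smooth_on_inner s assms(1)) auto
  moreover have "smooth_on S (\<lambda>x. (snd (f x), (1 + fst (f x)) / 2, (1 - fst (f x)) / K))" if "K \<noteq> 0"
    by (intro smooth_on_Pair smooth_on_divide smooth_on_add smooth_on_diff smooth_on_const smooth_on_inner s assms(1))
      (use that in auto)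
  ultimately show ?thesis by (cases "K = 0") (auto simp: lift_def)
qed

lemma smooth_on_dlift:
  assumes "open S" "smooth_on S f" "smooth_on S g"
  shows "smooth_on S (\<lambda>x. dlift K (f x) (g x))"
proof -
  have s: "smooth_on S (\<lambda>x. snd (f x))" "smooth_on S (\<lambda>x. fst (g x))" "smooth_on S (\<lambda>x. snd (g x))"
    using assms by (auto intro: smooth_on_linear_comp bounded_linear_fst bounded_linear_snd)
  have "smooth_on S (\<lambda>x. (snd (g x), fst (g x) / 2, snd (f x) \<bullet> snd (g x)))"
    by (intro smooth_on_Pair smooth_on_divide smooth_on_add smooth_on_const smooth_on_inner s assms(1)) auto
  moreover have "smooth_on S (\<lambda>x. (snd (g x), fst (g x) / 2, - fst (g x) / K))" if "K \<noteq> 0"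
    by (intro smooth_on_Pair smooth_on_divide smooth_on_minus smooth_on_const s assms(1))
      (use that in auto)
  ultimately show ?thesis by (cases "K = 0") (auto simp: dlift_def)
qed

lemma space_form_zero: "P \<in> space_form 0 \<Longrightarrow> fst P = 1"
  by (auto simp: space_form_def power2_eq_1_iff)

lemma lift_null: "P \<in> space_form K \<Longrightarrow> lor (lift K P) (lift K P) = 0"
proof (cases "K = 0")
  case True
  then show "P \<in> space_form K \<Longrightarrow> ?thesis"
    using space_form_zero[of P] by (auto simp: lor_def lift_def)
next
  case False
  then have "lor (lift K P) (lift K P) = ((fst P)\<^sup>2 + K * (snd P \<bullet> snd P) - 1) / K"
    by (simp add: lor_def lift_def field_simps power2_eq_square)
  then show "P \<in> space_form K \<Longrightarrow> ?thesis"
    by (auto simp: space_form_def)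
qed

lemma lor_lift_dlift:
  assumes "P \<in> space_form K" "v \<in> tangent_space K P"
  shows "lor (lift K P) (dlift K P v) = 0"
proof (cases "K = 0")
  case True
  then show ?thesis
    using assms space_form_zero[of P] by (auto simp: lor_def lift_def dlift_def tangent_space_def)
next
  case False
  then have "lor (lift K P) (dlift K P v) = (fst P * fst v + K * (snd P \<bullet> snd v)) / K"
    by (simp add: lor_def lift_def dlift_def field_simps)
  then show ?thesis
    using assms(2) by (simp add: tangent_space_def)
qed

lemma lor_dlift_dlift:
  assumes "P \<in> space_form K" "v \<in> tangent_space K P" "w \<in> tangent_space K P"
  shows "lor (dlift K P v) (dlift K P w) = sf_metric K v w"
proof (cases "K = 0")
  case True
  then show ?thesis
    using assms space_form_zero[of P] by (auto simp: lor_def dlift_def tangent_space_def sf_metric_def)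
next
  case False
  then show ?thesis
    by (auto simp: lor_def dlift_def sf_metric_def field_simps)
qed

text \<open>The equation of the hyperplane. It picks one vector on every line of the cone that it meets, so a
  point is determined by its lift up to scale.\<close>

lemma lift_normalised:
  "P \<in> space_form K \<Longrightarrow> fst (snd (lift K P)) + K / 2 * snd (snd (lift K P)) = 1"
  using space_form_zero[of P] by (cases "K = 0") (auto simp: lift_def field_simps)

lemma lift_inj_up_to_scale:
  assumes "P \<in> space_form K" "Q \<in> space_form K" "lift K Q = r *\<^sub>R lift K P"
  shows "P = Q"
proof -
  have "r * (fst (snd (lift K P)) + K / 2 * snd (snd (lift K P))) = 1"
    using lift_normalised[OF assms(2)] unfolding assms(3) by (simp add: algebra_simps)
  then have "lift K Q = lift K P"
    using lift_normalised[OF assms(1)] assms(3) by simp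
  then show ?thesis by (simp add: lift_def prod_eq_iff)
qed

text \<open>Affine coordinates on the projectivised light cone: the stereographic projection that sends the
  null line of \<open>\<nu>\<close> to infinity.\<close>

definition cone_projection :: "(4 \<Rightarrow> lorentz) \<Rightarrow> lorentz \<Rightarrow> lorentz \<Rightarrow> real^4" where
  "cone_projection \<epsilon> \<nu> v = (\<chi> i. - lor v (\<epsilon> i) / lor v \<nu>)"

text \<open>On null vectors, the expansion in the basis \<open>\<epsilon>\<close>, \<open>\<nu>\<close>, \<open>\<nu>'\<close> recovers the product with \<open>\<nu>'\<close> from the
  others, which gives injectivity. The differential of a quotient of linear functions, evaluated with
  the same expansion, changes the form by the factor \<open>1 / lor v \<nu> ^ 2\<close>.\<close>

lemma cone_projection_conformal:
  assumes ortho: "\<And>i j. lor (\<epsilon> i) (\<epsilon> j) = (if i = j then 1 else 0)"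
    and null: "lor \<nu> \<nu> = 0" "lor \<nu>' \<nu>' = 0" "lor \<nu> \<nu>' = - 2" "\<And>i. lor (\<epsilon> i) \<nu> = 0" "\<And>i. lor (\<epsilon> i) \<nu>' = 0"
  shows "conformal_embedding K (\<lambda>P. cone_projection \<epsilon> \<nu> (lift K P)) {P. lor (lift K P) \<nu> \<noteq> 0}"
proof -
  let ?\<Omega> = "{P. lor (lift K P) \<nu> \<noteq> 0}" and ?\<Phi> = "\<lambda>P. cone_projection \<epsilon> \<nu> (lift K P)"
  have expand: "v = (\<Sum>i\<in>UNIV. lor v (\<epsilon> i) *\<^sub>R \<epsilon> i) - (lor v \<nu>' / 2) *\<^sub>R \<nu> - (lor v \<nu> / 2) *\<^sub>R \<nu>'" for v
    using lor_expansion[of "\<epsilon> 1" "\<epsilon> 2" "\<epsilon> 3" "\<epsilon> 4" \<nu> "(1/2) *\<^sub>R \<nu>'" v]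
    by (simp add: ortho null lor_simps lor_commute[of \<nu>' \<nu>] sum_4 algebra_simps)
  have parseval: "(\<Sum>i\<in>UNIV. lor v (\<epsilon> i) * lor w (\<epsilon> i))
      = lor v w + (lor v \<nu> * lor w \<nu>' + lor v \<nu>' * lor w \<nu>) / 2" for v w
    using arg_cong[OF expand[of w], of "lor v"] by (simp add: lor_simps sum_4 algebra_simps add_divide_distrib)
  have lift_smooth: "smooth_on UNIV (lift K)"
    using smooth_on_lift[of UNIV "\<lambda>P. P" K] smooth_on_linear[OF open_UNIV bounded_linear_ident] by simp
  then have lor_smooth: "smooth_on UNIV (\<lambda>P. lor (lift K P) e)" for e
    by (intro smooth_on_bilinear[OF bounded_bilinear_lor] smooth_on_const) auto
  have "open ?\<Omega>"
    using smooth_on_continuous[OF lor_smooth, of \<nu>] by (intro open_Collect_neq) auto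
  have "smooth_on ?\<Omega> ?\<Phi>"
    unfolding cone_projection_def
    by (intro smooth_on_vec_lambda smooth_on_divide smooth_on_minus \<open>open ?\<Omega>\<close>
        smooth_on_subset[OF open_UNIV \<open>open ?\<Omega>\<close> _ lor_smooth]) auto
  moreover have "inj_on ?\<Phi> (?\<Omega> \<inter> space_form K)"
  proof (rule inj_onI)
    fix P Q assume P: "P \<in> ?\<Omega> \<inter> space_form K" and Q: "Q \<in> ?\<Omega> \<inter> space_form K" and eq: "?\<Phi> P = ?\<Phi> Q"
    define r where "r = lor (lift K Q) \<nu> / lor (lift K P) \<nu>"
    have "r \<noteq> 0" using P Q by (simp add: r_def)
    have \<nu>: "lor (lift K Q) \<nu> = r * lor (lift K P) \<nu>" using P by (simp add: r_def)
    have \<epsilon>: "lor (lift K Q) (\<epsilon> i) = r * lor (lift K P) (\<epsilon> i)" for i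
      using eq P Q by (simp add: cone_projection_def vec_eq_iff r_def field_simps)
    have null: "(\<Sum>i\<in>UNIV. lor (lift K P) (\<epsilon> i) * lor (lift K P) (\<epsilon> i)) = lor (lift K P) \<nu> * lor (lift K P) \<nu>'"
      if "P \<in> space_form K" for P
      using parseval[of "lift K P" "lift K P"] lift_null[OF that] by simp
    have "lor (lift K Q) \<nu> * lor (lift K Q) \<nu>' = r * r * (lor (lift K P) \<nu> * lor (lift K P) \<nu>')"
      using null[of P, symmetric] null[of Q, symmetric] P Q by (simp add: \<epsilon> sum_distrib_left algebra_simps)
    then have \<nu>': "lor (lift K Q) \<nu>' = r * lor (lift K P) \<nu>'"
      unfolding \<nu> using P \<open>r \<noteq> 0\<close> by simp
    have "lift K Q = r *\<^sub>R lift K P"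
      using arg_cong[OF expand[of "lift K P"], of "(*\<^sub>R) r"]
      by (subst expand[of "lift K Q"]) (simp add: \<epsilon> \<nu> \<nu>' sum_4 algebra_simps)
    then show "P = Q" using P Q by (intro lift_inj_up_to_scale) blast+
  qed
  moreover have "\<exists>\<rho>>0. \<forall>v\<in>tangent_space K P. \<forall>w\<in>tangent_space K P.
      frechet_derivative ?\<Phi> (at P) v \<bullet> frechet_derivative ?\<Phi> (at P) w = \<rho> * sf_metric K v w"
    if P: "P \<in> ?\<Omega> \<inter> space_form K" for P
  proof -
    let ?L = "\<lambda>e. lor (lift K P) e" and ?d = "\<lambda>v e. lor (dlift K P v) e"
    have X: "?L \<nu> \<noteq> 0" using P by simp
    have dl: "((\<lambda>P. lor (lift K P) e) has_derivative (\<lambda>v. ?d v e)) (at P)" for e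
      using bounded_bilinear.FDERIV[OF bounded_bilinear_lor lift_has_derivative has_derivative_const]
      by (simp add: lor_simps)
    have "((\<lambda>P. - lor (lift K P) (\<epsilon> i) / lor (lift K P) \<nu>) has_derivative
        (\<lambda>v. (?L (\<epsilon> i) * ?d v \<nu> - ?d v (\<epsilon> i) * ?L \<nu>) / (?L \<nu>)\<^sup>2)) (at P)" for i
      using has_derivative_divide'[OF has_derivative_minus[OF dl[of "\<epsilon> i"]] dl[of \<nu>] X]
      by (simp add: power2_eq_square algebra_simps)
    then have "(?\<Phi> has_derivative
        (\<lambda>v. \<chi> i. (?L (\<epsilon> i) * ?d v \<nu> - ?d v (\<epsilon> i) * ?L \<nu>) / (?L \<nu>)\<^sup>2)) (at P)"
      unfolding cone_projection_def by (rule has_derivative_vecI)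
    from frechet_derivative_at[OF this, symmetric]
    have D: "frechet_derivative ?\<Phi> (at P) v \<bullet> frechet_derivative ?\<Phi> (at P) w = 
       (\<Sum>i\<in>UNIV. (?L (\<epsilon> i) * ?d v \<nu> - ?d v (\<epsilon> i) * ?L \<nu>) * (?L (\<epsilon> i) * ?d w \<nu> - ?d w (\<epsilon> i) * ?L \<nu>)) / (?L \<nu>)^4" for v w
      by (simp add: inner_vec_def sum_divide_distrib power2_eq_square power4_eq_xxxx mult.assoc)
    have "frechet_derivative ?\<Phi> (at P) v \<bullet> frechet_derivative ?\<Phi> (at P) w = (1 / (?L \<nu>)\<^sup>2) * sf_metric K v w"
      if vw: "v \<in> tangent_space K P" "w \<in> tangent_space K P" for v w
    proof -
      note [simp] = lift_null[of P K] lor_lift_dlift[of P K] lor_dlift_dlift[of P K]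
      have "(\<Sum>i\<in>UNIV. (?L (\<epsilon> i) * ?d v \<nu> - ?d v (\<epsilon> i) * ?L \<nu>) * (?L (\<epsilon> i) * ?d w \<nu> - ?d w (\<epsilon> i) * ?L \<nu>)) =
         (\<Sum>i\<in>UNIV. ?L (\<epsilon> i) * ?L (\<epsilon> i)) * (?d v \<nu> * ?d w \<nu>) - (\<Sum>i\<in>UNIV. ?L (\<epsilon> i) * ?d v (\<epsilon> i)) * (?L \<nu> * ?d w \<nu>)
         - (\<Sum>i\<in>UNIV. ?L (\<epsilon> i) * ?d w (\<epsilon> i)) * (?L \<nu> * ?d v \<nu>) + (\<Sum>i\<in>UNIV. ?d v (\<epsilon> i) * ?d w (\<epsilon> i)) * (?L \<nu> * ?L \<nu>)"
        by (simp add: sum_4 algebra_simps)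
      also have "\<dots> = (?L \<nu>)\<^sup>2 * sf_metric K v w"
        unfolding parseval using P vw by (simp add: field_simps power2_eq_square)
      finally show ?thesis unfolding D using X by (simp add: power2_eq_square power4_eq_xxxx)
    qed
    then show ?thesis using X by (intro exI[of _ "1 / (?L \<nu>)\<^sup>2"]) auto
  qed
  ultimately show ?thesis using \<open>open ?\<Omega>\<close> unfolding conformal_embedding_def by blast
qed

section \<open>The structure equations\<close>

text \<open>
  The data of a hypersurface in the light cone, normalised so that its metric is
  \<open>lam\<^sup>2 (c\<^sup>2 dx\<^sub>1\<^sup>2 + dx\<^sub>2\<^sup>2 + s\<^sup>2 dx\<^sub>3\<^sup>2)\<close> and the principal curvature of \<open>N\<close> in the second direction is
  zero. The functions \<open>t1\<close>, \<open>t2\<close>, \<open>t3\<close> express that \<open>N\<close> is only controlled modulo \<open>F\<close>.\<close>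

locale lame_frame =
  fixes U :: "(real^3) set" and lam \<alpha>1 \<alpha>3 \<xi>0 :: real
    and c s :: "real^3 \<Rightarrow> real" and F N :: "real^3 \<Rightarrow> lorentz"
    and k1 k3 t1 t2 t3 :: "real^3 \<Rightarrow> real"
  defines "c \<equiv> \<lambda>x. cos (\<alpha>1 * x $ 1 + \<alpha>3 * x $ 3 + \<xi>0)"
    and "s \<equiv> \<lambda>x. sin (\<alpha>1 * x $ 1 + \<alpha>3 * x $ 3 + \<xi>0)"
  assumes open_U: "open U" and conn_U: "connected U"
    and nz: "lam \<noteq> 0" "\<alpha>1 \<noteq> 0" "\<alpha>3 \<noteq> 0" "\<And>x. x \<in> U \<Longrightarrow> c x \<noteq> 0" "\<And>x. x \<in> U \<Longrightarrow> s x \<noteq> 0"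
    and smooth_F: "smooth_on U F" and smooth_N: "smooth_on U N"
    and FF: "\<And>x. x \<in> U \<Longrightarrow> lor (F x) (F x) = 0"
    and FN: "\<And>x. x \<in> U \<Longrightarrow> lor (F x) (N x) = 0"
    and NN: "\<And>x. x \<in> U \<Longrightarrow> lor (N x) (N x) = 1"
    and dF_N: "\<And>x i. x \<in> U \<Longrightarrow> lor (pd i F x) (N x) = 0"
    and dF_dF: "\<And>x. x \<in> U \<Longrightarrow> lor (pd 1 F x) (pd 1 F x) = (lam * c x)\<^sup>2"
      "\<And>x. x \<in> U \<Longrightarrow> lor (pd 2 F x) (pd 2 F x) = lam\<^sup>2"
      "\<And>x. x \<in> U \<Longrightarrow> lor (pd 3 F x) (pd 3 F x) = (lam * s x)\<^sup>2"
      "\<And>x. x \<in> U \<Longrightarrow> lor (pd 1 F x) (pd 2 F x) = 0"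
      "\<And>x. x \<in> U \<Longrightarrow> lor (pd 1 F x) (pd 3 F x) = 0"
      "\<And>x. x \<in> U \<Longrightarrow> lor (pd 2 F x) (pd 3 F x) = 0"
    and dN: "\<And>x. x \<in> U \<Longrightarrow> pd 1 N x = t1 x *\<^sub>R F x - k1 x *\<^sub>R pd 1 F x"
      "\<And>x. x \<in> U \<Longrightarrow> pd 2 N x = t2 x *\<^sub>R F x"
      "\<And>x. x \<in> U \<Longrightarrow> pd 3 N x = t3 x *\<^sub>R F x - k3 x *\<^sub>R pd 3 F x"
    and k: "\<And>x. x \<in> U \<Longrightarrow> k1 x \<noteq> 0" "\<And>x. x \<in> U \<Longrightarrow> k3 x \<noteq> 0" "\<And>x. x \<in> U \<Longrightarrow> k1 x \<noteq> k3 x"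
begin

text \<open>The field \<open>W\<close> stands for the missing second null vector of a basis: its product with \<open>F\<close> is \<open>- 1\<close>. It
  is obtained by differentiation, so no choice is involved, but its square \<open>w\<close> is
  unknown at first.\<close>

definition "E1 x = (1 / (lam * c x)) *\<^sub>R pd 1 F x"
definition "E2 x = (1 / lam) *\<^sub>R pd 2 F x"
definition "E3 x = (1 / (lam * s x)) *\<^sub>R pd 3 F x"
definition "W x = (1 / lam) *\<^sub>R pd 2 E2 x"
definition "w x = lor (W x) (W x)"

lemma smooth_c: "smooth_on U c" and smooth_s: "smooth_on U s"
  unfolding c_def s_def
  by (intro smooth_on_cos smooth_on_sin smooth_on_add smooth_on_mult smooth_on_const smooth_on_component open_U)+

lemma smooth_E: "smooth_on U E1" "smooth_on U E2" "smooth_on U E3"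
  unfolding E1_def[abs_def] E2_def[abs_def] E3_def[abs_def]
  by (intro smooth_on_scaleR smooth_on_divide smooth_on_mult smooth_on_const smooth_on_pd
      smooth_F smooth_c smooth_s open_U; simp add: nz)+

lemma smooth_W: "smooth_on U W"
  unfolding W_def[abs_def]
  by (intro smooth_on_scaleR smooth_on_const smooth_on_pd smooth_E open_U)

lemmas smooth_frame = smooth_F smooth_N smooth_E smooth_W

lemma smooth_pd_frame: "smooth_on U (pd i E1)" "smooth_on U (pd i E2)" "smooth_on U (pd i E3)" "smooth_on U (pd i W)"
  by (intro smooth_on_pd open_U smooth_frame)+

lemmas differentiable_frame = smooth_on_differentiable[OF open_U smooth_F] smooth_on_differentiable[OF open_U smooth_N]
  smooth_on_differentiable[OF open_U smooth_E(1)] smooth_on_differentiable[OF open_U smooth_E(2)]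
  smooth_on_differentiable[OF open_U smooth_E(3)] smooth_on_differentiable[OF open_U smooth_W]
  smooth_on_differentiable[OF open_U smooth_c] smooth_on_differentiable[OF open_U smooth_s]

lemma pd_c_s:
  "pd i c x = (if i = 1 then - \<alpha>1 * s x else if i = 3 then - \<alpha>3 * s x else 0)"
  "pd i s x = (if i = 1 then \<alpha>1 * c x else if i = 3 then \<alpha>3 * c x else 0)"
proof -
  let ?a = "\<lambda>x::real^3. \<alpha>1 * x $ 1 + \<alpha>3 * x $ 3 + \<xi>0"
  have D: "(?a has_derivative (\<lambda>h. \<alpha>1 * h $ 1 + \<alpha>3 * h $ 3)) (at x)"
    by (auto intro!: derivative_eq_intros bounded_linear_imp_has_derivative bounded_linear_vec_nth)
  then have diff: "?a differentiable at x" by (auto simp: differentiable_def)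
  have a: "pd i ?a x = (if i = 1 then \<alpha>1 else if i = 3 then \<alpha>3 else 0)"
    using pd_eqI[OF D, of i] by (auto simp: axis_def)
  show "pd i c x = (if i = 1 then - \<alpha>1 * s x else if i = 3 then - \<alpha>3 * s x else 0)"
    unfolding c_def s_def using pd_real_chain[OF diff DERIV_cos] a by simp
  show "pd i s x = (if i = 1 then \<alpha>1 * c x else if i = 3 then \<alpha>3 * c x else 0)"
    unfolding c_def s_def using pd_real_chain[OF diff DERIV_sin] a by simp
qed

lemma dF: assumes "x \<in> U"
  shows "pd 1 F x = (lam * c x) *\<^sub>R E1 x" "pd 2 F x = lam *\<^sub>R E2 x" "pd 3 F x = (lam * s x) *\<^sub>R E3 x"
  using nz assms by (auto simp: E1_def E2_def E3_def)

text \<open>Almost every coefficient below is computed by differentiating a known product of two fields.\<close>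

lemma leibniz:
  assumes "smooth_on U f" "smooth_on U g" "x \<in> U" "\<And>y. y \<in> U \<Longrightarrow> lor (f y) (g y) = r y"
  shows "lor (pd i f x) (g x) = pd i r x - lor (f x) (pd i g x)"
proof -
  have "pd i r x = pd i (\<lambda>y. lor (f y) (g y)) x"
    using assms by (intro pd_cong[OF open_U assms(3)]) simp
  also have "\<dots> = lor (f x) (pd i g x) + lor (pd i f x) (g x)"
    using assms by (intro pd_bilinear[OF bounded_bilinear_lor]) (auto intro: smooth_on_differentiable[OF open_U])
  finally show ?thesis by simp
qed

lemma leibniz_const:
  assumes "smooth_on U f" "smooth_on U g" "\<And>y. y \<in> U \<Longrightarrow> lor (f y) (g y) = r" "x \<in> U" 
  shows "lor (pd i f x) (g x) = - lor (f x) (pd i g x)"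
  using leibniz[OF assms(1,2,4), of "\<lambda>_. r" i] assms(3) by (simp add: pd_const)

lemma leibniz_self:
  assumes "smooth_on U f" "\<And>y. y \<in> U \<Longrightarrow> lor (f y) (f y) = r" "x \<in> U" 
  shows "lor (pd i f x) (f x) = 0"
  using leibniz_const[OF assms(1,1,2,3), of i] lor_commute[of "f x"] by simp

lemma gram: assumes "x \<in> U"
  shows "lor (E1 x) (E1 x) = 1" "lor (E2 x) (E2 x) = 1" "lor (E3 x) (E3 x) = 1"
    "lor (E1 x) (E2 x) = 0" "lor (E1 x) (E3 x) = 0" "lor (E2 x) (E3 x) = 0"
    "lor (E1 x) (N x) = 0" "lor (E2 x) (N x) = 0" "lor (E3 x) (N x) = 0"
    "lor (E1 x) (F x) = 0" "lor (E2 x) (F x) = 0" "lor (E3 x) (F x) = 0"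
    "lor (N x) (F x) = 0"
  using nz assms dF_dF[OF assms] dF_N[OF assms] leibniz_self[OF smooth_F FF assms] FN[OF assms]
  by (simp_all add: E1_def E2_def E3_def lor_simps power2_eq_square lor_commute[of "N x"])

lemma W_F: "x \<in> U \<Longrightarrow> lor (W x) (F x) = - 1"
  using leibniz_const[OF smooth_E(2) smooth_F gram(11), of x 2] nz gram(2)[of x]
  by (simp add: W_def lor_simps dF)

lemma W_E2: "x \<in> U \<Longrightarrow> lor (W x) (E2 x) = 0"
  using leibniz_self[OF smooth_E(2) gram(2), of x 2] by (simp add: W_def lor_simps)

lemma W_N: "x \<in> U \<Longrightarrow> lor (W x) (N x) = 0"
  using leibniz_const[OF smooth_E(2) smooth_N gram(8), of x 2] gram(11)[of x]
  by (simp add: W_def lor_simps dN)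

text \<open>The three identities \<open>F\<^sub>,\<^sub>i\<^sub>j = F\<^sub>,\<^sub>j\<^sub>i\<close>. They play the role of a torsion-free connection.\<close>

lemma mixed12: "x \<in> U \<Longrightarrow> pd 1 E2 x = c x *\<^sub>R pd 2 E1 x"
proof -
  assume x: "x \<in> U"
  have "pd 2 (pd 1 F) x = pd 2 (\<lambda>y. (lam * c y) *\<^sub>R E1 y) x" "pd 1 (pd 2 F) x = pd 1 (\<lambda>y. lam *\<^sub>R E2 y) x"
    by (intro pd_cong[OF open_U x] dF; assumption)+
  with pd_commute[OF open_U smooth_F x, of 1 2] 
  have "lam *\<^sub>R pd 1 E2 x = lam *\<^sub>R (c x *\<^sub>R pd 2 E1 x)"
    using x by (simp add: pd_scaleR pd_mult pd_const pd_c_s differentiable_frame)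
  then show ?thesis by (rule scaleR_left_imp_eq[OF nz(1)])
qed

lemma mixed32: "x \<in> U \<Longrightarrow> pd 3 E2 x = s x *\<^sub>R pd 2 E3 x"
proof -
  assume x: "x \<in> U"
  have "pd 2 (pd 3 F) x = pd 2 (\<lambda>y. (lam * s y) *\<^sub>R E3 y) x" "pd 3 (pd 2 F) x = pd 3 (\<lambda>y. lam *\<^sub>R E2 y) x"
    by (intro pd_cong[OF open_U x] dF; assumption)+
  with pd_commute[OF open_U smooth_F x, of 3 2] 
  have "lam *\<^sub>R pd 3 E2 x = lam *\<^sub>R (s x *\<^sub>R pd 2 E3 x)"
    using x by (simp add: pd_scaleR pd_mult pd_const pd_c_s differentiable_frame)
  then show ?thesis by (rule scaleR_left_imp_eq[OF nz(1)])
qed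

lemma mixed13: "x \<in> U \<Longrightarrow>
  c x *\<^sub>R pd 3 E1 x - (\<alpha>3 * s x) *\<^sub>R E1 x = s x *\<^sub>R pd 1 E3 x + (\<alpha>1 * c x) *\<^sub>R E3 x"
proof -
  assume x: "x \<in> U"
  have "pd 3 (pd 1 F) x = pd 3 (\<lambda>y. (lam * c y) *\<^sub>R E1 y) x" "pd 1 (pd 3 F) x = pd 1 (\<lambda>y. (lam * s y) *\<^sub>R E3 y) x"
    by (intro pd_cong[OF open_U x] dF; assumption)+
  with pd_commute[OF open_U smooth_F x, of 1 3] 
  have "lam *\<^sub>R (c x *\<^sub>R pd 3 E1 x - (\<alpha>3 * s x) *\<^sub>R E1 x) = lam *\<^sub>R (s x *\<^sub>R pd 1 E3 x + (\<alpha>1 * c x) *\<^sub>R E3 x)"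
    using x by (simp add: pd_scaleR pd_mult pd_const pd_c_s differentiable_frame algebra_simps)
  then show ?thesis using nz by simp
qed

lemma W_E1: "x \<in> U \<Longrightarrow> lor (W x) (E1 x) = 0"
  using leibniz_const[OF smooth_E(2) smooth_E(1), of 0 x 2] gram(4)
    leibniz_self[OF smooth_E(2) gram(2), of x 1] nz(4)[of x] mixed12[of x]
  by (simp add: W_def lor_simps lor_commute[of "E2 _"])

lemma W_E3: "x \<in> U \<Longrightarrow> lor (W x) (E3 x) = 0"
  using leibniz_const[OF smooth_E(2) smooth_E(3), of 0 x 2] gram(6)
    leibniz_self[OF smooth_E(2) gram(2), of x 3] nz(5)[of x] mixed32[of x]
  by (simp add: W_def lor_simps lor_commute[of "E2 _"])

lemmas gram_sym = gram[THEN trans[OF lor_commute]]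

lemmas frame_gram = gram gram_sym FF NN FN W_F W_E1 W_E2 W_E3 W_N
  W_F[THEN trans[OF lor_commute]] W_E1[THEN trans[OF lor_commute]] W_E2[THEN trans[OF lor_commute]]
  W_E3[THEN trans[OF lor_commute]] W_N[THEN trans[OF lor_commute]]

lemma expand: assumes "x \<in> U"
  shows "v = lor v (E1 x) *\<^sub>R E1 x + lor v (E2 x) *\<^sub>R E2 x + lor v (E3 x) *\<^sub>R E3 x + lor v (N x) *\<^sub>R N x
    - (lor v (W x) + w x * lor v (F x)) *\<^sub>R F x - lor v (F x) *\<^sub>R W x"
  unfolding w_def by (rule lor_expansion) (simp_all add: frame_gram assms)

lemma d_E_F: assumes "x \<in> U"
  shows "lor (pd i E1 x) (F x) = - lor (E1 x) (pd i F x)"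
   "lor (pd i E2 x) (F x) = - lor (E2 x) (pd i F x)"
   "lor (pd i E3 x) (F x) = - lor (E3 x) (pd i F x)"
  using leibniz_const[OF smooth_E(1) smooth_F, of 0 x i] leibniz_const[OF smooth_E(2) smooth_F, of 0 x i]
    leibniz_const[OF smooth_E(3) smooth_F, of 0 x i] by (simp_all add: frame_gram assms)

lemma d_E_N: assumes "x \<in> U"
  shows "lor (pd i E1 x) (N x) = - lor (E1 x) (pd i N x)"
   "lor (pd i E2 x) (N x) = - lor (E2 x) (pd i N x)"
   "lor (pd i E3 x) (N x) = - lor (E3 x) (pd i N x)"
  using leibniz_const[OF smooth_E(1) smooth_N, of 0 x i] leibniz_const[OF smooth_E(2) smooth_N, of 0 x i]
    leibniz_const[OF smooth_E(3) smooth_N, of 0 x i] by (simp_all add: frame_gram assms)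

lemma d_E_E: assumes "x \<in> U"
  shows "lor (pd i E1 x) (E1 x) = 0" "lor (pd i E2 x) (E2 x) = 0" "lor (pd i E3 x) (E3 x) = 0"
   "lor (pd i E1 x) (E2 x) = - lor (pd i E2 x) (E1 x)"
   "lor (pd i E3 x) (E1 x) = - lor (pd i E1 x) (E3 x)"
   "lor (pd i E3 x) (E2 x) = - lor (pd i E2 x) (E3 x)"
  using leibniz_self[OF smooth_E(1) gram(1) assms, of i] leibniz_self[OF smooth_E(2) gram(2) assms, of i]
    leibniz_self[OF smooth_E(3) gram(3) assms, of i] leibniz_const[OF smooth_E(1,2), of 0 x i] 
    leibniz_const[OF smooth_E(3,1), of 0 x i] leibniz_const[OF smooth_E(3,2), of 0 x i]
  by (simp_all add: frame_gram assms lor_commute[of "E1 x"] lor_commute[of "E2 x"] lor_commute[of "E3 x"])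

lemma d1E2_E1: "x \<in> U \<Longrightarrow> lor (pd 1 E2 x) (E1 x) = 0"
  by (simp add: mixed12 lor_simps d_E_E(1))

lemma d3E2_E3: "x \<in> U \<Longrightarrow> lor (pd 3 E2 x) (E3 x) = 0"
  by (simp add: mixed32 lor_simps d_E_E(3))

text \<open>Chaining the symmetry of second derivatives of \<open>F\<close> with the orthogonality of the \<open>E\<close>s three times
  shows that the coefficient equals its own negative, as for any orthogonal
  coordinate system.\<close>

lemma d1E2_E3: assumes x: "x \<in> U" shows "lor (pd 1 E2 x) (E3 x) = 0"
proof -
  have "lor (pd 1 E2 x) (E3 x) = c x * lor (pd 2 E1 x) (E3 x)"
    by (simp add: mixed12 lor_simps x)
  also have "\<dots> = - c x * lor (pd 2 E3 x) (E1 x)" using d_E_E(5)[OF x, of 2] by simp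
  also have "s x * \<dots> = - c x * lor (pd 3 E2 x) (E1 x)" by (simp add: mixed32 lor_simps x)
  also have "\<dots> = c x * lor (pd 3 E1 x) (E2 x)" using d_E_E(4)[OF x, of 3] by simp
  also have "\<dots> = s x * lor (pd 1 E3 x) (E2 x)"
    using arg_cong[OF mixed13[OF x], of "\<lambda>v. lor v (E2 x)"] by (simp add: lor_simps frame_gram x)
  also have "\<dots> = - s x * lor (pd 1 E2 x) (E3 x)" using d_E_E(6)[OF x, of 1] by simp
  finally show ?thesis using nz(5)[OF x] by simp
qed

lemma d3E2_E1: assumes x: "x \<in> U" shows "lor (pd 3 E2 x) (E1 x) = 0"
proof -
  have "c x * lor (pd 3 E2 x) (E1 x) = - s x * lor (pd 1 E3 x) (E2 x)"
    using arg_cong[OF mixed13[OF x], of "\<lambda>v. lor v (E2 x)"] d_E_E(4)[OF x, of 3] by (simp add: lor_simps frame_gram x)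
  then show ?thesis using d_E_E(6)[OF x, of 1] d1E2_E3[OF x] nz(4)[OF x] by simp
qed

lemma d1E3_E1: assumes x: "x \<in> U" shows "lor (pd 1 E3 x) (E1 x) = - \<alpha>3"
proof -
  have "s x * (lor (pd 1 E3 x) (E1 x) + \<alpha>3) = 0"
    using arg_cong[OF mixed13[OF x], of "\<lambda>v. lor v (E1 x)"] 
    by (simp add: lor_simps frame_gram x d_E_E(1) algebra_simps)
  then show ?thesis using nz(5)[OF x] by simp
qed

lemma d3E1_E3: assumes x: "x \<in> U" shows "lor (pd 3 E1 x) (E3 x) = \<alpha>1"
proof -
  have "c x * (lor (pd 3 E1 x) (E3 x) - \<alpha>1) = 0"
    using arg_cong[OF mixed13[OF x], of "\<lambda>v. lor v (E3 x)"] 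
    by (simp add: lor_simps frame_gram x d_E_E(3) algebra_simps)
  then show ?thesis using nz(4)[OF x] by simp
qed


lemma d1E2_parallel_F: assumes x: "x \<in> U" shows "pd 1 E2 x = - lor (pd 1 E2 x) (W x) *\<^sub>R F x"
  by (subst expand[OF x, of "pd 1 E2 x"])
    (simp add: d1E2_E1 d1E2_E3 d_E_E d_E_F d_E_N dF dN lor_simps frame_gram x)

lemma d3E2_parallel_F: assumes x: "x \<in> U" shows "pd 3 E2 x = - lor (pd 3 E2 x) (W x) *\<^sub>R F x"
  by (subst expand[OF x, of "pd 3 E2 x"])
    (simp add: d3E2_E1 d3E2_E3 d_E_E d_E_F d_E_N dF dN lor_simps frame_gram x)

lemma d2E1_parallel_F: assumes x: "x \<in> U" shows "\<exists>r. pd 2 E1 x = r *\<^sub>R F x"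
proof -
  have "pd 2 E1 x = (1 / c x) *\<^sub>R pd 1 E2 x" using nz(4)[OF x] by (simp add: mixed12 x)
  then show ?thesis using d1E2_parallel_F[OF x] by (metis scaleR_scaleR)
qed

lemma d2E3_parallel_F: assumes x: "x \<in> U" shows "\<exists>r. pd 2 E3 x = r *\<^sub>R F x"
proof -
  have "pd 2 E3 x = (1 / s x) *\<^sub>R pd 3 E2 x" using nz(5)[OF x] by (simp add: mixed32 x)
  then show ?thesis using d3E2_parallel_F[OF x] by (metis scaleR_scaleR)
qed

lemma d2_E_E: assumes x: "x \<in> U"
  shows "lor (pd 2 E1 x) (E2 x) = 0" "lor (pd 2 E1 x) (E3 x) = 0" "lor (pd 2 E3 x) (E1 x) = 0" "lor (pd 2 E3 x) (E2 x) = 0"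
  using d2E1_parallel_F[OF x] d2E3_parallel_F[OF x] by (auto simp: lor_simps frame_gram x)

lemma dd21: "x \<in> U \<Longrightarrow> pd 2 (pd 1 E1) x = pd 1 (pd 2 E1) x"
  and dd23: "x \<in> U \<Longrightarrow> pd 2 (pd 3 E3) x = pd 3 (pd 2 E3) x"
  by (rule pd_commute[OF open_U smooth_E(1)] pd_commute[OF open_U smooth_E(3)]; assumption)+

text \<open>So far the derivatives of \<open>E1\<close>, \<open>E3\<close> in direction 2 are unknown multiples of \<open>F\<close>. The commutation of
  the derivatives of \<open>E1\<close> in directions 1 and 2, paired with \<open>E3\<close>, isolates the multiple for \<open>E3\<close>, since
  \<open>pd 1 E1\<close> has a nonzero product with \<open>F\<close>. The next lemma exchanges the roles of 1 and 3.\<close>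

lemma d2E3_zero: assumes x: "x \<in> U" shows "pd 2 E3 x = 0"
proof -
  obtain r q where r: "pd 2 E1 x = r *\<^sub>R F x" and q: "pd 2 E3 x = q *\<^sub>R F x"
    using d2E1_parallel_F[OF x] d2E3_parallel_F[OF x] by auto
  have "lor (pd 2 (pd 1 E1) x) (E3 x) = - lor (pd 1 E1 x) (pd 2 E3 x)"
    using d_E_E(5) d1E3_E1 by (intro leibniz_const[OF smooth_pd_frame(1) smooth_E(3) _ x]) force
  moreover have "lor (pd 1 (pd 2 E1) x) (E3 x) = - lor (pd 2 E1 x) (pd 1 E3 x)"
    using d2_E_E by (intro leibniz_const[OF smooth_pd_frame(1) smooth_E(3) _ x])
  ultimately have "lor (pd 1 E1 x) (pd 2 E3 x) = lor (pd 2 E1 x) (pd 1 E3 x)"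
    using dd21[OF x] by simp
  then have "q * (lam * c x) = 0"
    using d_E_F[OF x, of 1] by (simp add: r q lor_simps lor_commute[of "F x"] dF frame_gram x)
  then show ?thesis using nz(1) nz(4)[OF x] q by simp
qed

lemma d2E1_zero: assumes x: "x \<in> U" shows "pd 2 E1 x = 0"
proof -
  obtain r q where r: "pd 2 E1 x = r *\<^sub>R F x" and q: "pd 2 E3 x = q *\<^sub>R F x"
    using d2E1_parallel_F[OF x] d2E3_parallel_F[OF x] by auto
  have "lor (pd 2 (pd 3 E3) x) (E1 x) = - lor (pd 3 E3 x) (pd 2 E1 x)"
    using d_E_E(5) d3E1_E3 by (intro leibniz_const[OF smooth_pd_frame(3) smooth_E(1) _ x]) force
  moreover have "lor (pd 3 (pd 2 E3) x) (E1 x) = - lor (pd 2 E3 x) (pd 3 E1 x)"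
    using d2_E_E by (intro leibniz_const[OF smooth_pd_frame(3) smooth_E(1) _ x])
  ultimately have "lor (pd 3 E3 x) (pd 2 E1 x) = lor (pd 2 E3 x) (pd 3 E1 x)"
    using dd23[OF x] by simp
  then have "r * (lam * s x) = 0"
    using d_E_F[OF x, of 3] by (simp add: r q lor_simps lor_commute[of "F x"] dF frame_gram x)
  then show ?thesis using nz(1) nz(5)[OF x] r by simp
qed

lemma dd2_zero: assumes x: "x \<in> U" shows "pd 2 (pd i E1) x = 0" "pd 2 (pd i E3) x = 0"
proof -
  have "pd i (pd 2 E1) x = pd i (\<lambda>_. 0) x" "pd i (pd 2 E3) x = pd i (\<lambda>_. 0) x"
    by (intro pd_cong[OF open_U x] d2E1_zero d2E3_zero; assumption)+
  then show "pd 2 (pd i E1) x = 0" "pd 2 (pd i E3) x = 0"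
    using pd_commute[OF open_U smooth_E(1) x, of 2 i] pd_commute[OF open_U smooth_E(3) x, of 2 i]
    by (simp_all add: pd_const)
qed

lemma d1E2_zero: "x \<in> U \<Longrightarrow> pd 1 E2 x = 0"
  and d3E2_zero: "x \<in> U \<Longrightarrow> pd 3 E2 x = 0"
  by (simp_all add: mixed12 mixed32 d2E1_zero d2E3_zero)

lemma d2E2: "pd 2 E2 x = lam *\<^sub>R W x"
  using nz(1) by (simp add: W_def)

lemma dW: assumes x: "x \<in> U" shows "pd 1 W x = 0" "pd 3 W x = 0"
proof -
  have "pd i (pd 2 E2) x = pd 2 (pd i E2) x" for i
    by (rule pd_commute[OF open_U smooth_E(2) x])
  moreover have "pd 2 (pd 1 E2) x = pd 2 (\<lambda>_. 0) x" "pd 2 (pd 3 E2) x = pd 2 (\<lambda>_. 0) x"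
    by (intro pd_cong[OF open_U x] d1E2_zero d3E2_zero; assumption)+
  moreover have "pd i W x = (1 / lam) *\<^sub>R pd i (pd 2 E2) x" for i
    unfolding W_def[abs_def]
    using smooth_on_differentiable[OF open_U smooth_pd_frame(2) x] by (simp add: pd_scaleR pd_const)
  ultimately show "pd 1 W x = 0" "pd 3 W x = 0" by (simp_all add: pd_const)
qed

lemma t13_zero: assumes x: "x \<in> U" shows "t1 x = 0" "t3 x = 0"
  using leibniz_const[OF smooth_N smooth_W, of 0 x 1] leibniz_const[OF smooth_N smooth_W, of 0 x 3]
  by (simp_all add: frame_gram dN dW dF lor_simps x)

text \<open>The products with \<open>W\<close> determine the components along \<open>F\<close>. Up to the factor \<open>lam\<close>, \<open>W\<close> is \<open>pd 2 E2\<close>, and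
  the product with \<open>E2\<close> vanishes along with its derivative in direction 2.\<close>

lemma dE_W: assumes x: "x \<in> U"
  shows "lor (pd 1 E1 x) (W x) = 0" "lor (pd 3 E1 x) (W x) = 0" "lor (pd 1 E3 x) (W x) = 0" "lor (pd 3 E3 x) (W x) = 0"
proof -
  have "lor (pd i E1 y) (E2 y) = 0" "lor (pd i E3 y) (E2 y) = 0" if "i = 1 \<or> i = 3" "y \<in> U" for i y
    using that d_E_E(4,6)[OF that(2), of i] by (auto simp: d1E2_zero d3E2_zero lor_simps)
  then have "lor (pd 2 (pd i E1) x) (E2 x) = - lor (pd i E1 x) (pd 2 E2 x)"
    "lor (pd 2 (pd i E3) x) (E2 x) = - lor (pd i E3 x) (pd 2 E2 x)" if "i = 1 \<or> i = 3" for i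
    using that by (intro leibniz_const[OF smooth_pd_frame(1) smooth_E(2) _ x] leibniz_const[OF smooth_pd_frame(3) smooth_E(2) _ x]; blast)+
  then show "lor (pd 1 E1 x) (W x) = 0" "lor (pd 3 E1 x) (W x) = 0" "lor (pd 1 E3 x) (W x) = 0" "lor (pd 3 E3 x) (W x) = 0"
    using nz(1) by (simp_all add: dd2_zero x d2E2 lor_simps)
qed

text \<open>The second fundamental form of \<open>N\<close>, divided by \<open>l\<^sub>1\<close> and \<open>l\<^sub>3\<close>, respectively. Working with these products
  instead of \<open>k1\<close> and \<open>k3\<close> makes smoothness automatic and the Codazzi equations linear.\<close>

definition "a x = lor (pd 1 E1 x) (N x)"
definition "b x = lor (pd 3 E3 x) (N x)"

lemma ab_k: "x \<in> U \<Longrightarrow> a x = k1 x * (lam * c x)" "x \<in> U \<Longrightarrow> b x = k3 x * (lam * s x)"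
  by (simp_all add: a_def b_def d_E_N dN dF frame_gram lor_simps)

lemma dN_ab: "x \<in> U \<Longrightarrow> pd 1 N x = - a x *\<^sub>R E1 x" "x \<in> U \<Longrightarrow> pd 3 N x = - b x *\<^sub>R E3 x"
  by (simp_all add: ab_k dN dF t13_zero)

lemma dE: assumes x: "x \<in> U"
  shows "pd 1 E1 x = (lam * c x) *\<^sub>R (W x + w x *\<^sub>R F x) + a x *\<^sub>R N x + \<alpha>3 *\<^sub>R E3 x"
    "pd 3 E3 x = (lam * s x) *\<^sub>R (W x + w x *\<^sub>R F x) + b x *\<^sub>R N x - \<alpha>1 *\<^sub>R E1 x"
    "pd 1 E3 x = - \<alpha>3 *\<^sub>R E1 x" "pd 3 E1 x = \<alpha>1 *\<^sub>R E3 x"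
proof -
  have e: "lor (pd 1 E1 x) (E3 x) = \<alpha>3" "lor (pd 3 E3 x) (E1 x) = - \<alpha>1"
    using d_E_E(5)[OF x] d1E3_E1[OF x] d3E1_E3[OF x] by simp_all
  note simps = e dE_W d_E_E(1-4) d_E_E(6) d1E3_E1 d3E1_E3 d_E_F d_E_N dF dN_ab d1E2_zero d3E2_zero lor_simps frame_gram x
  show "pd 1 E1 x = (lam * c x) *\<^sub>R (W x + w x *\<^sub>R F x) + a x *\<^sub>R N x + \<alpha>3 *\<^sub>R E3 x"
    by (subst expand[OF x, of "pd 1 E1 x"]) (simp add: simps algebra_simps)
  show "pd 3 E3 x = (lam * s x) *\<^sub>R (W x + w x *\<^sub>R F x) + b x *\<^sub>R N x - \<alpha>1 *\<^sub>R E1 x"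
    by (subst expand[OF x, of "pd 3 E3 x"]) (simp add: simps algebra_simps)
  show "pd 1 E3 x = - \<alpha>3 *\<^sub>R E1 x"
    by (subst expand[OF x, of "pd 1 E3 x"]) (simp add: simps)
  show "pd 3 E1 x = \<alpha>1 *\<^sub>R E3 x"
    by (subst expand[OF x, of "pd 3 E1 x"]) (simp add: simps)
qed

lemma dd13: assumes x: "x \<in> U"
  shows "pd 3 (pd 1 E1) x = (- \<alpha>1 * \<alpha>3) *\<^sub>R E1 x" "pd 1 (pd 3 E3) x = (- \<alpha>1 * \<alpha>3) *\<^sub>R E3 x"
proof -
  have "pd 1 (pd 3 E1) x = pd 1 (\<lambda>y. \<alpha>1 *\<^sub>R E3 y) x" "pd 3 (pd 1 E3) x = pd 3 (\<lambda>y. (- \<alpha>3) *\<^sub>R E1 y) x"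
    by (intro pd_cong[OF open_U x] dE; assumption)+
  then show "pd 3 (pd 1 E1) x = (- \<alpha>1 * \<alpha>3) *\<^sub>R E1 x" "pd 1 (pd 3 E3) x = (- \<alpha>1 * \<alpha>3) *\<^sub>R E3 x"
    using pd_commute[OF open_U smooth_E(1) x, of 3 1] pd_commute[OF open_U smooth_E(3) x, of 1 3]
    by (simp_all add: pd_scaleR pd_const pd_minus differentiable_frame dE x)
qed

text \<open>The Gauss equation for the flat metric in the plane of \<open>E1\<close> and \<open>E3\<close>. It determines the unknown
  square \<open>w\<close> in terms of the principal curvatures.\<close>

lemma w_eq: assumes x: "x \<in> U" shows "a x * b x = w x * lam\<^sup>2 * s x * c x" "w x = k1 x * k3 x"
proof -
  have "lor (pd 1 (pd 3 E3) x) (E1 x) = - lor (pd 3 E3 x) (pd 1 E1 x)"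
    using d_E_E(5) d3E1_E3 by (intro leibniz_const[OF smooth_pd_frame(3) smooth_E(1) _ x]) force
  then show 1: "a x * b x = w x * lam\<^sup>2 * s x * c x"
    by (simp add: dd13 dE lor_simps frame_gram x w_def[symmetric] power2_eq_square algebra_simps)
  show "w x = k1 x * k3 x"
    using 1 nz(1) nz(4,5)[OF x] by (simp add: ab_k x power2_eq_square)
qed

text \<open>The Codazzi equations, which are linear because the rotation coefficients of the metric are the
  constants \<open>\<alpha>1\<close> and \<open>- \<alpha>3\<close>.\<close>

lemma da: assumes x: "x \<in> U" shows "pd 3 a x = - \<alpha>3 * b x"
  using leibniz[OF smooth_pd_frame(1) smooth_N x, of 1 a 3]
  by (simp add: a_def[symmetric] dd13 dE dN_ab lor_simps frame_gram x eq_neg_iff_add_eq_0 mult.commute)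

lemma db: assumes x: "x \<in> U" shows "pd 1 b x = \<alpha>1 * a x"
  using leibniz[OF smooth_pd_frame(3) smooth_N x, of 3 b 1]
  by (simp add: b_def[symmetric] dd13 dE dN_ab lor_simps frame_gram x)

lemma smooth_ab: "smooth_on U a" "smooth_on U b" "smooth_on U w"
  unfolding a_def[abs_def] b_def[abs_def] w_def[abs_def]
  by (intro smooth_on_bilinear[OF bounded_bilinear_lor] smooth_pd_frame smooth_N smooth_W open_U)+

lemma dw: assumes x: "x \<in> U" shows "pd i w x = 2 * lor (W x) (pd i W x)"
  using leibniz[OF smooth_W smooth_W x, of w i] by (simp add: w_def[symmetric] lor_commute[of "pd i W x"])

text \<open>Differentiating the vanishing products of \<open>W\<close> with \<open>pd 1 E1\<close> and \<open>pd 3 E3\<close> in direction 2 gives two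
  linear equations for \<open>pd 2 w\<close> and \<open>t2\<close> whose determinant is proportional to \<open>k1 - k3\<close>.\<close>

lemma d2_invariants: assumes x: "x \<in> U" shows "t2 x = 0" "pd 2 w x = 0"
proof -
  have W2: "lor (N x) (pd 2 W x) = t2 x" "lor (F x) (pd 2 W x) = 0" "lor (E1 x) (pd 2 W x) = 0" "lor (E3 x) (pd 2 W x) = 0"
    using leibniz_const[OF smooth_N smooth_W, of 0 x 2] leibniz_const[OF smooth_F smooth_W, of "- 1" x 2]
      leibniz_const[OF smooth_E(1) smooth_W, of 0 x 2] leibniz_const[OF smooth_E(3) smooth_W, of 0 x 2]
    by (simp_all add: frame_gram dN dF d2E1_zero d2E3_zero lor_simps x)
  have "lor (pd 1 E1 x) (pd 2 W x) = 0" "lor (pd 3 E3 x) (pd 2 W x) = 0"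
    using leibniz_const[OF smooth_pd_frame(1) smooth_W, of 1 0 x 2] leibniz_const[OF smooth_pd_frame(3) smooth_W, of 3 0 x 2]
    by (simp_all add: dE_W dd2_zero lor_simps x)
  then have "(lam * c x) * (pd 2 w x / 2 + k1 x * t2 x) = 0" "(lam * s x) * (pd 2 w x / 2 + k3 x * t2 x) = 0"
    by (simp_all add: dE W2 dw lor_simps x ab_k algebra_simps)
  then have 1: "pd 2 w x / 2 + k1 x * t2 x = 0" "pd 2 w x / 2 + k3 x * t2 x = 0"
    using nz(1) nz(4,5)[OF x] by simp_all
  have "(k1 x - k3 x) * t2 x = (pd 2 w x / 2 + k1 x * t2 x) - (pd 2 w x / 2 + k3 x * t2 x)"
    by (simp add: algebra_simps)
  then have "(k1 x - k3 x) * t2 x = 0" unfolding 1 by simp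
  then show "t2 x = 0" using k(3)[OF x] by simp
  with 1 show "pd 2 w x = 0" by simp
qed

lemma w_constant: "\<exists>w0. \<forall>x\<in>U. w x = w0"
proof (rule pd_zero_imp_constant[OF open_U conn_U smooth_ab(3)])
  fix x and i :: 3 assume x: "x \<in> U"
  show "pd i w x = 0"
    using exhaust_3[of i] dw[OF x, of 1] dw[OF x, of 3] dW[OF x] d2_invariants(2)[OF x] by (auto simp: lor_simps)
qed

lemma d_ab_product:
  assumes x: "x \<in> U" and \<kappa>: "\<And>y. y \<in> U \<Longrightarrow> a y * b y = \<kappa> * (s y * c y)"
  shows "b x * pd 1 a x = \<alpha>1 * (\<kappa> * ((c x)\<^sup>2 - (s x)\<^sup>2) - (a x)\<^sup>2)"
    "a x * pd 3 b x = \<alpha>3 * (\<kappa> * ((c x)\<^sup>2 - (s x)\<^sup>2) + (b x)\<^sup>2)"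
proof -
  have "pd i (\<lambda>y. a y * b y) x = pd i (\<lambda>y. \<kappa> * (s y * c y)) x" for i
    by (rule pd_cong[OF open_U x \<kappa>])
  from this[of 1] this[of 3]
  show "b x * pd 1 a x = \<alpha>1 * (\<kappa> * ((c x)\<^sup>2 - (s x)\<^sup>2) - (a x)\<^sup>2)"
    "a x * pd 3 b x = \<alpha>3 * (\<kappa> * ((c x)\<^sup>2 - (s x)\<^sup>2) + (b x)\<^sup>2)"
    using smooth_on_differentiable[OF open_U smooth_ab(1) x] smooth_on_differentiable[OF open_U smooth_ab(2) x]
    by (simp_all add: pd_mult pd_const pd_c_s differentiable_frame x da db power2_eq_square algebra_simps)
qed

lemma d_ab_second:
  assumes x: "x \<in> U" and \<kappa>: "\<And>y. y \<in> U \<Longrightarrow> a y * b y = \<kappa> * (s y * c y)"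
  shows "pd 1 a x * pd 3 b x - \<alpha>1 * \<alpha>3 * (a x * b x)
    = \<alpha>1 * \<alpha>3 * (2 * (a x * b x) - 4 * (\<kappa> * (s x * c x)))"
proof -
  have "pd 3 (pd 1 b) x = pd 3 (\<lambda>y. \<alpha>1 * a y) x"
    by (rule pd_cong[OF open_U x db])
  then have b13: "pd 1 (pd 3 b) x = - \<alpha>1 * \<alpha>3 * b x"
    using pd_commute[OF open_U smooth_ab(2) x, of 1 3] smooth_on_differentiable[OF open_U smooth_ab(1) x]
    by (simp add: pd_mult pd_const da x)
  have "pd 1 (\<lambda>y. a y * pd 3 b y) x
      = pd 1 (\<lambda>y. \<alpha>3 * (\<kappa> * (c y * c y - s y * s y) + b y * b y)) x"
    using d_ab_product(2)[OF _ \<kappa>] by (intro pd_cong[OF open_U x]) (simp add: power2_eq_square)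
  then show ?thesis
    using smooth_on_differentiable[OF open_U smooth_ab(1) x] smooth_on_differentiable[OF open_U smooth_ab(2) x]
      smooth_on_differentiable[OF open_U smooth_on_pd[OF open_U smooth_ab(2)] x, of 3] b13
    by (simp add: pd_mult pd_add pd_diff pd_const pd_c_s differentiable_frame x db algebra_simps)
qed

text \<open>Both first derivatives of \<open>a\<close> and \<open>b\<close> are rational in \<open>a\<close>, \<open>b\<close>, \<open>c\<close>, \<open>s\<close>, so that the equality of the mixed
  second derivatives of \<open>b\<close> is an algebraic equation. With \<open>d = c\<^sup>2 - s\<^sup>2\<close> it says that \<open>d\<close> is zero or
  \<open>b\<^sup>2\<close> is one of \<open>\<kappa> s\<^sup>2\<close> and \<open>- \<kappa> c\<^sup>2\<close>. The first value would mean \<open>k1 = k3\<close>.\<close>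

lemma scalar_integrability:
  assumes x: "x \<in> U" and \<kappa>: "\<And>y. y \<in> U \<Longrightarrow> a y * b y = \<kappa> * (s y * c y)"
  shows "((c x)\<^sup>2 - (s x)\<^sup>2) * ((b x)\<^sup>2 + \<kappa> * (c x)\<^sup>2) = 0"
proof -
  define d where "d = (c x)\<^sup>2 - (s x)\<^sup>2"
  have ab0: "a x \<noteq> 0" "b x \<noteq> 0"
    using ab_k[OF x] k(1,2)[OF x] nz(1) nz(4,5)[OF x] by auto
  have \<kappa>k: "\<kappa> = k1 x * k3 x * lam\<^sup>2"
    using \<kappa>[OF x] nz(4,5)[OF x] by (simp add: ab_k x power2_eq_square algebra_simps)
  then have "\<kappa> \<noteq> 0" using k(1,2)[OF x] nz(1) by simp
  have second: "pd 1 a x * pd 3 b x - \<alpha>1 * \<alpha>3 * (a x * b x) = \<alpha>1 * \<alpha>3 * (- 2 * (a x * b x))"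
    using d_ab_second[OF x \<kappa>] unfolding \<kappa>[OF x] by simp
  have first: "b x * pd 1 a x = \<alpha>1 * (\<kappa> * d - (a x)\<^sup>2)" "a x * pd 3 b x = \<alpha>3 * (\<kappa> * d + (b x)\<^sup>2)"
    unfolding d_def by (rule d_ab_product[OF x \<kappa>]; assumption)+
  have "(b x * pd 1 a x) * (a x * pd 3 b x) - \<alpha>1 * \<alpha>3 * (a x * b x)\<^sup>2
      = (a x * b x) * (pd 1 a x * pd 3 b x - \<alpha>1 * \<alpha>3 * (a x * b x))"
    by (simp add: algebra_simps power2_eq_square)
  also have "\<dots> = \<alpha>1 * \<alpha>3 * (- 2 * (a x * b x)\<^sup>2)"
    unfolding second by (simp add: power2_eq_square)
  finally have "\<alpha>1 * \<alpha>3 * (\<kappa> * d * (\<kappa> * d + (b x)\<^sup>2 - (a x)\<^sup>2)) = 0"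
    unfolding first by (simp add: algebra_simps power2_eq_square)
  then have "d = 0 \<or> \<kappa> * d + (b x)\<^sup>2 - (a x)\<^sup>2 = 0"
    using nz(2,3) \<open>\<kappa> \<noteq> 0\<close> by simp
  moreover have "(b x)\<^sup>2 + \<kappa> * (c x)\<^sup>2 = 0" if "\<kappa> * d + (b x)\<^sup>2 - (a x)\<^sup>2 = 0"
  proof -
    have "((b x)\<^sup>2 - \<kappa> * (s x)\<^sup>2) * ((b x)\<^sup>2 + \<kappa> * (c x)\<^sup>2)
        = (b x)\<^sup>2 * ((b x)\<^sup>2 + \<kappa> * d) - (\<kappa> * (s x * c x))\<^sup>2"
      by (simp add: d_def algebra_simps power2_eq_square)
    also have "\<dots> = (b x)\<^sup>2 * (\<kappa> * d + (b x)\<^sup>2 - (a x)\<^sup>2)"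
      unfolding \<kappa>[OF x, symmetric] by (simp add: algebra_simps power2_eq_square)
    finally have "(b x)\<^sup>2 = \<kappa> * (s x)\<^sup>2 \<or> (b x)\<^sup>2 + \<kappa> * (c x)\<^sup>2 = 0" using that by simp
    moreover have "(b x)\<^sup>2 \<noteq> \<kappa> * (s x)\<^sup>2"
    proof
      assume "(b x)\<^sup>2 = \<kappa> * (s x)\<^sup>2"
      then have "(k3 x * lam\<^sup>2 * (s x)\<^sup>2) * (k3 x - k1 x) = 0"
        unfolding \<kappa>k ab_k[OF x] by (simp add: algebra_simps power2_eq_square)
      then show False using k(2,3)[OF x] nz(1) nz(5)[OF x] by simp
    qed
    ultimately show ?thesis by simp
  qed
  ultimately show ?thesis unfolding d_def by auto
qed

lemma b_squared:
  assumes x: "x \<in> U" and \<kappa>: "\<And>y. y \<in> U \<Longrightarrow> a y * b y = \<kappa> * (s y * c y)"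
  shows "(b x)\<^sup>2 = - \<kappa> * (c x)\<^sup>2"
proof -
  let ?d = "\<lambda>y. c y * c y - s y * s y" and ?g = "\<lambda>y. b y * b y + \<kappa> * (c y * c y)"
  have zero: "?d y * ?g y = 0" if "y \<in> U" for y
    using scalar_integrability[OF that \<kappa>] by (simp add: power2_eq_square)
  have "?g x = 0"
  proof (cases "?d x = 0")
    case True
    \<comment> \<open>At a zero of \<open>?d\<close> the product rule still isolates \<open>?g\<close>.\<close>
    have "pd 1 (\<lambda>y. ?d y * ?g y) x = pd 1 (\<lambda>_. 0) x"
      by (rule pd_cong[OF open_U x zero])
    then have "?d x * (2 * b x * pd 1 b x - 2 * \<kappa> * c x * \<alpha>1 * s x) - 4 * \<alpha>1 * s x * c x * ?g x = 0"
      using smooth_on_differentiable[OF open_U smooth_ab(2) x]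
      by (simp add: pd_mult pd_add pd_diff pd_const pd_c_s differentiable_frame x algebra_simps)
    then have "4 * \<alpha>1 * s x * c x * ?g x = 0" unfolding True by simp
    then show ?thesis using nz(2) nz(4,5)[OF x] by simp
  qed (use zero[OF x] in simp)
  then show ?thesis by (simp add: power2_eq_square)
qed

text \<open>By the previous lemma \<open>b / c\<close> has a constant square; it is continuous and nowhere zero, hence
  constant. This constant \<open>M\<close> is a free parameter of the hypersurface: it is not determined by the
  solution of Lame's system.\<close>

lemma invariants:
  assumes "U \<noteq> {}"
  shows "\<exists>M. M \<noteq> 0 \<and> (\<forall>x\<in>U. a x = - M * s x \<and> b x = M * c x \<and> w x = - (M / lam)\<^sup>2)"
proof -
  obtain x0 where x0: "x0 \<in> U" using assms by auto
  obtain w0 where w0: "\<And>x. x \<in> U \<Longrightarrow> w x = w0" using w_constant by auto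
  define \<kappa> where "\<kappa> = w0 * lam\<^sup>2"
  have \<kappa>: "a y * b y = \<kappa> * (s y * c y)" if "y \<in> U" for y
    using w_eq(1)[OF that] w0[OF that] by (simp add: \<kappa>_def)
  define m where "m y = b y / c y" for y
  have sm: "smooth_on U m"
    unfolding m_def[abs_def] by (intro smooth_on_divide smooth_ab smooth_c open_U nz)
  have b0: "b y \<noteq> 0" if "y \<in> U" for y
    using ab_k(2)[OF that] k(2)[OF that] nz(1) nz(5)[OF that] by auto
  have m2: "m y * m y = - \<kappa>" if "y \<in> U" for y
    using b_squared[OF that \<kappa>] nz(4)[OF that] by (simp add: m_def field_simps power2_eq_square)
  have "\<exists>M. \<forall>y\<in>U. m y = M"
  proof (rule pd_zero_imp_constant[OF open_U conn_U sm])
    fix y i assume y: "y \<in> U"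
    have "pd i (\<lambda>y. m y * m y) y = pd i (\<lambda>_. - \<kappa>) y" by (rule pd_cong[OF open_U y m2])
    then have "2 * m y * pd i m y = 0"
      using smooth_on_differentiable[OF open_U sm y] by (simp add: pd_mult pd_const)
    then show "pd i m y = 0" using b0[OF y] nz(4)[OF y] by (simp add: m_def)
  qed
  then obtain M where M: "\<And>y. y \<in> U \<Longrightarrow> m y = M" by auto
  have b: "b y = M * c y" if "y \<in> U" for y
    using M[OF that] nz(4)[OF that] by (auto simp: m_def)
  have "M \<noteq> 0" using b[OF x0] b0[OF x0] by auto
  have \<kappa>M: "\<kappa> = - M\<^sup>2" using m2[OF x0] M[OF x0] by (simp add: power2_eq_square)
  have a: "a y = - M * s y" if "y \<in> U" for y
  proof -
    have "(M * c y) * a y = (M * c y) * (- M * s y)"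
      using \<kappa>[OF that] b[OF that] \<kappa>M by (simp add: power2_eq_square algebra_simps)
    then show ?thesis using \<open>M \<noteq> 0\<close> nz(4)[OF that] by (simp only: mult_cancel_left) simp
  qed
  have "w0 = - (M / lam)\<^sup>2" using \<kappa>M nz(1) by (simp add: \<kappa>_def field_simps)
  then show ?thesis using a b w0 \<open>M \<noteq> 0\<close> by auto
qed

text \<open>Any solution \<open>u\<close>, \<open>v\<close>, \<open>y\<close>, \<open>z\<close> of the linear system satisfied by \<open>P\<close>, \<open>Q\<close>, \<open>E1\<close>, \<open>E3\<close> gives a constant
  combination of these four vectors, because the matrices of the system are skew. Four orthonormal
  solutions give \<open>\<epsilon>\<close>. The null vectors come from the hyperbolic rotation of \<open>T\<close> and \<open>E2\<close>.\<close>

lemma reconstruction: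
  fixes u v y z :: "4 \<Rightarrow> real^3 \<Rightarrow> real"
  assumes M: "M \<noteq> 0" "\<And>x. x \<in> U \<Longrightarrow> a x = - M * s x" "\<And>x. x \<in> U \<Longrightarrow> b x = M * c x"
      "\<And>x. x \<in> U \<Longrightarrow> w x = - (M / lam)\<^sup>2"
    and smooth: "\<And>i. smooth_on U (u i)" "\<And>i. smooth_on U (v i)" "\<And>i. smooth_on U (y i)" "\<And>i. smooth_on U (z i)"
    and d1: "\<And>i x. pd 1 (u i) x = \<alpha>1 * v i x + M * y i x" "\<And>i x. pd 1 (v i) x = - \<alpha>1 * u i x"
      "\<And>i x. pd 1 (y i) x = \<alpha>3 * z i x - M * u i x" "\<And>i x. pd 1 (z i) x = - \<alpha>3 * y i x"
    and d2: "\<And>i x. pd 2 (u i) x = 0" "\<And>i x. pd 2 (v i) x = 0" "\<And>i x. pd 2 (y i) x = 0" "\<And>i x. pd 2 (z i) x = 0"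
    and d3: "\<And>i x. pd 3 (u i) x = \<alpha>3 * v i x" "\<And>i x. pd 3 (v i) x = - \<alpha>3 * u i x - M * z i x"
      "\<And>i x. pd 3 (y i) x = \<alpha>1 * z i x" "\<And>i x. pd 3 (z i) x = M * v i x - \<alpha>1 * y i x"
    and ortho: "\<And>i j x. u i x * u j x + v i x * v j x + y i x * y j x + z i x * z j x = (if i = j then 1 else 0)"
    and "U \<noteq> {}"
  obtains \<epsilon> \<nu> \<nu>' where "\<And>i j. lor (\<epsilon> i) (\<epsilon> j) = (if i = j then 1 else 0)"
    "lor \<nu> \<nu> = 0" "lor \<nu>' \<nu>' = 0" "lor \<nu> \<nu>' = - 2" "\<And>i. lor (\<epsilon> i) \<nu> = 0" "\<And>i. lor (\<epsilon> i) \<nu>' = 0"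
    "\<And>x i. x \<in> U \<Longrightarrow> lor (F x) (\<epsilon> i) = (lam / M) * (c x * u i x - s x * v i x)"
    "\<And>x. x \<in> U \<Longrightarrow> lor (F x) \<nu> = - (lam / M) * exp (- M * x $ 2)"
proof -
  define m where "m = M / lam"
  have m: "m \<noteq> 0" "M = m * lam" using M(1) nz(1) by (auto simp: m_def)
  have wm: "w x = - m\<^sup>2" if "x \<in> U" for x using M(4)[OF that] by (simp add: m_def)
  \<comment> \<open>\<open>p\<close> and \<open>T\<close> split \<open>F\<close> into a unit spacelike part depending on \<open>x\<^sub>1\<close>, \<open>x\<^sub>3\<close> only and a unit timelike part
    depending on \<open>x\<^sub>2\<close> only. Turning \<open>p\<close> and \<open>N\<close> by the angle of \<open>c\<close>, \<open>s\<close> makes all coefficients constant.\<close>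
  define p where "p x = m *\<^sub>R F x - (1 / m) *\<^sub>R W x" for x
  define T where "T x = (1 / m) *\<^sub>R W x" for x
  define P where "P x = c x *\<^sub>R p x + s x *\<^sub>R N x" for x
  define Q where "Q x = c x *\<^sub>R N x - s x *\<^sub>R p x" for x
  have F: "F x = (1 / m) *\<^sub>R (p x + T x)" for x using m by (simp add: p_def T_def)
  have WwF: "W x + w x *\<^sub>R F x = - m *\<^sub>R p x" if "x \<in> U" for x
    using m wm[OF that] by (simp add: p_def algebra_simps power2_eq_square)
  have smooth_pT: "smooth_on U p" "smooth_on U T"
    unfolding p_def[abs_def] T_def[abs_def]
    by (intro smooth_on_diff smooth_on_scaleR smooth_on_const smooth_frame open_U)+
  have smooth_PQ: "smooth_on U P" "smooth_on U Q"
    unfolding P_def[abs_def] Q_def[abs_def]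
    by (intro smooth_on_diff smooth_on_add smooth_on_scaleR smooth_pT smooth_frame smooth_c smooth_s open_U)+
  note diff = smooth_on_differentiable[OF open_U]
  note diffs = diff[OF smooth_pT(1)] diff[OF smooth_pT(2)] diff[OF smooth_PQ(1)] diff[OF smooth_PQ(2)] differentiable_frame
  have W2: "pd 2 W x = (lam * m\<^sup>2) *\<^sub>R E2 x" if x: "x \<in> U" for x
  proof -
    have "lor (pd 2 W x) (N x) = 0" "lor (pd 2 W x) (F x) = 0" "lor (pd 2 W x) (E1 x) = 0"
      "lor (pd 2 W x) (E3 x) = 0" "lor (pd 2 W x) (E2 x) = lam * m\<^sup>2" "lor (pd 2 W x) (W x) = 0"
      using leibniz_const[OF smooth_W smooth_N W_N x, of 2] leibniz_const[OF smooth_W smooth_F W_F x, of 2]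
        leibniz_const[OF smooth_W smooth_E(1) W_E1 x, of 2] leibniz_const[OF smooth_W smooth_E(2) W_E2 x, of 2]
        leibniz_const[OF smooth_W smooth_E(3) W_E3 x, of 2] dw[OF x, of 2]
      by (simp_all add: d2E2 d2E1_zero d2E3_zero dN dF d2_invariants lor_simps frame_gram x
          wm[OF x] w_def[symmetric] lor_commute[of "W x" "pd 2 W x"])
    then show ?thesis by (subst expand[OF x, of "pd 2 W x"]) simp
  qed
  have dp: "pd 1 p x = (M * c x) *\<^sub>R E1 x" "pd 2 p x = 0" "pd 3 p x = (M * s x) *\<^sub>R E3 x" if x: "x \<in> U" for x
    unfolding p_def[abs_def] using m
    by (simp_all add: pd_diff pd_scaleR pd_const diffs x dF dW W2 power2_eq_square algebra_simps)
  have dN': "pd 1 N x = (M * s x) *\<^sub>R E1 x" "pd 2 N x = 0" "pd 3 N x = - (M * c x) *\<^sub>R E3 x" if x: "x \<in> U" for x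
    using M(2,3)[OF x] by (simp_all add: dN_ab x dN(2) d2_invariants)
  have cs: "c x * c x + s x * s x = 1" for x by (simp add: c_def s_def)
  have dPQ: "pd 1 P x = \<alpha>1 *\<^sub>R Q x + M *\<^sub>R E1 x" "pd 2 P x = 0" "pd 3 P x = \<alpha>3 *\<^sub>R Q x"
    "pd 1 Q x = - \<alpha>1 *\<^sub>R P x" "pd 2 Q x = 0" "pd 3 Q x = - \<alpha>3 *\<^sub>R P x - M *\<^sub>R E3 x" if x: "x \<in> U" for x
  proof -
    have "M *\<^sub>R E x = M *\<^sub>R ((c x * c x + s x * s x) *\<^sub>R E x)" for E :: "real^3 \<Rightarrow> lorentz" by (simp add: cs)
    note E = this[of E1] this[of E3]
    show "pd 1 P x = \<alpha>1 *\<^sub>R Q x + M *\<^sub>R E1 x" "pd 2 P x = 0" "pd 3 P x = \<alpha>3 *\<^sub>R Q x"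
      "pd 1 Q x = - \<alpha>1 *\<^sub>R P x" "pd 2 Q x = 0" "pd 3 Q x = - \<alpha>3 *\<^sub>R P x - M *\<^sub>R E3 x"
      unfolding E
      by (simp_all only: P_def[abs_def] Q_def[abs_def] pd_add pd_diff pd_scaleR pd_c_s diffs x dp dN'
          differentiable_scaleR differentiable_add differentiable_diff)
        (simp_all add: algebra_simps)
  qed
  have dE': "pd 1 E1 x = \<alpha>3 *\<^sub>R E3 x - M *\<^sub>R P x" "pd 3 E3 x = M *\<^sub>R Q x - \<alpha>1 *\<^sub>R E1 x" if x: "x \<in> U" for x
    using M(2,3)[OF x] by (simp_all add: dE x WwF P_def Q_def m algebra_simps)
  have gram': "lor (P x) (P x) = 1" "lor (Q x) (Q x) = 1" "lor (P x) (Q x) = 0" "lor (Q x) (P x) = 0"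
    "lor (P x) (E1 x) = 0" "lor (P x) (E3 x) = 0" "lor (Q x) (E1 x) = 0" "lor (Q x) (E3 x) = 0"
    "lor (P x) (E2 x) = 0" "lor (P x) (T x) = 0" "lor (Q x) (E2 x) = 0" "lor (Q x) (T x) = 0"
    "lor (T x) (T x) = - 1" "lor (T x) (E1 x) = 0" "lor (T x) (E2 x) = 0" "lor (T x) (E3 x) = 0"
    "lor (p x) (P x) = c x" "lor (p x) (Q x) = - s x" "lor (p x) (E1 x) = 0" "lor (p x) (E2 x) = 0" 
    "lor (p x) (E3 x) = 0" "lor (p x) (T x) = 0"
    if x: "x \<in> U" for x
  proof -
    have 1: "lor (W x) (W x) = - m\<^sup>2" using wm[OF x] by (simp add: w_def)
    have p: "lor (p x) (p x) = 1" "lor (p x) (N x) = 0" "lor (N x) (p x) = 0" "lor (p x) (E1 x) = 0" "lor (p x) (E2 x) = 0" 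
      "lor (p x) (E3 x) = 0" "lor (p x) (T x) = 0"
      using m by (simp_all add: p_def T_def lor_simps frame_gram x 1 field_simps power2_eq_square)
    then show "lor (P x) (P x) = 1" "lor (Q x) (Q x) = 1" "lor (P x) (Q x) = 0" "lor (Q x) (P x) = 0"
      "lor (P x) (E1 x) = 0" "lor (P x) (E3 x) = 0" "lor (Q x) (E1 x) = 0" "lor (Q x) (E3 x) = 0"
      "lor (P x) (E2 x) = 0" "lor (P x) (T x) = 0" "lor (Q x) (E2 x) = 0" "lor (Q x) (T x) = 0"
      "lor (T x) (T x) = - 1" "lor (T x) (E1 x) = 0" "lor (T x) (E2 x) = 0" "lor (T x) (E3 x) = 0"
      "lor (p x) (P x) = c x" "lor (p x) (Q x) = - s x" "lor (p x) (E1 x) = 0" "lor (p x) (E2 x) = 0" 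
      "lor (p x) (E3 x) = 0" "lor (p x) (T x) = 0"
      using cs[of x] m by (simp_all add: P_def Q_def T_def lor_simps frame_gram x 1 power2_eq_square add.commute)
  qed
  define X where "X i x = u i x *\<^sub>R P x + v i x *\<^sub>R Q x + y i x *\<^sub>R E1 x + z i x *\<^sub>R E3 x" for i x
  have smooth_X: "smooth_on U (X i)" for i
    unfolding X_def[abs_def] by (intro smooth_on_add smooth_on_scaleR smooth smooth_PQ smooth_E open_U)
  have "\<exists>e. \<forall>x\<in>U. X i x = e" for i
  proof (rule pd_zero_imp_constant[OF open_U conn_U smooth_X])
    fix x and j :: 3 assume x: "x \<in> U"
    have "pd j (X i) x = pd j (u i) x *\<^sub>R P x + u i x *\<^sub>R pd j P x + pd j (v i) x *\<^sub>R Q x + v i x *\<^sub>R pd j Q x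
      + pd j (y i) x *\<^sub>R E1 x + y i x *\<^sub>R pd j E1 x + pd j (z i) x *\<^sub>R E3 x + z i x *\<^sub>R pd j E3 x" for j
      unfolding X_def[abs_def]
      by (simp add: pd_add pd_scaleR diffs diff[OF smooth(1)] diff[OF smooth(2)] diff[OF smooth(3)] diff[OF smooth(4)] x)
    then show "pd j (X i) x = 0"
      using exhaust_3[of j]
      by (auto simp: d1 d2 d3 dPQ dE' dE(3,4) d2E1_zero d2E3_zero x algebra_simps)
  qed
  then obtain \<epsilon> where \<epsilon>: "\<And>i x. x \<in> U \<Longrightarrow> X i x = \<epsilon> i" by metis
  define Y where "Y \<sigma> x = exp (- \<sigma> * M * x $ 2) *\<^sub>R (T x + \<sigma> *\<^sub>R E2 x)" for \<sigma> x
  have ex_smooth: "smooth_on U (\<lambda>x. exp (- \<sigma> * M * x $ 2))" for \<sigma>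
    by (intro smooth_on_exp smooth_on_mult smooth_on_const smooth_on_component open_U)
  have smooth_Y: "smooth_on U (Y \<sigma>)" for \<sigma>
    unfolding Y_def[abs_def]
    by (intro smooth_on_scaleR smooth_on_add smooth_on_const smooth_pT smooth_E ex_smooth open_U)
  have "\<exists>e. \<forall>x\<in>U. Y \<sigma> x = e" if \<sigma>: "\<sigma> * \<sigma> = 1" for \<sigma>
  proof (rule pd_zero_imp_constant[OF open_U conn_U smooth_Y])
    fix x and j :: 3 assume x: "x \<in> U"
    have D: "((\<lambda>x::real^3. - \<sigma> * M * x $ 2) has_derivative (\<lambda>h. - \<sigma> * M * h $ 2)) (at x)"
      by (intro has_derivative_mult_right bounded_linear_imp_has_derivative bounded_linear_vec_nth)
    then have dd: "(\<lambda>x::real^3. - \<sigma> * M * x $ 2) differentiable at x" by (auto simp: differentiable_def)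
    have de: "pd j (\<lambda>x. exp (- \<sigma> * M * x $ 2)) x = (if j = 2 then - \<sigma> * M * exp (- \<sigma> * M * x $ 2) else 0)" for j
      using pd_real_chain[OF dd DERIV_exp, of j] pd_eqI[OF D, of j] by (simp add: axis_def)
    have "pd j T x = (1 / m) *\<^sub>R pd j W x" for j
      unfolding T_def[abs_def] by (simp add: pd_scaleR pd_const diffs x)
    then have dT: "pd j T x = (if j = 2 then M *\<^sub>R E2 x else 0)" for j
      using m exhaust_3[of j] by (auto simp: dW W2 x power2_eq_square)
    have dE2: "pd j E2 x = (if j = 2 then M *\<^sub>R T x else 0)" for j
      using m exhaust_3[of j] by (auto simp: d1E2_zero d3E2_zero d2E2 T_def x)
    have "pd j (Y \<sigma>) x = exp (- \<sigma> * M * x $ 2) *\<^sub>R pd j (\<lambda>x. T x + \<sigma> *\<^sub>R E2 x) x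
      + pd j (\<lambda>x. exp (- \<sigma> * M * x $ 2)) x *\<^sub>R (T x + \<sigma> *\<^sub>R E2 x)"
      unfolding Y_def[abs_def]
      by (intro pd_scaleR diff[OF ex_smooth x] differentiable_add differentiable_scaleR differentiable_const diffs x)
    also have "\<dots> = exp (- \<sigma> * M * x $ 2) *\<^sub>R (if j = 2 then (M * (1 - \<sigma> * \<sigma>)) *\<^sub>R E2 x else 0)"
      unfolding de by (simp add: pd_scaleR pd_add pd_const dT dE2 diffs x algebra_simps)
    finally show "pd j (Y \<sigma>) x = 0" using \<sigma> by simp
  qed
  from this[of 1] this[of "- 1"]
  obtain \<nu> \<nu>' where \<nu>: "\<And>x. x \<in> U \<Longrightarrow> Y 1 x = \<nu>" and \<nu>': "\<And>x. x \<in> U \<Longrightarrow> Y (- 1) x = \<nu>'" by auto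
  obtain x0 where x0: "x0 \<in> U" using \<open>U \<noteq> {}\<close> by auto
  note sym = gram'[THEN trans[OF lor_commute]]
  show ?thesis
  proof
    show "lor (\<epsilon> i) (\<epsilon> j) = (if i = j then 1 else 0)" for i j
      unfolding \<epsilon>[OF x0, symmetric] X_def ortho[of i x0 j, symmetric]
      by (simp add: lor_simps gram' sym frame_gram x0 algebra_simps)
    show "lor \<nu> \<nu> = 0" "lor \<nu>' \<nu>' = 0" "lor \<nu> \<nu>' = - 2"
      unfolding \<nu>[OF x0, symmetric] \<nu>'[OF x0, symmetric] Y_def
      by (simp_all add: lor_simps gram' sym frame_gram x0 exp_minus)
    show "lor (\<epsilon> i) \<nu> = 0" "lor (\<epsilon> i) \<nu>' = 0" for i
      unfolding \<nu>[OF x0, symmetric] \<nu>'[OF x0, symmetric] Y_def \<epsilon>[OF x0, symmetric] X_def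
      by (simp_all add: lor_simps gram' sym frame_gram x0)
    show "lor (F x) (\<epsilon> i) = (lam / M) * (c x * u i x - s x * v i x)" if x: "x \<in> U" for x i
      unfolding \<epsilon>[OF x, symmetric] X_def F[of x]
      using m nz(1) by (simp add: lor_simps gram' sym x algebra_simps)
    show "lor (F x) \<nu> = - (lam / M) * exp (- M * x $ 2)" if x: "x \<in> U" for x
      unfolding \<nu>[OF x, symmetric] Y_def F[of x]
      using m nz(1) by (simp add: lor_simps gram' sym x)
  qed
qed

end

section \<open>The model surface\<close>

text \<open>The singular value decomposition of the matrix with rows \<open>(\<alpha>1, M)\<close> and \<open>(0, \<alpha>3)\<close>: its singular values
  up to sign are \<open>\<theta>1\<close>, \<open>\<theta>2\<close>, and \<open>(e, f)\<close>, \<open>(g, h)\<close> are the first columns of the two rotations. Up to signs, this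
  matrix couples the pairs \<open>(P, E3)\<close> and \<open>(Q, E1)\<close> under differentiation in direction 1. For direction 3
  the speeds \<open>\<theta>1\<close> and \<open>\<theta>2\<close> are exchanged, because their product is \<open>\<alpha>1 * \<alpha>3\<close>.\<close>

lemma singular_value_rotation:
  fixes \<alpha>1 \<alpha>3 M :: real
  assumes "M \<noteq> 0"
  obtains \<theta>1 \<theta>2 e f g h where "e * e + f * f = 1" "g * g + h * h = 1"
    "e * \<theta>1 = \<alpha>1 * g + M * h" "g * \<theta>1 = \<alpha>1 * e" "h * \<theta>1 = \<alpha>3 * f + M * e" "f * \<theta>1 = \<alpha>3 * h"
    "f * \<theta>2 = \<alpha>1 * h - M * g" "h * \<theta>2 = \<alpha>1 * f" "g * \<theta>2 = \<alpha>3 * e - M * f" "e * \<theta>2 = \<alpha>3 * g"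
    "\<theta>1 \<noteq> \<theta>2" "\<theta>1 \<noteq> - \<theta>2"
proof -
  have polar: "\<exists>r t. r \<noteq> 0 \<and> p = r * cos t \<and> M = r * sin t" for p
  proof -
    define r where "r = sqrt (p\<^sup>2 + M\<^sup>2)"
    have r: "r > 0" "r\<^sup>2 = p\<^sup>2 + M\<^sup>2" using assms by (auto simp: r_def add_nonneg_pos)
    then have "(p / r)\<^sup>2 + (M / r)\<^sup>2 = 1"
      by (metis add_divide_distrib divide_self less_irrefl power_divide power_not_zero)
    from sincos_total_2pi[OF this] obtain t where "p / r = cos t" "M / r = sin t" by metis
    then show ?thesis using r(1) by - (rule exI[of _ r], rule exI[of _ t], auto simp: field_simps)
  qed
  \<comment> \<open>Sums and differences of the diagonal and the antidiagonal are \<open>\<theta>1 + \<theta>2\<close> and \<open>\<theta>1 - \<theta>2\<close> times the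
    cosine and sine of the difference and the sum of the two rotation angles.\<close>
  obtain \<sigma> \<mu> where \<sigma>: "\<sigma> \<noteq> 0" "\<alpha>1 + \<alpha>3 = \<sigma> * cos \<mu>" "M = \<sigma> * sin \<mu>" using polar by metis
  obtain \<delta> \<nu> where \<delta>: "\<delta> \<noteq> 0" "\<alpha>1 - \<alpha>3 = \<delta> * cos \<nu>" "M = \<delta> * sin \<nu>" using polar by metis
  define \<zeta> \<eta> where "\<zeta> = (\<nu> + \<mu>) / 2" and "\<eta> = (\<nu> - \<mu>) / 2"
  define \<theta>1 \<theta>2 where "\<theta>1 = (\<sigma> + \<delta>) / 2" and "\<theta>2 = (\<sigma> - \<delta>) / 2"
  define e f g h where efgh: "e = cos \<eta>" "f = sin \<eta>" "g = cos \<zeta>" "h = sin \<zeta>"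
  have "\<mu> = \<zeta> - \<eta>" "\<nu> = \<zeta> + \<eta>" by (auto simp: \<zeta>_def \<eta>_def field_simps)
  then have A: "\<alpha>1 + \<alpha>3 = \<sigma> * (g * e + h * f)" "M = \<sigma> * (h * e - g * f)"
      "\<alpha>1 - \<alpha>3 = \<delta> * (g * e - h * f)" "M = \<delta> * (h * e + g * f)"
    using \<sigma>(2,3) \<delta>(2,3) by (simp_all add: efgh cos_diff sin_diff cos_add sin_add)
  have one: "e * e + f * f = 1" "g * g + h * h = 1" by (simp_all add: efgh)
  have \<theta>: "\<sigma> = \<theta>1 + \<theta>2" "\<delta> = \<theta>1 - \<theta>2" by (simp_all add: \<theta>1_def \<theta>2_def field_simps)
  have B: "\<alpha>1 = \<theta>1 * g * e + \<theta>2 * h * f" "\<alpha>3 = \<theta>1 * h * f + \<theta>2 * g * e"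
    "M = \<theta>1 * h * e - \<theta>2 * g * f" "\<theta>1 * g * f = \<theta>2 * h * e"
    using A unfolding \<theta> by (simp_all add: algebra_simps)
  show ?thesis
  proof
    show "e * e + f * f = 1" "g * g + h * h = 1" by (fact one)+
    show "e * \<theta>1 = \<alpha>1 * g + M * h" using B one by algebra
    show "g * \<theta>1 = \<alpha>1 * e" using B one by algebra
    show "h * \<theta>1 = \<alpha>3 * f + M * e" using B one by algebra
    show "f * \<theta>1 = \<alpha>3 * h" using B one by algebra
    show "f * \<theta>2 = \<alpha>1 * h - M * g" using B one by algebra
    show "h * \<theta>2 = \<alpha>1 * f" using B one by algebra
    show "g * \<theta>2 = \<alpha>3 * e - M * f" using B one by algebra
    show "e * \<theta>2 = \<alpha>3 * g" using B one by algebra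
    show "\<theta>1 \<noteq> \<theta>2" "\<theta>1 \<noteq> - \<theta>2" using \<theta> \<sigma>(1) \<delta>(1) by auto
  qed
qed

lemma vector_4:
  "(vector [w, x, y, z] :: ('a::zero)^4) $ 1 = w" "(vector [w, x, y, z] :: ('a::zero)^4) $ 2 = x"
  "(vector [w, x, y, z] :: ('a::zero)^4) $ 3 = y" "(vector [w, x, y, z] :: ('a::zero)^4) $ 4 = z"
  unfolding vector_def by simp_all

text \<open>
  The functions \<open>u i\<close>, \<open>v i\<close>, \<open>y i\<close>, \<open>z i\<close> are the \<open>i\<close>-th coordinates of four orthonormal vectors in \<open>\<real>\<^sup>4\<close>: the
  rotated position and normal of the surface, and its two unit tangents along the curvature lines.
  They take the two parameters as real arguments, since they are used as functions on \<open>\<real>\<^sup>2\<close> for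
  the surface and on \<open>\<real>\<^sup>3\<close> for the hypersurface.\<close>

locale model_surface =
  fixes \<alpha>1 \<alpha>3 \<xi>0 M \<theta>1 \<theta>2 e f g h :: real
  assumes M0: "M \<noteq> 0"
    and unit: "e * e + f * f = 1" "g * g + h * h = 1"
    and sv: "e * \<theta>1 = \<alpha>1 * g + M * h" "g * \<theta>1 = \<alpha>1 * e" "h * \<theta>1 = \<alpha>3 * f + M * e" "f * \<theta>1 = \<alpha>3 * h"
    "f * \<theta>2 = \<alpha>1 * h - M * g" "h * \<theta>2 = \<alpha>1 * f" "g * \<theta>2 = \<alpha>3 * e - M * f" "e * \<theta>2 = \<alpha>3 * g"
begin

definition u :: "4 \<Rightarrow> real \<Rightarrow> real \<Rightarrow> real" where
  "u i p q = (if i = 1 then e * cos (\<theta>1 * p + \<theta>2 * q) else if i = 2 then e * sin (\<theta>1 * p + \<theta>2 * q)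
    else if i = 3 then - f * cos (\<theta>2 * p + \<theta>1 * q) else - f * sin (\<theta>2 * p + \<theta>1 * q))"

definition v :: "4 \<Rightarrow> real \<Rightarrow> real \<Rightarrow> real" where
  "v i p q = (if i = 1 then - g * sin (\<theta>1 * p + \<theta>2 * q) else if i = 2 then g * cos (\<theta>1 * p + \<theta>2 * q)
    else if i = 3 then h * sin (\<theta>2 * p + \<theta>1 * q) else - h * cos (\<theta>2 * p + \<theta>1 * q))"

definition y :: "4 \<Rightarrow> real \<Rightarrow> real \<Rightarrow> real" where
  "y i p q = (if i = 1 then - h * sin (\<theta>1 * p + \<theta>2 * q) else if i = 2 then h * cos (\<theta>1 * p + \<theta>2 * q)
    else if i = 3 then - g * sin (\<theta>2 * p + \<theta>1 * q) else g * cos (\<theta>2 * p + \<theta>1 * q))"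

definition z :: "4 \<Rightarrow> real \<Rightarrow> real \<Rightarrow> real" where
  "z i p q = (if i = 1 then - f * cos (\<theta>1 * p + \<theta>2 * q) else if i = 2 then - f * sin (\<theta>1 * p + \<theta>2 * q)
    else if i = 3 then - e * cos (\<theta>2 * p + \<theta>1 * q) else - e * sin (\<theta>2 * p + \<theta>1 * q))"

lemmas frame_defs = u_def v_def y_def z_def

lemma smooth_frame:
  assumes "open S" "smooth_on S p" "smooth_on S q"
  shows "smooth_on S (\<lambda>x. u i (p x) (q x))" "smooth_on S (\<lambda>x. v i (p x) (q x))"
    "smooth_on S (\<lambda>x. y i (p x) (q x))" "smooth_on S (\<lambda>x. z i (p x) (q x))"
proof -
  have t: "smooth_on S (\<lambda>x. r * cos (a * p x + b * q x))" "smooth_on S (\<lambda>x. r * sin (a * p x + b * q x))" for r a b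
    by (intro smooth_on_mult smooth_on_cos smooth_on_sin smooth_on_add smooth_on_const assms)+
  show "smooth_on S (\<lambda>x. u i (p x) (q x))" "smooth_on S (\<lambda>x. v i (p x) (q x))"
    "smooth_on S (\<lambda>x. y i (p x) (q x))" "smooth_on S (\<lambda>x. z i (p x) (q x))"
    using exhaust_4[of i] by (elim disjE; simp only: frame_defs; simp add: t t[of "- _", simplified])+
qed

text \<open>The linear system with constant coefficients, with matrices given by the singular value relations.
  Here \<open>p\<close> and \<open>q\<close> are arbitrary, so the chain rule is built in.\<close>

lemma pd_frame:
  fixes x :: "real^'n"
  assumes "p differentiable at x" "q differentiable at x"
  shows "pd k (\<lambda>x. u i (p x) (q x)) x = pd k p x * (\<alpha>1 * v i (p x) (q x) + M * y i (p x) (q x)) + pd k q x * (\<alpha>3 * v i (p x) (q x))"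
    "pd k (\<lambda>x. v i (p x) (q x)) x = pd k p x * (- \<alpha>1 * u i (p x) (q x)) + pd k q x * (- \<alpha>3 * u i (p x) (q x) - M * z i (p x) (q x))"
    "pd k (\<lambda>x. y i (p x) (q x)) x = pd k p x * (\<alpha>3 * z i (p x) (q x) - M * u i (p x) (q x)) + pd k q x * (\<alpha>1 * z i (p x) (q x))"
    "pd k (\<lambda>x. z i (p x) (q x)) x = pd k p x * (- \<alpha>3 * y i (p x) (q x)) + pd k q x * (M * v i (p x) (q x) - \<alpha>1 * y i (p x) (q x))"
proof -
  have d: "(\<lambda>x. a * p x + b * q x) differentiable at x" for a b
    using assms by (intro differentiable_add differentiable_mult differentiable_const)
  have dt: "pd k (\<lambda>x. a * p x + b * q x) x = a * pd k p x + b * pd k q x" for a b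
    using assms by (simp add: pd_add pd_mult pd_const)
  have sc: "pd k (\<lambda>x. r * cos (a * p x + b * q x)) x
      = pd k p x * (- (r * a) * sin (a * p x + b * q x)) + pd k q x * (- (r * b) * sin (a * p x + b * q x))"
    "pd k (\<lambda>x. r * sin (a * p x + b * q x)) x
      = pd k p x * ((r * a) * cos (a * p x + b * q x)) + pd k q x * ((r * b) * cos (a * p x + b * q x))" for r a b
    using pd_real_chain[OF d DERIV_cmult[OF DERIV_cos], of k r a b] pd_real_chain[OF d DERIV_cmult[OF DERIV_sin], of k r a b]
    unfolding dt by (simp_all add: algebra_simps)
  note rules = frame_defs sc sc[of "- _", simplified] sv
  show "pd k (\<lambda>x. u i (p x) (q x)) x = pd k p x * (\<alpha>1 * v i (p x) (q x) + M * y i (p x) (q x)) + pd k q x * (\<alpha>3 * v i (p x) (q x))"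
    using exhaust_4[of i] by (elim disjE; simp add: rules; simp add: algebra_simps)
  show "pd k (\<lambda>x. v i (p x) (q x)) x = pd k p x * (- \<alpha>1 * u i (p x) (q x)) + pd k q x * (- \<alpha>3 * u i (p x) (q x) - M * z i (p x) (q x))"
    using exhaust_4[of i] by (elim disjE; simp add: rules; simp add: algebra_simps)
  show "pd k (\<lambda>x. y i (p x) (q x)) x = pd k p x * (\<alpha>3 * z i (p x) (q x) - M * u i (p x) (q x)) + pd k q x * (\<alpha>1 * z i (p x) (q x))"
    using exhaust_4[of i] by (elim disjE; simp add: rules; simp add: algebra_simps)
  show "pd k (\<lambda>x. z i (p x) (q x)) x = pd k p x * (- \<alpha>3 * y i (p x) (q x)) + pd k q x * (M * v i (p x) (q x) - \<alpha>1 * y i (p x) (q x))"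
    using exhaust_4[of i] by (elim disjE; simp add: rules; simp add: algebra_simps)
qed

text \<open>An orthogonal matrix has orthonormal rows and columns. The columns are needed for the constant
  vectors of the hypersurface and the rows for the metric of the surface.\<close>

lemma frame_columns:
  "u i p q * u j p q + v i p q * v j p q + y i p q * y j p q + z i p q * z j p q = (if i = j then 1 else 0)"
proof -
  define C1 S1 C2 S2 where "C1 = cos (\<theta>1 * p + \<theta>2 * q)" and "S1 = sin (\<theta>1 * p + \<theta>2 * q)"
    and "C2 = cos (\<theta>2 * p + \<theta>1 * q)" and "S2 = sin (\<theta>2 * p + \<theta>1 * q)"
  note CS = this[symmetric]
  have t: "C1 * C1 + S1 * S1 = 1" "C2 * C2 + S2 * S2 = 1"
    by (simp_all add: C1_def S1_def C2_def S2_def)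
  have "\<forall>i j. u i p q * u j p q + v i p q * v j p q + y i p q * y j p q + z i p q * z j p q = (if i = j then 1 else 0)"
    unfolding frame_defs CS forall_4 by (intro conjI; simp; use t unit in algebra)
  then show ?thesis by blast
qed

lemma frame_rows:
  "(\<Sum>i\<in>UNIV. u i p q * u i p q) = 1" "(\<Sum>i\<in>UNIV. v i p q * v i p q) = 1" "(\<Sum>i\<in>UNIV. u i p q * v i p q) = 0"
  "(\<Sum>i\<in>UNIV. y i p q * y i p q) = 1" "(\<Sum>i\<in>UNIV. z i p q * z i p q) = 1" "(\<Sum>i\<in>UNIV. y i p q * z i p q) = 0"
proof -
  define C1 S1 C2 S2 where "C1 = cos (\<theta>1 * p + \<theta>2 * q)" and "S1 = sin (\<theta>1 * p + \<theta>2 * q)"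
    and "C2 = cos (\<theta>2 * p + \<theta>1 * q)" and "S2 = sin (\<theta>2 * p + \<theta>1 * q)"
  note CS = this[symmetric]
  have t: "C1 * C1 + S1 * S1 = 1" "C2 * C2 + S2 * S2 = 1"
    by (simp_all add: C1_def S1_def C2_def S2_def)
  show "(\<Sum>i\<in>UNIV. u i p q * u i p q) = 1" "(\<Sum>i\<in>UNIV. v i p q * v i p q) = 1" "(\<Sum>i\<in>UNIV. u i p q * v i p q) = 0"
    "(\<Sum>i\<in>UNIV. y i p q * y i p q) = 1" "(\<Sum>i\<in>UNIV. z i p q * z i p q) = 1" "(\<Sum>i\<in>UNIV. y i p q * z i p q) = 0"
    unfolding sum_4 frame_defs CS by (simp; use t unit in algebra)+
qed


definition angle :: "real^2 \<Rightarrow> real" where "angle x = \<alpha>1 * x $ 1 + \<alpha>3 * x $ 2 + \<xi>0"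

definition surface :: "real^2 \<Rightarrow> real^4" where
  "surface x = (\<chi> i. cos (angle x) * u i (x $ 1) (x $ 2) - sin (angle x) * v i (x $ 1) (x $ 2))"

lemma smooth_angle: "smooth_on UNIV angle"
  unfolding angle_def[abs_def]
  by (intro smooth_on_add smooth_on_mult smooth_on_const smooth_on_component[OF open_UNIV] open_UNIV)

lemma smooth_surface: "smooth_on UNIV surface"
  unfolding surface_def[abs_def]
  by (intro smooth_on_vec_lambda smooth_on_diff smooth_on_mult smooth_on_cos smooth_on_sin smooth_angle
      smooth_frame smooth_on_component[OF open_UNIV] open_UNIV)

lemma pd_angle: "pd k angle x = (if k = 1 then \<alpha>1 else \<alpha>3)"
  unfolding angle_def[abs_def] using exhaust_2[of k]
  by (auto simp: pd_add pd_mult pd_const pd_coordinate differentiable_coordinate)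

lemma differentiable_angle: "angle differentiable at x"
  by (rule smooth_on_differentiable[OF open_UNIV smooth_angle]) simp

lemma pd_surface:
  "pd 1 surface x = (\<chi> i. M * cos (angle x) * y i (x $ 1) (x $ 2))"
  "pd 2 surface x = (\<chi> i. M * sin (angle x) * z i (x $ 1) (x $ 2))"
proof -
  have "pd k surface x $ i = (if k = 1 then M * cos (angle x) * y i (x $ 1) (x $ 2) else M * sin (angle x) * z i (x $ 1) (x $ 2))" for k i
  proof -
    note fr = smooth_on_differentiable[OF open_UNIV smooth_frame(1)[OF open_UNIV smooth_on_component[OF open_UNIV] smooth_on_component[OF open_UNIV]] UNIV_I]
      smooth_on_differentiable[OF open_UNIV smooth_frame(2)[OF open_UNIV smooth_on_component[OF open_UNIV] smooth_on_component[OF open_UNIV]] UNIV_I]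
    have tr: "(\<lambda>x. cos (angle x)) differentiable at x" "(\<lambda>x. sin (angle x)) differentiable at x"
      by (rule smooth_on_differentiable[OF open_UNIV smooth_on_cos[OF open_UNIV smooth_angle]]
          smooth_on_differentiable[OF open_UNIV smooth_on_sin[OF open_UNIV smooth_angle]]; simp)+
    have dtr: "pd k (\<lambda>x. cos (angle x)) x = - sin (angle x) * pd k angle x" "pd k (\<lambda>x. sin (angle x)) x = cos (angle x) * pd k angle x"
      by (rule pd_real_chain[OF differentiable_angle DERIV_cos] pd_real_chain[OF differentiable_angle DERIV_sin])+
    have "pd k surface x $ i = pd k (\<lambda>x. surface x $ i) x"
      by (rule pd_vec[OF smooth_on_differentiable[OF open_UNIV smooth_surface]]) simp
    also have "\<dots> = pd k (\<lambda>x. cos (angle x) * u i (x $ 1) (x $ 2) - sin (angle x) * v i (x $ 1) (x $ 2)) x"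
      by (simp add: surface_def)
    also have "\<dots> = (cos (angle x) * pd k (\<lambda>x. u i (x $ 1) (x $ 2)) x + pd k (\<lambda>x. cos (angle x)) x * u i (x $ 1) (x $ 2))
      - (sin (angle x) * pd k (\<lambda>x. v i (x $ 1) (x $ 2)) x + pd k (\<lambda>x. sin (angle x)) x * v i (x $ 1) (x $ 2))"
      by (subst pd_diff) (simp_all add: pd_mult fr tr)
    finally show ?thesis
      unfolding pd_frame[OF differentiable_coordinate differentiable_coordinate] dtr
      using exhaust_2[of k] by (auto simp: pd_angle pd_coordinate algebra_simps)
  qed
  then show "pd 1 surface x = (\<chi> i. M * cos (angle x) * y i (x $ 1) (x $ 2))"
    "pd 2 surface x = (\<chi> i. M * sin (angle x) * z i (x $ 1) (x $ 2))"
    by (simp_all add: vec_eq_iff)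
qed

lemma surface_metric:
  "pd 1 surface x \<bullet> pd 1 surface x = (M * cos (angle x))\<^sup>2"
  "pd 2 surface x \<bullet> pd 2 surface x = (M * sin (angle x))\<^sup>2"
  "pd 1 surface x \<bullet> pd 2 surface x = 0"
proof -
  have "pd 1 surface x \<bullet> pd 1 surface x = (M * cos (angle x))\<^sup>2 * (\<Sum>i\<in>UNIV. y i (x$1) (x$2) * y i (x$1) (x$2))"
    "pd 2 surface x \<bullet> pd 2 surface x = (M * sin (angle x))\<^sup>2 * (\<Sum>i\<in>UNIV. z i (x$1) (x$2) * z i (x$1) (x$2))"
    "pd 1 surface x \<bullet> pd 2 surface x = (M * cos (angle x)) * (M * sin (angle x)) * (\<Sum>i\<in>UNIV. y i (x$1) (x$2) * z i (x$1) (x$2))"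
    unfolding pd_surface by (simp_all add: inner_vec_def sum_4 power2_eq_square algebra_simps)
  then show "pd 1 surface x \<bullet> pd 1 surface x = (M * cos (angle x))\<^sup>2"
    "pd 2 surface x \<bullet> pd 2 surface x = (M * sin (angle x))\<^sup>2" "pd 1 surface x \<bullet> pd 2 surface x = 0"
    by (simp_all add: frame_rows)
qed

lemma norm_surface: "norm (surface x) = 1"
proof -
  have "surface x \<bullet> surface x = (cos (angle x))\<^sup>2 * (\<Sum>i\<in>UNIV. u i (x$1) (x$2) * u i (x$1) (x$2))
     + (sin (angle x))\<^sup>2 * (\<Sum>i\<in>UNIV. v i (x$1) (x$2) * v i (x$1) (x$2))
     - 2 * sin (angle x) * cos (angle x) * (\<Sum>i\<in>UNIV. u i (x$1) (x$2) * v i (x$1) (x$2))"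
    by (simp add: surface_def inner_vec_def sum_4 power2_eq_square algebra_simps)
  then show ?thesis by (simp add: frame_rows norm_eq_sqrt_inner)
qed

definition regular :: "(real^2) set" where
  "regular = {x. cos (angle x) \<noteq> 0 \<and> sin (angle x) \<noteq> 0}"

lemma surface_immersion:
  assumes "x \<in> regular" shows "inj (frechet_derivative surface (at x))"
proof -
  let ?D = "frechet_derivative surface (at x)"
  have lin: "linear ?D"
    using smooth_on_differentiable[OF open_UNIV smooth_surface, of x] by (simp add: linear_frechet_derivative)
  have "a = 0" if "?D a = 0" for a
  proof -
    have "a = a $ 1 *\<^sub>R axis 1 1 + a $ 2 *\<^sub>R axis 2 1"
      by (simp add: vec_eq_iff forall_2 axis_def)
    then have "?D a = a $ 1 *\<^sub>R pd 1 surface x + a $ 2 *\<^sub>R pd 2 surface x"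
      unfolding pd_def by (metis linear_add[OF lin] linear_scale[OF lin])
    then have "(a $ 1 *\<^sub>R pd 1 surface x + a $ 2 *\<^sub>R pd 2 surface x) \<bullet> pd 1 surface x = 0"
      "(a $ 1 *\<^sub>R pd 1 surface x + a $ 2 *\<^sub>R pd 2 surface x) \<bullet> pd 2 surface x = 0"
      using that by simp_all
    then show "a = 0"
      using assms M0 by (auto simp: inner_add_left surface_metric inner_commute[of "pd 2 surface x"] regular_def vec_eq_iff forall_2)
  qed
  then show ?thesis using linear_injective_0[OF lin] by blast
qed

lemma spherical_surface:
  assumes "open V" "connected V" "V \<subseteq> regular" shows "spherical_surface surface V"
  using assms smooth_on_subset[OF open_UNIV assms(1) _ smooth_surface] norm_surface surface_immersion
  by (auto simp: spherical_surface_def)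

lemma induced_metric_surface:
  "induced_metric surface x = (\<chi> i j. if i = j then (if i = 1 then (M * cos (angle x))\<^sup>2 else (M * sin (angle x))\<^sup>2) else 0)"
  by (simp add: induced_metric_def vec_eq_iff forall_2 surface_metric inner_commute[of "pd 2 surface x"])

end

lemma matrix_inv_diagonal2:
  fixes A :: "real^2^2"
  assumes "A $ 1 $ 2 = 0" "A $ 2 $ 1 = 0" "A $ 1 $ 1 \<noteq> 0" "A $ 2 $ 2 \<noteq> 0"
  shows "matrix_inv A = (\<chi> i j. if i = j then 1 / (A $ i $ j) else 0)"
proof -
  define B where "B = (\<chi> i j. if i = j then 1 / (A $ i $ j) else 0 :: real^2^2)"
  have AB: "A ** B = mat 1" "B ** A = mat 1"
    using assms by (simp_all add: B_def matrix_matrix_mult_def mat_def vec_eq_iff forall_2 sum_2)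
  have "A ** matrix_inv A = mat 1 \<and> matrix_inv A ** A = mat 1"
    unfolding matrix_inv_def by (rule someI[of _ B]) (use AB in simp)
  then have "matrix_inv A = (B ** A) ** matrix_inv A" by (simp add: AB)
  also have "\<dots> = B ** (A ** matrix_inv A)" by (simp add: matrix_mul_assoc)
  also have "\<dots> = B" using \<open>A ** matrix_inv A = mat 1 \<and> _\<close> by simp
  finally show ?thesis by (simp add: B_def)
qed

context model_surface
begin

lemma open_regular: "open regular"
  unfolding regular_def
  using smooth_on_continuous[OF smooth_on_cos[OF open_UNIV smooth_angle]] smooth_on_continuous[OF smooth_on_sin[OF open_UNIV smooth_angle]]
  by (intro open_Collect_conj open_Collect_neq continuous_on_const)

lemma christoffel_surface:
  assumes "x \<in> regular"
  shows "christoffel (induced_metric surface) 1 1 1 x = - \<alpha>1 * tan (angle x)"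
    "christoffel (induced_metric surface) 1 1 2 x = - \<alpha>3 * tan (angle x)"
    "christoffel (induced_metric surface) 1 2 1 x = - \<alpha>3 * tan (angle x)"
    "christoffel (induced_metric surface) 1 2 2 x = - \<alpha>1 * tan (angle x)"
    "christoffel (induced_metric surface) 2 1 2 x = \<alpha>1 * cot (angle x)"
    "christoffel (induced_metric surface) 2 2 2 x = \<alpha>3 * cot (angle x)"
proof -
  let ?g = "induced_metric surface"
  have nz: "cos (angle x) \<noteq> 0" "sin (angle x) \<noteq> 0" using assms by (auto simp: regular_def)
  have g: "?g w $ 1 $ 1 = (M * cos (angle w))\<^sup>2" "?g w $ 2 $ 2 = (M * sin (angle w))\<^sup>2" "?g w $ 1 $ 2 = 0" "?g w $ 2 $ 1 = 0" for w
    by (simp_all add: induced_metric_surface)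
  have inv: "matrix_inv (?g x) = (\<chi> i j. if i = j then 1 / (?g x $ i $ j) else 0)"
    by (rule matrix_inv_diagonal2) (use nz M0 in \<open>simp_all add: g\<close>)
  have "pd k (\<lambda>w. (M * cos (angle w))\<^sup>2) x = (2 * (M * cos (angle x)) * (M * (- sin (angle x)))) * pd k angle x" for k
    by (rule pd_real_chain[OF differentiable_angle, of "\<lambda>t. (M * cos t)\<^sup>2"]) (auto intro!: derivative_eq_intros)
  moreover have "pd k (\<lambda>w. (M * sin (angle w))\<^sup>2) x = (2 * (M * sin (angle x)) * (M * cos (angle x))) * pd k angle x" for k
    by (rule pd_real_chain[OF differentiable_angle, of "\<lambda>t. (M * sin t)\<^sup>2"]) (auto intro!: derivative_eq_intros)
  ultimately show "christoffel ?g 1 1 1 x = - \<alpha>1 * tan (angle x)"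
    "christoffel ?g 1 1 2 x = - \<alpha>3 * tan (angle x)"
    "christoffel ?g 1 2 1 x = - \<alpha>3 * tan (angle x)"
    "christoffel ?g 1 2 2 x = - \<alpha>1 * tan (angle x)"
    "christoffel ?g 2 1 2 x = \<alpha>1 * cot (angle x)"
    "christoffel ?g 2 2 2 x = \<alpha>3 * cot (angle x)"
    using nz M0 unfolding christoffel_def inv
    by (simp_all add: sum_2 g pd_const pd_angle tan_def cot_def power2_eq_square field_simps)
qed

text \<open>The metric is diagonal with coefficients depending only on the angle. The curvature turns out as a
  multiple of \<open>\<alpha>3\<^sup>2 - \<alpha>1\<^sup>2\<close> in which the factor \<open>1 - tan * cot\<close> vanishes.\<close>

lemma surface_flat:
  assumes x: "x \<in> regular" shows "gauss_curvature (induced_metric surface) x = 0"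
proof -
  let ?g = "induced_metric surface"
  have nz: "cos (angle x) \<noteq> 0" "sin (angle x) \<noteq> 0" using x by (auto simp: regular_def)
  have "pd k (\<lambda>w. - r * tan (angle w)) x = - r * inverse ((cos (angle x))\<^sup>2) * pd k angle x" for k r
    by (rule pd_real_chain[OF differentiable_angle, of "\<lambda>t. - r * tan t"]) (rule DERIV_cmult DERIV_tan nz)+
  moreover have "pd 1 (christoffel ?g 1 2 2) x = pd 1 (\<lambda>w. - \<alpha>1 * tan (angle w)) x"
    "pd 2 (christoffel ?g 1 1 2) x = pd 2 (\<lambda>w. - \<alpha>3 * tan (angle w)) x"
    by (rule pd_cong[OF open_regular x]; simp add: christoffel_surface)+
  ultimately have d: "pd 1 (christoffel ?g 1 2 2) x = - \<alpha>1\<^sup>2 * inverse ((cos (angle x))\<^sup>2)"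
     "pd 2 (christoffel ?g 1 1 2) x = - \<alpha>3\<^sup>2 * inverse ((cos (angle x))\<^sup>2)"
    by (simp_all add: pd_angle power2_eq_square)
  have sec: "inverse ((cos (angle x))\<^sup>2) = 1 + (tan (angle x))\<^sup>2" using tan_sec[OF nz(1)] by (simp add: power_inverse)
  have tc: "tan (angle x) * cot (angle x) = 1" using nz by (simp add: tan_def cot_def)
  have "riemann_122 ?g 1 x = (\<alpha>3\<^sup>2 - \<alpha>1\<^sup>2) * (1 - tan (angle x) * cot (angle x))"
    unfolding riemann_122_def d sec by (simp add: sum_2 christoffel_surface x power2_eq_square algebra_simps)
  then have "riemann_122 ?g 1 x = 0" unfolding tc by simp
  then show ?thesis unfolding gauss_curvature_def by (simp add: sum_2 induced_metric_surface)
qed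

lemma flat_surface:
  assumes "open V" "connected V" "V \<subseteq> regular" shows "flat_surface surface V"
  using assms spherical_surface surface_flat by (auto simp: flat_surface_def)

text \<open>The vector \<open>(\<alpha>3, - \<alpha>1)\<close> spans the lines on which the angle is constant, and the arguments of the
  trigonometric functions grow linearly along them.\<close>

lemma surface_translate:
  "helicoidal_motion (\<theta>1 * \<alpha>3 - \<theta>2 * \<alpha>1) (\<theta>2 * \<alpha>3 - \<theta>1 * \<alpha>1) t *v surface x
    = surface (x + t *\<^sub>R vector [\<alpha>3, - \<alpha>1])"
proof -
  let ?x = "x + t *\<^sub>R vector [\<alpha>3, - \<alpha>1]"
  have a: "angle ?x = angle x" by (simp add: angle_def algebra_simps)
  have 1: "\<theta>1 * ?x $ 1 + \<theta>2 * ?x $ 2 = (\<theta>1 * \<alpha>3 - \<theta>2 * \<alpha>1) * t + (\<theta>1 * x $ 1 + \<theta>2 * x $ 2)"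
    and 2: "\<theta>2 * ?x $ 1 + \<theta>1 * ?x $ 2 = (\<theta>2 * \<alpha>3 - \<theta>1 * \<alpha>1) * t + (\<theta>2 * x $ 1 + \<theta>1 * x $ 2)"
    by (simp_all add: algebra_simps)
  show ?thesis
    unfolding surface_def a u_def v_def 1 2 cos_add sin_add
    by (simp add: vec_eq_iff forall_4 helicoidal_motion_def matrix_vector_mult_def sum_4 vector_4 algebra_simps)
qed

end

section \<open>From the hypersurface to the structure equations\<close>

lemma pd_in_tangent_space:
  assumes "open U" "smooth_on U f" "f ` U \<subseteq> space_form K" "x \<in> U"
  shows "pd i f x \<in> tangent_space K (f x)"
proof -
  have d: "f differentiable at x" by (rule smooth_on_differentiable[OF assms(1,2,4)])
  have D: "(\<lambda>x. fst (f x)) differentiable at x" "(\<lambda>x. snd (f x)) differentiable at x"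
    using bounded_linear.has_derivative[OF bounded_linear_fst pd_has_derivative[OF d]]
      bounded_linear.has_derivative[OF bounded_linear_snd pd_has_derivative[OF d]]
    unfolding differentiable_def by blast+
  have "pd i (\<lambda>x. fst (f x) * fst (f x) + K * (snd (f x) \<bullet> snd (f x))) x = pd i (\<lambda>_. 1) x"
    using assms(3) by (intro pd_cong[OF assms(1,4)]) (force simp: space_form_def power2_eq_square)
  moreover have "(\<lambda>x. snd (f x) \<bullet> snd (f x)) differentiable at x"
    using bounded_bilinear.FDERIV[OF bounded_bilinear_inner pd_has_derivative[OF D(2)] pd_has_derivative[OF D(2)]]
    unfolding differentiable_def by blast
  ultimately show ?thesis
    using D by (simp add: pd_add pd_mult pd_inner pd_const pd_linear[OF bounded_linear_fst d]
        pd_linear[OF bounded_linear_snd d] tangent_space_def inner_commute)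
qed

lemma pd_lift:
  assumes "f differentiable at x"
  shows "pd i (\<lambda>x. lift K (f x)) x = dlift K (f x) (pd i f x)"
  using pd_eqI[OF has_derivative_compose[OF pd_has_derivative[OF assms] lift_has_derivative]]
  by (simp add: pd_def)

text \<open>For \<open>K = 0\<close> the lift is quadratic, whence the extra term. It vanishes if \<open>n\<close> is normal to \<open>f\<close>.\<close>

lemma pd_dlift:
  assumes "f differentiable at x" "n differentiable at x"
  shows "pd i (\<lambda>x. dlift K (f x) (n x)) x
    = dlift K (f x) (pd i n x) + (0, 0, if K = 0 then snd (pd i f x) \<bullet> snd (n x) else 0)"
proof -
  note D = pd_has_derivative[OF assms(1)] pd_has_derivative[OF assms(2)]
  note Df = bounded_linear.has_derivative[OF bounded_linear_fst D(1)] bounded_linear.has_derivative[OF bounded_linear_snd D(1)]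
  note Dn = bounded_linear.has_derivative[OF bounded_linear_fst D(2)] bounded_linear.has_derivative[OF bounded_linear_snd D(2)]
  show ?thesis
  proof (cases "K = 0")
    case True
    have "((\<lambda>x. (snd (n x), fst (n x) * (1/2), snd (f x) \<bullet> snd (n x))) has_derivative
      (\<lambda>h. (snd (frechet_derivative n (at x) h), fst (frechet_derivative n (at x) h) * (1/2),
        snd (f x) \<bullet> snd (frechet_derivative n (at x) h) + snd (frechet_derivative f (at x) h) \<bullet> snd (n x)))) (at x)"
      by (intro has_derivative_Pair has_derivative_mult_left bounded_bilinear.FDERIV[OF bounded_bilinear_inner] Dn Df)
    from pd_eqI[OF this] show ?thesis using True by (simp add: dlift_def pd_def)
  next
    case False
    have "((\<lambda>x. (snd (n x), fst (n x) * (1/2), fst (n x) * (- (1/K)))) has_derivative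
      (\<lambda>h. (snd (frechet_derivative n (at x) h), fst (frechet_derivative n (at x) h) * (1/2),
        fst (frechet_derivative n (at x) h) * (- (1/K))))) (at x)"
      by (intro has_derivative_Pair has_derivative_mult_left Dn Df)
    from pd_eqI[OF this] show ?thesis using False by (simp add: dlift_def pd_def)
  qed
qed

lemma dlift_scaleR: "dlift K P (r *\<^sub>R v) = r *\<^sub>R dlift K P v"
  by (simp add: dlift_def)

lemma sf_metric_commute: "sf_metric K v w = sf_metric K w v"
  by (simp add: sf_metric_def inner_commute mult.commute)

text \<open>Passing from \<open>f\<close> to \<open>F\<close> and from the normal to \<open>N\<close> subtracts the second principal curvature from the
  others and multiplies the differences by \<open>e\<^sup>u\<close>. Their ratio is a conformal invariant.\<close>

lemma hypersurface_lame_frame: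
  assumes "open U" "connected U" "U \<noteq> {}" and \<alpha>: "\<alpha>1 \<noteq> 0" "\<alpha>3 \<noteq> 0"
    and l: "\<And>x. x \<in> U \<Longrightarrow> l 1 x = lam * cos (\<alpha>1 * x $ 1 + \<alpha>3 * x $ 3 + \<xi>0)"
      "\<And>x. x \<in> U \<Longrightarrow> l 2 x = lam"
      "\<And>x. x \<in> U \<Longrightarrow> l 3 x = lam * sin (\<alpha>1 * x $ 1 + \<alpha>3 * x $ 3 + \<xi>0)"
    and l0: "\<And>x i. x \<in> U \<Longrightarrow> l i x \<noteq> 0"
    and hyp: "associated_hypersurface K l U f"
  obtains u F N k1 k3 t1 t2 t3 where "lame_frame U lam \<alpha>1 \<alpha>3 \<xi>0 F N k1 k3 t1 t2 t3"
    "\<And>x. F x = exp (- u x) *\<^sub>R lift K (f x)"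
proof -
  from hyp have smooth_f: "smooth_on U f" and range_f: "f ` U \<subseteq> space_form K"
    unfolding associated_hypersurface_def by auto
  from hyp obtain u where smooth_u: "smooth_on U u" and metric: "\<And>x i j. x \<in> U \<Longrightarrow>
      sf_metric K (pd i f x) (pd j f x) = (if i = j then exp (2 * u x) * (l i x)\<^sup>2 else 0)"
    unfolding associated_hypersurface_def by auto
  from hyp obtain n \<kappa> where smooth_n: "smooth_on U n"
    and n: "\<And>x. x \<in> U \<Longrightarrow> n x \<in> tangent_space K (f x)" "\<And>x. x \<in> U \<Longrightarrow> sf_metric K (n x) (n x) = 1"
      "\<And>x i. x \<in> U \<Longrightarrow> sf_metric K (n x) (pd i f x) = 0"
    and inj_\<kappa>: "\<And>x. x \<in> U \<Longrightarrow> inj (\<lambda>i::3. \<kappa> i x)"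
    and weingarten: "\<And>x i. x \<in> U \<Longrightarrow> pd i n x = - \<kappa> i x *\<^sub>R pd i f x"
    unfolding associated_hypersurface_def by blast
  have lam: "lam \<noteq> 0" using l(2) l0[of _ 2] \<open>U \<noteq> {}\<close> by auto
  define \<psi> where "\<psi> x = lift K (f x)" for x
  define \<nu> where "\<nu> x = dlift K (f x) (n x)" for x
  have smooth_\<psi>: "smooth_on U \<psi>" and smooth_\<nu>: "smooth_on U \<nu>"
    unfolding \<psi>_def[abs_def] \<nu>_def[abs_def]
    by (intro smooth_on_lift smooth_on_dlift smooth_f smooth_n \<open>open U\<close>)+
  note diff = smooth_on_differentiable[OF \<open>open U\<close>]
  have sf: "f x \<in> space_form K" if "x \<in> U" for x using range_f that by auto
  have tan: "pd i f x \<in> tangent_space K (f x)" if "x \<in> U" for x i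
    by (rule pd_in_tangent_space[OF \<open>open U\<close> smooth_f range_f that])
  have d\<psi>: "pd i \<psi> x = dlift K (f x) (pd i f x)" if "x \<in> U" for x i
    unfolding \<psi>_def[abs_def] by (rule pd_lift[OF diff[OF smooth_f that]])
  have d\<nu>: "pd i \<nu> x = - \<kappa> i x *\<^sub>R pd i \<psi> x" if "x \<in> U" for x i
  proof -
    have "K = 0 \<Longrightarrow> snd (pd i f x) \<bullet> snd (n x) = 0"
      using n(3)[OF that, of i] by (simp add: sf_metric_def inner_commute)
    then show ?thesis
      unfolding d\<psi>[OF that] \<nu>_def[abs_def] pd_dlift[OF diff[OF smooth_f that] diff[OF smooth_n that]]
      by (simp only: weingarten[OF that] dlift_scaleR) (auto simp: zero_prod_def)
  qed
  have gram: "lor (\<psi> x) (\<psi> x) = 0" "lor (\<psi> x) (pd i \<psi> x) = 0" "lor (pd i \<psi> x) (\<psi> x) = 0"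
    "lor (\<psi> x) (\<nu> x) = 0" "lor (\<nu> x) (\<psi> x) = 0" "lor (\<nu> x) (\<nu> x) = 1"
    "lor (pd i \<psi> x) (\<nu> x) = 0" "lor (\<nu> x) (pd i \<psi> x) = 0"
    "lor (pd i \<psi> x) (pd j \<psi> x) = (if i = j then exp (2 * u x) * (l i x)\<^sup>2 else 0)" if "x \<in> U" for x i j
    using n(3)[OF that, THEN trans[OF sf_metric_commute]]
    by (simp_all add: d\<psi>[OF that] \<psi>_def \<nu>_def lift_null[OF sf[OF that]] lor_lift_dlift[OF sf[OF that]]
        lor_lift_dlift[OF sf[OF that], THEN trans[OF lor_commute]] lor_dlift_dlift[OF sf[OF that]] tan[OF that] n[OF that] metric[OF that])
  \<comment> \<open>A formula for \<open>\<kappa> 2\<close> from which its smoothness can be read off.\<close>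
  define k2 where "k2 x = - lor (pd 2 \<nu> x) (pd 2 \<psi> x) / (exp (2 * u x) * lam\<^sup>2)" for x
  have k2: "k2 x = \<kappa> 2 x" if "x \<in> U" for x
    unfolding k2_def d\<nu>[OF that] using lam by (simp add: lor_simps gram[OF that] l(2)[OF that])
  have smooth_k2: "smooth_on U k2"
    unfolding k2_def[abs_def]
    by (intro smooth_on_divide smooth_on_minus smooth_on_bilinear[OF bounded_bilinear_lor] smooth_on_pd
        smooth_on_mult smooth_on_exp smooth_on_const smooth_\<nu> smooth_\<psi> smooth_u \<open>open U\<close>) (simp add: lam)
  define F where "F x = exp (- u x) *\<^sub>R \<psi> x" for x
  define N where "N x = \<nu> x + k2 x *\<^sub>R \<psi> x" for x
  have smooth_e: "smooth_on U (\<lambda>x. exp (- u x))"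
    by (intro smooth_on_exp smooth_on_minus smooth_u \<open>open U\<close>)
  have smooth_F: "smooth_on U F" unfolding F_def[abs_def]
    by (intro smooth_on_scaleR smooth_e smooth_\<psi> \<open>open U\<close>)
  have smooth_N: "smooth_on U N" unfolding N_def[abs_def]
    by (intro smooth_on_add smooth_on_scaleR smooth_k2 smooth_\<nu> smooth_\<psi> \<open>open U\<close>)
  have dF: "pd i F x = exp (- u x) *\<^sub>R pd i \<psi> x - (exp (- u x) * pd i u x) *\<^sub>R \<psi> x" if "x \<in> U" for i x
  proof -
    have "pd i (\<lambda>x. exp (- u x)) x = exp (- u x) * (- pd i u x)"
      using pd_real_chain[of "\<lambda>x. - u x" x exp "exp (- u x)" i] diff[OF smooth_u that] diff[OF smooth_on_minus[OF \<open>open U\<close> smooth_u] that]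
      by (simp add: pd_minus)
    then show ?thesis unfolding F_def[abs_def] using diff[OF smooth_e that] diff[OF smooth_\<psi> that] by (simp add: pd_scaleR)
  qed
  have \<psi>F: "\<psi> x = exp (u x) *\<^sub>R F x" for x by (simp add: F_def exp_minus)
  have d\<psi>F: "pd i \<psi> x = exp (u x) *\<^sub>R pd i F x + (exp (u x) * pd i u x) *\<^sub>R F x" if "x \<in> U" for i x
    by (simp add: dF[OF that] F_def exp_minus algebra_simps)
  define k where "k i x = (\<kappa> i x - \<kappa> 2 x) * exp (u x)" for i :: 3 and x
  define t where "t i x = (pd i k2 x - (\<kappa> i x - \<kappa> 2 x) * pd i u x) * exp (u x)" for i :: 3 and x
  have dN: "pd i N x = t i x *\<^sub>R F x - k i x *\<^sub>R pd i F x" if "x \<in> U" for i x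
  proof -
    have "pd i N x = pd i \<nu> x + (k2 x *\<^sub>R pd i \<psi> x + pd i k2 x *\<^sub>R \<psi> x)"
      unfolding N_def[abs_def] using diff[OF smooth_\<nu> that] diff[OF smooth_\<psi> that] diff[OF smooth_k2 that]
      by (simp add: pd_add pd_scaleR)
    also have "\<dots> = (- (\<kappa> i x - \<kappa> 2 x)) *\<^sub>R pd i \<psi> x + pd i k2 x *\<^sub>R \<psi> x"
      by (simp add: d\<nu>[OF that] k2[OF that] algebra_simps)
    finally show ?thesis
      unfolding d\<psi>F[OF that] \<psi>F[of x] by (simp add: t_def k_def algebra_simps)
  qed
  have e2: "exp (- u x) * (exp (- u x) * (exp (2 * u x) * r)) = r" for x r
    by (simp add: mult.assoc[symmetric] exp_add[symmetric])
  have metricF: "lor (pd i F x) (pd j F x) = (if i = j then (l i x)\<^sup>2 else 0)" if "x \<in> U" for i j x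
    by (simp add: dF[OF that] lor_simps gram[OF that] e2)
  have "lame_frame U lam \<alpha>1 \<alpha>3 \<xi>0 F N (k 1) (k 3) (t 1) (t 2) (t 3)"
  proof
    show "open U" "connected U" "lam \<noteq> 0" "\<alpha>1 \<noteq> 0" "\<alpha>3 \<noteq> 0" "smooth_on U F" "smooth_on U N"
      by (fact assms lam smooth_F smooth_N)+
    fix x assume x: "x \<in> U"
    show "cos (\<alpha>1 * x $ 1 + \<alpha>3 * x $ 3 + \<xi>0) \<noteq> 0" "sin (\<alpha>1 * x $ 1 + \<alpha>3 * x $ 3 + \<xi>0) \<noteq> 0"
      using l(1,3)[OF x] l0[OF x, of 1] l0[OF x, of 3] by auto
    show "lor (F x) (F x) = 0" "lor (F x) (N x) = 0" "lor (N x) (N x) = 1"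
      by (simp_all add: F_def N_def lor_simps gram[OF x])
    show "lor (pd i F x) (N x) = 0" for i
      by (simp add: dF[OF x] N_def lor_simps gram[OF x])
    show "lor (pd 1 F x) (pd 1 F x) = (lam * cos (\<alpha>1 * x $ 1 + \<alpha>3 * x $ 3 + \<xi>0))\<^sup>2"
      "lor (pd 2 F x) (pd 2 F x) = lam\<^sup>2"
      "lor (pd 3 F x) (pd 3 F x) = (lam * sin (\<alpha>1 * x $ 1 + \<alpha>3 * x $ 3 + \<xi>0))\<^sup>2"
      "lor (pd 1 F x) (pd 2 F x) = 0" "lor (pd 1 F x) (pd 3 F x) = 0" "lor (pd 2 F x) (pd 3 F x) = 0"
      by (simp_all add: metricF x l)
    show "pd 1 N x = t 1 x *\<^sub>R F x - k 1 x *\<^sub>R pd 1 F x" "pd 3 N x = t 3 x *\<^sub>R F x - k 3 x *\<^sub>R pd 3 F x"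
      by (rule dN[OF x])+
    show "pd 2 N x = t 2 x *\<^sub>R F x" by (simp add: dN[OF x] k_def)
    have "\<kappa> 1 x \<noteq> \<kappa> 2 x" "\<kappa> 3 x \<noteq> \<kappa> 2 x" "\<kappa> 1 x \<noteq> \<kappa> 3 x"
      using inj_eq[OF inj_\<kappa>[OF x], of 1 2] inj_eq[OF inj_\<kappa>[OF x], of 3 2] inj_eq[OF inj_\<kappa>[OF x], of 1 3] by auto
    then show "k 1 x \<noteq> 0" "k 3 x \<noteq> 0" "k 1 x \<noteq> k 3 x" by (simp_all add: k_def)
  qed
  moreover have "F x = exp (- u x) *\<^sub>R lift K (f x)" for x by (simp add: F_def \<psi>_def)
  ultimately show ?thesis by (rule that)
qed

section \<open>Strips of regular points and the change of parameters\<close>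

context model_surface
begin

text \<open>The components of \<open>regular\<close>. Each is invariant under translations along the lines of constant
  angle.\<close>

definition strip :: "int \<Rightarrow> (real^2) set" where
  "strip k = {x. of_int k * pi < 2 * angle x \<and> 2 * angle x < (of_int k + 1) * pi}"

lemma regular_iff: "x \<in> regular \<longleftrightarrow> (\<forall>k::int. 2 * angle x \<noteq> of_int k * pi)"
  unfolding regular_def using sin_double[of "angle x"] sin_zero_iff_int2[of "2 * angle x"] by auto

lemma strip_subset_regular: "strip k \<subseteq> regular"
proof
  fix x assume x: "x \<in> strip k"
  have False if "2 * angle x = of_int j * pi" for j :: int
  proof -
    have "real_of_int k < of_int j" "real_of_int j < of_int (k + 1)"
      using x that by (auto simp: strip_def)
    then show False unfolding of_int_less_iff by simp
  qed
  then show "x \<in> regular" by (auto simp: regular_iff)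
qed

lemma open_strip: "open (strip k)"
  unfolding strip_def using smooth_on_continuous[OF smooth_angle]
  by (intro open_Collect_conj open_Collect_less continuous_intros)

lemma connected_strip: "connected (strip k)"
proof -
  have "strip k = {x. vector [2 * \<alpha>1, 2 * \<alpha>3] \<bullet> x > of_int k * pi - 2 * \<xi>0} \<inter>
      {x. vector [2 * \<alpha>1, 2 * \<alpha>3] \<bullet> x < (of_int k + 1) * pi - 2 * \<xi>0}"
    by (auto simp: strip_def angle_def inner_vec_def sum_2 algebra_simps)
  then show ?thesis
    by (simp only: convex_connected[OF convex_Int[OF convex_halfspace_gt convex_halfspace_lt]])
qed

text \<open>Twice the angle takes connected sets to intervals, which avoid the multiples of \<open>\<pi>\<close>.\<close>

lemma connected_regular_subset_strip:
  assumes "connected V" "V \<subseteq> regular" "V \<noteq> {}"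
  obtains k where "V \<subseteq> strip k"
proof -
  obtain x0 where x0: "x0 \<in> V" using assms(3) by auto
  define k where "k = \<lfloor>2 * angle x0 / pi\<rfloor>"
  have b: "of_int k \<le> 2 * angle x0 / pi" "2 * angle x0 / pi < of_int k + 1"
    unfolding k_def by linarith+
  have conn: "connected ((\<lambda>x. 2 * angle x) ` V)"
    using smooth_on_continuous[OF smooth_angle] 
    by (intro connected_continuous_image continuous_intros assms(1)) (rule continuous_on_subset, auto)
  have avoid: "of_int j * pi \<notin> (\<lambda>x. 2 * angle x) ` V" for j :: int
  proof
    assume "of_int j * pi \<in> (\<lambda>x. 2 * angle x) ` V"
    then obtain x where "x \<in> V" "2 * angle x = of_int j * pi" by auto
    then show False using assms(2) regular_iff[of x] by blast
  qed
  have "V \<subseteq> strip k"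
  proof
    fix x assume x: "x \<in> V"
    have 0: "of_int k * pi \<le> 2 * angle x0" "2 * angle x0 < of_int (k + 1) * pi"
      using b by (auto simp: field_simps)
    have "2 * angle x < of_int (k + 1) * pi"
    proof (rule ccontr)
      assume "\<not> ?thesis"
      then have "of_int (k + 1) * pi \<in> {2 * angle x0 .. 2 * angle x}" using 0 by auto
      then show False using connected_contains_Icc[OF conn, of "2 * angle x0" "2 * angle x"] x x0 avoid by blast
    qed
    moreover have "of_int k * pi < 2 * angle x"
    proof (rule ccontr)
      assume "\<not> ?thesis"
      then have "of_int k * pi \<in> {2 * angle x .. 2 * angle x0}" using 0 by auto
      then show False using connected_contains_Icc[OF conn, of "2 * angle x" "2 * angle x0"] x x0 avoid by blast
    qed
    ultimately show "x \<in> strip k" by (simp add: strip_def)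
  qed
  then show ?thesis by (rule that)
qed

lemma strip_invariant:
  "invariant_under_motions (\<theta>1 * \<alpha>3 - \<theta>2 * \<alpha>1) (\<theta>2 * \<alpha>3 - \<theta>1 * \<alpha>1) (surface ` strip k)"
proof -
  have shift: "x + t *\<^sub>R vector [\<alpha>3, - \<alpha>1] \<in> strip k" if "x \<in> strip k" for x t
    using that by (simp add: strip_def angle_def algebra_simps)
  show ?thesis
    unfolding invariant_under_motions_def
  proof (intro allI set_eqI iffI)
    fix t w
    assume "w \<in> (*v) (helicoidal_motion (\<theta>1 * \<alpha>3 - \<theta>2 * \<alpha>1) (\<theta>2 * \<alpha>3 - \<theta>1 * \<alpha>1) t) ` surface ` strip k"
    then show "w \<in> surface ` strip k" using shift by (auto simp: surface_translate)
  next
    fix t w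
    assume "w \<in> surface ` strip k"
    then obtain x where x: "x \<in> strip k" "w = surface x" by auto
    have "w = helicoidal_motion (\<theta>1 * \<alpha>3 - \<theta>2 * \<alpha>1) (\<theta>2 * \<alpha>3 - \<theta>1 * \<alpha>1) t *v surface (x + (- t) *\<^sub>R vector [\<alpha>3, - \<alpha>1])"
      unfolding surface_translate x by simp
    then show "w \<in> (*v) (helicoidal_motion (\<theta>1 * \<alpha>3 - \<theta>2 * \<alpha>1) (\<theta>2 * \<alpha>3 - \<theta>1 * \<alpha>1) t) ` surface ` strip k"
      using shift[OF x(1), of "- t"] by blast
  qed
qed

end

lemma locally_congruent_restriction:
  assumes "open V" "V \<subseteq> G" shows "locally_congruent p V p G"
proof -
  have id: "smooth_on V (\<lambda>x. x)" by (rule smooth_on_linear[OF assms(1) bounded_linear_ident])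
  have "smooth_on V (inv_into V (\<lambda>x. x))"
    by (rule smooth_on_cong[OF assms(1) id]) (metis f_inv_into_f image_ident)
  then have "diffeomorphism_between (\<lambda>x. x) V V"
    using id assms(1) by (simp add: diffeomorphism_between_def bij_betw_def)
  then show ?thesis
    using assms(2) orthogonal_transformation_id unfolding locally_congruent_def by (metis order_refl)
qed

text \<open>The change of parameters: \<open>M\<close> is the speed of the hyperbolic rotation.\<close>

definition cone_chart :: "real \<Rightarrow> real^3 \<Rightarrow> real \<times> (real^2)" where
  "cone_chart M x = (exp (M * x $ 2), vector [x $ 1, x $ 3])"

lemma vector2_lambda: "(vector [a, b] :: real^2) = (\<chi> i. if i = 1 then a else b)"
  by (simp add: vec_eq_iff forall_2)

lemma vector3_lambda: "(vector [a, b, c] :: real^3) = (\<chi> i. if i = 1 then a else if i = 2 then b else c)"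
  by (simp add: vec_eq_iff forall_3)

lemma cone_chart_diffeomorphism:
  assumes "M \<noteq> 0" "open U"
  shows "diffeomorphism_between (cone_chart M) U (cone_chart M ` U)"
proof -
  define k :: "real \<times> (real^2) \<Rightarrow> real^3" where "k w = vector [snd w $ 1, ln (fst w) / M, snd w $ 2]" for w
  have kh: "k (cone_chart M x) = x" for x
    using assms(1) by (simp add: k_def cone_chart_def vec_eq_iff forall_3)
  have hk: "cone_chart M (k w) = w" if "fst w > 0" for w
    using assms(1) that by (simp add: k_def cone_chart_def prod_eq_iff vec_eq_iff forall_2)
  let ?H = "{0<..} \<times> UNIV :: (real \<times> (real^2)) set"
  have H: "open ?H" by (intro open_Times open_greaterThan open_UNIV)
  have comp: "smooth_on S (\<lambda>w::real \<times> (real^2). snd w $ i)" "smooth_on S (\<lambda>w::real \<times> (real^2). fst w)" if "open S" for S i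
    by (rule smooth_on_linear[OF that bounded_linear_compose[OF bounded_linear_vec_nth bounded_linear_snd]]
        smooth_on_linear[OF that bounded_linear_fst])+
  have "smooth_on ?H (\<lambda>w. if i = 1 then snd w $ 1 else if i = 2 then ln (fst w) / M else snd w $ 2)" for i :: 3
  proof -
    have "smooth_on ?H (\<lambda>w. ln (fst w) / M)"
      by (intro smooth_on_divide smooth_on_ln smooth_on_const comp H) (auto simp: assms(1))
    then show ?thesis using comp(1)[OF H] exhaust_3[of i] by (elim disjE) simp_all
  qed
  then have smooth_k: "smooth_on ?H k"
    unfolding k_def[abs_def] vector3_lambda by (intro smooth_on_vec_lambda H)
  have image: "cone_chart M ` U = {w \<in> ?H. k w \<in> U}"
  proof (intro set_eqI iffI)
    fix w assume "w \<in> cone_chart M ` U"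
    then show "w \<in> {w \<in> ?H. k w \<in> U}" using kh by (auto simp: cone_chart_def)
  next
    fix w assume w: "w \<in> {w \<in> ?H. k w \<in> U}"
    then have "w = cone_chart M (k w)" using hk by auto
    then show "w \<in> cone_chart M ` U" using w by blast
  qed
  have open_D: "open (cone_chart M ` U)"
    unfolding image using continuous_open_preimage[OF smooth_on_continuous[OF smooth_k] H assms(2)]
    by (simp add: vimage_def Int_def)
  have inj: "inj_on (cone_chart M) U" using kh by (metis inj_onI)
  have "smooth_on U (\<lambda>x. if i = 1 then x $ 1 else x $ 3)" for i :: 2
    using smooth_on_component[OF assms(2)] by (cases "i = 1") simp_all
  then have smooth_h: "smooth_on U (cone_chart M)"
    unfolding cone_chart_def[abs_def] vector2_lambda
    by (intro smooth_on_Pair smooth_on_vec_lambda smooth_on_exp smooth_on_mult smooth_on_const smooth_on_component assms(2))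
  have inv: "k w = inv_into U (cone_chart M) w" if w: "w \<in> cone_chart M ` U" for w
  proof -
    obtain x where "x \<in> U" "w = cone_chart M x" using w by (rule imageE)
    then show ?thesis using inv_into_f_f[OF inj] kh by simp
  qed
  have "cone_chart M ` U \<subseteq> ?H" unfolding image by blast
  then have "smooth_on (cone_chart M ` U) (inv_into U (cone_chart M))"
    by (rule smooth_on_cong[OF open_D smooth_on_subset[OF H open_D _ smooth_k] inv])
  then show ?thesis
    unfolding diffeomorphism_between_def bij_betw_def
    using assms(2) open_D smooth_h inj by blast
qed

text \<open>As \<open>x\<^sub>2\<close> runs through all real numbers, \<open>exp (M * x\<^sub>2)\<close> runs through all positive ones.\<close>

lemma cone_chart_image_cylinder:
  assumes "M \<noteq> 0" "\<And>x s. x \<in> U \<Longrightarrow> x + s *\<^sub>R axis 2 1 \<in> U"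
  shows "cone_chart M ` U = {0<..} \<times> snd ` cone_chart M ` U"
proof
  show "cone_chart M ` U \<subseteq> {0<..} \<times> snd ` cone_chart M ` U"
    by (force simp: cone_chart_def)
  show "{0<..} \<times> snd ` cone_chart M ` U \<subseteq> cone_chart M ` U"
  proof
    fix w :: "real \<times> (real^2)" assume "w \<in> {0<..} \<times> snd ` cone_chart M ` U"
    then obtain x where x: "x \<in> U" "fst w > 0" "snd w = vector [x $ 1, x $ 3]"
      by (auto simp: cone_chart_def)
    have "w = cone_chart M (x + (ln (fst w) / M - x $ 2) *\<^sub>R axis 2 1)"
      using x(2,3) assms(1) by (simp add: cone_chart_def axis_def prod_eq_iff)
    then show "w \<in> cone_chart M ` U" using assms(2)[OF x(1)] by blast
  qed
qed

section \<open>The associated hypersurfaces are cones\<close>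

text \<open>
  The surfaces \<open>p\<close> and \<open>q\<close> are the model surface, once on the projection of \<open>U\<close> and once on the
  whole strip that contains it. The constant vectors exist on all of \<open>U\<close>, because it
  is connected; thus a single conformal map serves for the whole hypersurface.\<close>

theorem theorem3:
  fixes K \<alpha>1 \<alpha>3 lam2 \<xi>0 :: real
    and U :: "(real^3) set"
    and l :: "3 \<Rightarrow> real^3 \<Rightarrow> real"
    and \<xi> :: "real^3 \<Rightarrow> real"
    and f :: "real^3 \<Rightarrow> real \<times> (real^4)"
  assumes "open U" and "connected U"
    and "\<alpha>1 * \<alpha>3 \<noteq> 0"
    and "\<And>x. \<xi> x = \<alpha>1 * x $ 1 + \<alpha>3 * x $ 3"
    and "\<And>x. x \<in> U \<Longrightarrow> l 1 x = lam2 * cos (\<xi> x + \<xi>0)"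
    and "\<And>x. x \<in> U \<Longrightarrow> l 2 x = lam2"
    and "\<And>x. x \<in> U \<Longrightarrow> l 3 x = lam2 * sin (\<xi> x + \<xi>0)"
    and "lame_system U l" and "guichard_condition U l"
    and "associated_hypersurface K l U f"
  shows "\<exists>p V D q G a b.
      spherical_surface p V
    \<and> flat_surface q G \<and> invariant_under_motions a b (q ` G)
    \<and> (a, b) \<noteq> (0, 0) \<and> (\<alpha>1 \<noteq> \<alpha>3 \<and> \<alpha>1 \<noteq> - \<alpha>3 \<longrightarrow> a \<noteq> b \<and> a \<noteq> - b)
    \<and> locally_congruent p V q G
    \<and> D \<subseteq> {0<..} \<times> V \<and> snd ` D = V
    \<and> ((\<forall>x\<in>U. \<forall>s. x + s *\<^sub>R axis 2 1 \<in> U) \<longrightarrow> D = {0<..} \<times> V)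
    \<and> conformally_equivalent K f U (\<lambda>(t, v). t *\<^sub>R p v) D"
proof (cases "U = {}")
  case True
  have k: "Ck_on k {} h" for k and h :: "'a::euclidean_space \<Rightarrow> 'b::real_normed_vector"
    by (rule Ck_on_cong[OF open_empty _ Ck_on_const[OF open_empty]]) simp
  then have s: "smooth_on {} h" for h :: "'a::euclidean_space \<Rightarrow> 'b::real_normed_vector"
    unfolding smooth_on_def by blast
  \<comment> \<open>The speeds 1 and 0 are nondegenerate for all values of \<open>\<alpha>1\<close>, \<open>\<alpha>3\<close>.\<close>
  let ?o = "\<lambda>_::real^2. 0 :: real^4"
  have 1: "spherical_surface ?o {}" "flat_surface ?o {}" "invariant_under_motions 1 0 (?o ` {})"
    "locally_congruent ?o {} ?o {}"
    by (simp_all add: spherical_surface_def flat_surface_def invariant_under_motions_def locally_congruent_def s)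
  have 2: "conformally_equivalent K f U (\<lambda>(t, v). t *\<^sub>R ?o v) {}"
    unfolding conformally_equivalent_def diffeomorphism_between_def conformal_embedding_def
    by (rule exI[of _ "\<lambda>_. 0"], rule exI[of _ "\<lambda>_. 0"], rule exI[of _ "{}"]) (simp add: True s bij_betw_def)
  show ?thesis
    by (rule exI[of _ ?o], rule exI[of _ "{}"], rule exI[of _ "{}"], rule exI[of _ ?o], rule exI[of _ "{}"],
        rule exI[of _ 1], rule exI[of _ 0]) (use 1 2 in simp)
next
  case False
  have \<alpha>0: "\<alpha>1 \<noteq> 0" "\<alpha>3 \<noteq> 0" using assms(3) by auto
  have l: "l 1 x = lam2 * cos (\<alpha>1 * x $ 1 + \<alpha>3 * x $ 3 + \<xi>0)" "l 3 x = lam2 * sin (\<alpha>1 * x $ 1 + \<alpha>3 * x $ 3 + \<xi>0)"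
    if "x \<in> U" for x using assms(5,7)[OF that] by (simp_all add: assms(4))
  have l0: "l i x \<noteq> 0" if "x \<in> U" for i x using assms(8) that by (auto simp: lame_system_def)
  obtain u F N k1 k3 t1 t2 t3 where frame: "lame_frame U lam2 \<alpha>1 \<alpha>3 \<xi>0 F N k1 k3 t1 t2 t3"
    and F: "\<And>x. F x = exp (- u x) *\<^sub>R lift K (f x)"
    by (rule hypersurface_lame_frame[OF assms(1,2) False \<alpha>0, of l lam2 \<xi>0 K f])
      (assumption | rule l l0 assms(6) assms(10) | blast)+
  interpret H: lame_frame U lam2 \<alpha>1 \<alpha>3 \<xi>0 "\<lambda>x. cos (\<alpha>1 * x $ 1 + \<alpha>3 * x $ 3 + \<xi>0)"
      "\<lambda>x. sin (\<alpha>1 * x $ 1 + \<alpha>3 * x $ 3 + \<xi>0)" F N k1 k3 t1 t2 t3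
    by (rule frame) (rule reflexive)+
  obtain M where M: "M \<noteq> 0" "\<And>x. x \<in> U \<Longrightarrow> H.a x = - M * sin (\<alpha>1 * x $ 1 + \<alpha>3 * x $ 3 + \<xi>0)"
    "\<And>x. x \<in> U \<Longrightarrow> H.b x = M * cos (\<alpha>1 * x $ 1 + \<alpha>3 * x $ 3 + \<xi>0)" "\<And>x. x \<in> U \<Longrightarrow> H.w x = - (M / lam2)\<^sup>2"
    using H.invariants[OF False] by auto
  obtain \<theta>1 \<theta>2 e f' g h where sv: "e * e + f' * f' = 1" "g * g + h * h = 1"
    "e * \<theta>1 = \<alpha>1 * g + M * h" "g * \<theta>1 = \<alpha>1 * e" "h * \<theta>1 = \<alpha>3 * f' + M * e" "f' * \<theta>1 = \<alpha>3 * h"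
    "f' * \<theta>2 = \<alpha>1 * h - M * g" "h * \<theta>2 = \<alpha>1 * f'" "g * \<theta>2 = \<alpha>3 * e - M * f'" "e * \<theta>2 = \<alpha>3 * g"
    "\<theta>1 \<noteq> \<theta>2" "\<theta>1 \<noteq> - \<theta>2"
    by (rule singular_value_rotation[OF M(1), of \<alpha>1 \<alpha>3])
  interpret S: model_surface \<alpha>1 \<alpha>3 \<xi>0 M \<theta>1 \<theta>2 e f' g h
    by unfold_locales (fact M(1) sv)+
  have lam2: "lam2 \<noteq> 0" by (rule H.nz(1))
  have coord: "smooth_on U (\<lambda>x. x $ 1)" "smooth_on U (\<lambda>x. x $ 3)"
    by (rule smooth_on_component[OF assms(1)])+
  note pd_frame3 = S.pd_frame[OF differentiable_coordinate differentiable_coordinate, of _ _ 1 3]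
  have system:
    "pd 1 (\<lambda>x. S.u i (x $ 1) (x $ 3)) x = \<alpha>1 * S.v i (x $ 1) (x $ 3) + M * S.y i (x $ 1) (x $ 3)"
    "pd 1 (\<lambda>x. S.v i (x $ 1) (x $ 3)) x = - \<alpha>1 * S.u i (x $ 1) (x $ 3)"
    "pd 1 (\<lambda>x. S.y i (x $ 1) (x $ 3)) x = \<alpha>3 * S.z i (x $ 1) (x $ 3) - M * S.u i (x $ 1) (x $ 3)"
    "pd 1 (\<lambda>x. S.z i (x $ 1) (x $ 3)) x = - \<alpha>3 * S.y i (x $ 1) (x $ 3)"
    "pd 2 (\<lambda>x. S.u i (x $ 1) (x $ 3)) x = 0" "pd 2 (\<lambda>x. S.v i (x $ 1) (x $ 3)) x = 0"
    "pd 2 (\<lambda>x. S.y i (x $ 1) (x $ 3)) x = 0" "pd 2 (\<lambda>x. S.z i (x $ 1) (x $ 3)) x = 0"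
    "pd 3 (\<lambda>x. S.u i (x $ 1) (x $ 3)) x = \<alpha>3 * S.v i (x $ 1) (x $ 3)"
    "pd 3 (\<lambda>x. S.v i (x $ 1) (x $ 3)) x = - \<alpha>3 * S.u i (x $ 1) (x $ 3) - M * S.z i (x $ 1) (x $ 3)"
    "pd 3 (\<lambda>x. S.y i (x $ 1) (x $ 3)) x = \<alpha>1 * S.z i (x $ 1) (x $ 3)"
    "pd 3 (\<lambda>x. S.z i (x $ 1) (x $ 3)) x = M * S.v i (x $ 1) (x $ 3) - \<alpha>1 * S.y i (x $ 1) (x $ 3)"
    for i and x :: "real^3"
    by (simp_all add: pd_frame3 pd_coordinate)
  obtain \<epsilon> \<nu> \<nu>' where \<epsilon>: "\<And>i j. lor (\<epsilon> i) (\<epsilon> j) = (if i = j then 1 else 0)"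
    "lor \<nu> \<nu> = 0" "lor \<nu>' \<nu>' = 0" "lor \<nu> \<nu>' = - 2" "\<And>i. lor (\<epsilon> i) \<nu> = 0" "\<And>i. lor (\<epsilon> i) \<nu>' = 0"
    and F\<epsilon>: "\<And>x i. x \<in> U \<Longrightarrow> lor (F x) (\<epsilon> i) = (lam2 / M) *
      (cos (\<alpha>1 * x $ 1 + \<alpha>3 * x $ 3 + \<xi>0) * S.u i (x $ 1) (x $ 3) - sin (\<alpha>1 * x $ 1 + \<alpha>3 * x $ 3 + \<xi>0) * S.v i (x $ 1) (x $ 3))"
    and F\<nu>: "\<And>x. x \<in> U \<Longrightarrow> lor (F x) \<nu> = - (lam2 / M) * exp (- M * x $ 2)"
    by (rule H.reconstruction[of M "\<lambda>i x. S.u i (x $ 1) (x $ 3)" "\<lambda>i x. S.v i (x $ 1) (x $ 3)"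
          "\<lambda>i x. S.y i (x $ 1) (x $ 3)" "\<lambda>i x. S.z i (x $ 1) (x $ 3)"])
      (assumption | rule M False S.frame_columns S.smooth_frame[OF assms(1) coord] system | blast)+
  let ?\<Phi> = "\<lambda>P. cone_projection \<epsilon> \<nu> (lift K P)" and ?\<Omega> = "{P. lor (lift K P) \<nu> \<noteq> 0}"
  let ?h = "cone_chart M" and ?V = "snd ` cone_chart M ` U"
  have lift: "lift K (f x) = exp (u x) *\<^sub>R F x" for x by (simp add: F exp_minus)
  have f_\<Omega>: "f ` U \<subseteq> ?\<Omega>" using M(1) lam2 by (auto simp: lift lor_simps F\<nu>)
  have \<Phi>f: "?\<Phi> (f x) = (\<lambda>(t, v). t *\<^sub>R S.surface v) (?h x)" if "x \<in> U" for x
    using M(1) lam2 by (simp add: cone_projection_def cone_chart_def S.surface_def S.angle_def vec_eq_iff lift lor_simps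
        F\<epsilon>[OF that] F\<nu>[OF that] exp_minus field_simps)
  have diffeo: "diffeomorphism_between ?h U (?h ` U)"
    by (rule cone_chart_diffeomorphism[OF M(1) assms(1)])
  have V_regular: "?V \<subseteq> S.regular"
    using H.nz(4,5) by (auto simp: S.regular_def S.angle_def cone_chart_def)
  have "open ?V" using diffeo by (auto simp: diffeomorphism_between_def intro: open_image_snd)
  have "connected ?V"
    using diffeo smooth_on_continuous
    by (intro connected_continuous_image continuous_intros assms(2)) (auto simp: diffeomorphism_between_def)
  obtain k where k: "?V \<subseteq> S.strip k"
    using S.connected_regular_subset_strip[OF \<open>connected ?V\<close> V_regular] False by auto
  define a b where "a = \<theta>1 * \<alpha>3 - \<theta>2 * \<alpha>1" and "b = \<theta>2 * \<alpha>3 - \<theta>1 * \<alpha>1"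
  \<comment> \<open>The factorisations show when the motion degenerates: exactly for \<open>\<alpha>1 = \<plusminus> \<alpha>3\<close>.\<close>
  have ab: "a - b = (\<theta>1 - \<theta>2) * (\<alpha>1 + \<alpha>3)" "a + b = (\<theta>1 + \<theta>2) * (\<alpha>3 - \<alpha>1)"
    by (simp_all add: a_def b_def algebra_simps)
  have ab0: "\<alpha>1 \<noteq> - \<alpha>3 \<Longrightarrow> a - b \<noteq> 0" "\<alpha>1 \<noteq> \<alpha>3 \<Longrightarrow> a + b \<noteq> 0"
    unfolding ab using sv(11,12) by (simp_all add: eq_neg_iff_add_eq_0)
  have "(a, b) \<noteq> (0, 0)" using ab0 \<alpha>0 by (cases "\<alpha>1 = \<alpha>3") auto
  moreover have "\<alpha>1 \<noteq> \<alpha>3 \<and> \<alpha>1 \<noteq> - \<alpha>3 \<longrightarrow> a \<noteq> b \<and> a \<noteq> - b" using ab0 by auto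
  moreover have "conformally_equivalent K f U (\<lambda>(t, v). t *\<^sub>R S.surface v) (?h ` U)"
    unfolding conformally_equivalent_def
    by (rule exI[of _ ?h], rule exI[of _ ?\<Phi>], rule exI[of _ ?\<Omega>])
      (intro conjI ballI diffeo cone_projection_conformal[OF \<epsilon>] f_\<Omega> \<Phi>f)
  moreover have "?h ` U \<subseteq> {0<..} \<times> ?V" by (force simp: cone_chart_def)
  moreover have "(\<forall>x\<in>U. \<forall>s. x + s *\<^sub>R axis 2 1 \<in> U) \<longrightarrow> ?h ` U = {0<..} \<times> ?V"
    using cone_chart_image_cylinder[OF M(1)] by blast
  moreover have "spherical_surface S.surface ?V"
    by (rule S.spherical_surface[OF \<open>open ?V\<close> \<open>connected ?V\<close> V_regular])
  moreover have "flat_surface S.surface (S.strip k)"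
    by (rule S.flat_surface[OF S.open_strip S.connected_strip S.strip_subset_regular])
  moreover have "invariant_under_motions a b (S.surface ` S.strip k)"
    unfolding a_def b_def by (rule S.strip_invariant)
  moreover have "locally_congruent S.surface ?V S.surface (S.strip k)"
    by (rule locally_congruent_restriction[OF \<open>open ?V\<close> k])
  ultimately show ?thesis
    by - (rule exI[of _ S.surface], rule exI[of _ ?V], rule exI[of _ "?h ` U"], rule exI[of _ S.surface],
        rule exI[of _ "S.strip k"], rule exI[of _ a], rule exI[of _ b], (intro conjI refl; assumption))
qed

end
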